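(* Let $\{\xi_{j,n}:1\le j\le n\}$ be a centered triangular array as in the context. Suppose that $\sigma_n\to\infty$, that the $\xi_{j,n}$ are bounded, and that $\phi_n(j)\le B_ne^{-a_nj^\eta}$ (for all $n$ and $1\le j\le n$) for some sequences $a_n>0$, $B_n\ge1$ such that $(a_n)$ is bounded, and a constant $\eta>0$. Fix an arbitrary $u>1$ and set $$R_n=A_n(K_{\infty,n}j_n+1)B_ne^{a_n^{-u}},\qquad K_{\infty,n}=\max_{j\le n}\|\xi_{j,n}\|_{L^\infty}.$$ Assume that $R_n=o(\sigma_n^{1/3})$. Let $(t_n)$ be a sequence such that $\lim_{n\to\infty}t_n=\infty$ and $\lim_{n\to\infty}t_n(R_n^{-3}\sigma_n)^{-\frac1{1+2\gamma}}=0$, where $\gamma=\eta^{-1}$. Set $W_n=\frac{S_n}{\sigma_nt_n}$ and $I(x)=x^2/2$. Then for every Borel measurable set $\Gamma\subset\mathbb R$, $$-\inf_{x\in\Gamma^o}I(x)\le\liminf_{n\to\infty}\frac1{t_n^2}\ln\mathbb P(W_n\in\Gamma)\le\limsup_{n\to\infty}\frac1{t_n^2}\ln\mathbb P(W_n\in\Gamma)\le-\inf_{x\in\bar\Gamma}I(x),$$ where $\Gamma^o$ is the interior of $\Gamma$ and $\bar\Gamma$ its closure.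
   Context: Setting. For each $n$, $\zeta_{1,n},\dots,\zeta_{n,n}$ are random variables on a probability space $(\Omega,\mathcal F,\mathbb P)$ taking values in measurable spaces; $\xi_{j,n}=g_{j,n}(\zeta_{j,n})$ with $g_{j,n}$ real-valued measurable, $\mathbb E[\xi_{j,n}]=0$; $S_n=\sum_{j=1}^n\xi_{j,n}$, $\sigma_n=\sqrt{\mathrm{Var}(S_n)}$, $K_{r,n}=\max_{1\le j\le n}\|\xi_{j,n}\|_{L^r}$. Mixing. $\alpha(\mathcal G,\mathcal H)=\sup\{|\mathbb P(A\cap B)-\mathbb P(A)\mathbb P(B)|:A\in\mathcal G,B\in\mathcal H\}$, $\phi(\mathcal G,\mathcal H)=\sup\{|\mathbb P(B|A)-\mathbb P(B)|:A\in\mathcal G,B\in\mathcal H,\mathbb P(A)>0\}$. For $k\le n$, $\alpha_n(k)$ (resp. $\phi_n(k)$) is the supremum over $s\le n-k$ of $\alpha$ (resp. $\phi$) of the pair $\sigma\{\zeta_{j,n}:j\le s\}$, $\sigma\{\zeta_{j,n}:s+k\le j\le n\}$. Sequences. Fix $2<p<q$. $\Gamma_n(x)=\sum_{x\le j\le n}(\alpha_n(j))^{1/p-1/q}$; $\Gamma_n^{-1}(y)$ is the smallest positive integer $m$ with $\Gamma_n(m)\le y$; $r_n=\max\big(\Gamma_n^{-1}(\tfrac1{8K_{q,n}}),1\big)$; $A_n=18r_n(1+K_{2,n})$. $(j_n)$ is a sequence of positive integers $j_n<n$ such that $\phi_n(j_n)<\frac12-\varepsilon$ for some constant $\varepsilon>0$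 not depending on $n$. *)

theory Defs
  imports "HOL-Probability.Probability" "HOL-Library.Landau_Symbols"
begin

text \<open>
  Row \<open>n\<close> of a triangular array is a family \<open>Z j\<close>, \<open>j \<in> {1..n}\<close>; the definitions below take
  a single row, so \<open>Z j\<close> is $\zeta_{j,n}$ with values in the measurable space \<open>N j\<close>, and \<open>X j\<close> is
  $\xi_{j,n}$. Values outside \<open>{1..n}\<close> are never used.
\<close>

definition Lr_norm :: "real \<Rightarrow> 'a measure \<Rightarrow> ('a \<Rightarrow> real) \<Rightarrow> real" where
  "Lr_norm r M f = (\<integral>\<omega>. \<bar>f \<omega>\<bar> powr r \<partial>M) powr (1 / r)"

definition Linf_norm :: "'a measure \<Rightarrow> ('a \<Rightarrow> real) \<Rightarrow> ereal" where
  "Linf_norm M f = esssup M (\<lambda>\<omega>. ereal \<bar>f \<omega>\<bar>)"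

definition row_sum :: "(nat \<Rightarrow> 'a \<Rightarrow> real) \<Rightarrow> nat \<Rightarrow> 'a \<Rightarrow> real" where
  "row_sum X n \<omega> = (\<Sum>j=1..n. X j \<omega>)"

definition row_sd :: "'a measure \<Rightarrow> (nat \<Rightarrow> 'a \<Rightarrow> real) \<Rightarrow> nat \<Rightarrow> real" where
  "row_sd M X n = sqrt (prob_space.variance M (row_sum X n))"

definition row_K :: "real \<Rightarrow> 'a measure \<Rightarrow> (nat \<Rightarrow> 'a \<Rightarrow> real) \<Rightarrow> nat \<Rightarrow> real" where
  "row_K r M X n = Max ((\<lambda>j. Lr_norm r M (X j)) ` {1..n})"

definition row_Kinf :: "'a measure \<Rightarrow> (nat \<Rightarrow> 'a \<Rightarrow> real) \<Rightarrow> nat \<Rightarrow> real" where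
  "row_Kinf M X n = Max ((\<lambda>j. real_of_ereal (Linf_norm M (X j))) ` {1..n})"

definition alpha_coeff :: "'a measure \<Rightarrow> 'a set set \<Rightarrow> 'a set set \<Rightarrow> real" where
  "alpha_coeff M G H =
     Sup {\<bar>measure M (A \<inter> B) - measure M A * measure M B\<bar> | A B. A \<in> G \<and> B \<in> H}"

definition phi_coeff :: "'a measure \<Rightarrow> 'a set set \<Rightarrow> 'a set set \<Rightarrow> real" where
  "phi_coeff M G H =
     Sup {\<bar>measure M (A \<inter> B) / measure M A - measure M B\<bar> | A B.
            A \<in> G \<and> B \<in> H \<and> measure M A > 0}"

definition sigma_gen ::
    "'a measure \<Rightarrow> (nat \<Rightarrow> 'b measure) \<Rightarrow> (nat \<Rightarrow> 'a \<Rightarrow> 'b) \<Rightarrow> nat set \<Rightarrow> 'a set set" where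
  "sigma_gen M N Z J =
     sigma_sets (space M) (\<Union>j\<in>J. {Z j -` C \<inter> space M | C. C \<in> sets (N j)})"

text \<open>
  The suprema include \<open>s = 0\<close>. There the first sigma-algebra is trivial and the coefficient is
  \<open>0\<close>, so for \<open>k < n\<close> this changes nothing, while for \<open>k = n\<close> (where no \<open>s \<ge> 1\<close> is admissible)
  it gives the value \<open>0\<close>.
\<close>

definition row_alpha ::
    "'a measure \<Rightarrow> (nat \<Rightarrow> 'b measure) \<Rightarrow> (nat \<Rightarrow> 'a \<Rightarrow> 'b) \<Rightarrow> nat \<Rightarrow> nat \<Rightarrow> real" where
  "row_alpha M N Z n k =
     (SUP s\<in>{0..n - k}. alpha_coeff M (sigma_gen M N Z {1..s}) (sigma_gen M N Z {s + k..n}))"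

definition row_phi ::
    "'a measure \<Rightarrow> (nat \<Rightarrow> 'b measure) \<Rightarrow> (nat \<Rightarrow> 'a \<Rightarrow> 'b) \<Rightarrow> nat \<Rightarrow> nat \<Rightarrow> real" where
  "row_phi M N Z n k =
     (SUP s\<in>{0..n - k}. phi_coeff M (sigma_gen M N Z {1..s}) (sigma_gen M N Z {s + k..n}))"

definition row_Gamma ::
    "real \<Rightarrow> real \<Rightarrow> 'a measure \<Rightarrow> (nat \<Rightarrow> 'b measure) \<Rightarrow> (nat \<Rightarrow> 'a \<Rightarrow> 'b) \<Rightarrow> nat \<Rightarrow> nat \<Rightarrow> real" where
  "row_Gamma p q M N Z n m = (\<Sum>j=m..n. row_alpha M N Z n j powr (1 / p - 1 / q))"

text \<open>For \<open>y \<ge> 0\<close> the minimum exists, since \<open>row_Gamma\<close> is an empty sum at \<open>m = n + 1\<close>.\<close>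

definition row_Gamma_inv ::
    "real \<Rightarrow> real \<Rightarrow> 'a measure \<Rightarrow> (nat \<Rightarrow> 'b measure) \<Rightarrow> (nat \<Rightarrow> 'a \<Rightarrow> 'b) \<Rightarrow> nat \<Rightarrow> real \<Rightarrow> nat" where
  "row_Gamma_inv p q M N Z n y = (LEAST m. m > 0 \<and> row_Gamma p q M N Z n m \<le> y)"

definition row_r ::
    "real \<Rightarrow> real \<Rightarrow> 'a measure \<Rightarrow> (nat \<Rightarrow> 'b measure) \<Rightarrow> (nat \<Rightarrow> 'a \<Rightarrow> 'b) \<Rightarrow>
     (nat \<Rightarrow> 'a \<Rightarrow> real) \<Rightarrow> nat \<Rightarrow> nat" where
  "row_r p q M N Z X n = max (row_Gamma_inv p q M N Z n (1 / (8 * row_K q M X n))) 1"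

definition row_A ::
    "real \<Rightarrow> real \<Rightarrow> 'a measure \<Rightarrow> (nat \<Rightarrow> 'b measure) \<Rightarrow> (nat \<Rightarrow> 'a \<Rightarrow> 'b) \<Rightarrow>
     (nat \<Rightarrow> 'a \<Rightarrow> real) \<Rightarrow> nat \<Rightarrow> real" where
  "row_A p q M N Z X n = 18 * real (row_r p q M N Z X n) * (1 + row_K 2 M X n)"

text \<open>Logarithm of a probability, with \<open>ln 0 = -\<infinity>\<close> (the library has \<open>ln 0 = 0\<close> on the reals).\<close>

definition eln :: "real \<Rightarrow> ereal" where
  "eln x = (if x = 0 then -\<infinity> else ereal (ln x))"

end

theory Submission
  imports Defs
begin

text \<open>
  Let \<open>M\<^sub>j = E(S | F\<^sub>j)\<close> for the partial sum \<open>S\<close> of a row. By \<open>\<phi>\<close>-mixing the increments of this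
  martingale are bounded by a multiple of \<open>K\<^sub>\<infinity> \<Sum>\<^sub>l \<phi>(l)\<^sup>1\<^sup>/\<^sup>2\<close>, and the conditional variance \<open>P\<^sub>j\<close> of
  \<open>S\<close> given \<open>F\<^sub>j\<close> differs from its mean by at most the square of such a bound, uniformly in \<open>n\<close>.
  Exponential potentials in \<open>M\<^sub>j\<close> and \<open>P\<^sub>j\<close> then give
  \<open>ln E exp(\<theta> S) = (1/2 + o(1)) \<theta>\<^sup>2 \<sigma>\<^sup>2\<close> as soon as \<open>\<theta>\<close> times this bound tends to \<open>0\<close>.
  For \<open>\<theta> = l t\<^sub>n / \<sigma>\<^sub>n\<close> the bound is controlled by \<open>R\<^sub>n\<close>, because \<open>exp(a\<^sub>n\<^sup>-\<^sup>u)\<close> absorbs every power of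
  \<open>1 / a\<^sub>n\<close>, and \<open>t\<^sub>n R\<^sub>n / \<sigma>\<^sub>n\<close> tends to \<open>0\<close>. The limit of the scaled Laplace transforms
  yields the deviation principle by Chebyshev's inequality and exponential tilting.
\<close>

section \<open>Laplace transforms of martingales with nearly deterministic conditional variance\<close>

text \<open>The conditional variance \<open>P j\<close> of what is still to come is the remedy: by
  the law of total variance \<open>P (j - 1)\<close> is the conditional mean of \<open>P j\<close>
  plus the square of the increment \<open>d j\<close>. In exp(M_j + c (P_j - E P_j)) with c near
  1/2, the random second-order term of one step is thus traded for the number E (d j)^2, and these
  numbers add up to the variance. The centred \<open>P\<close> vanishes at time 0, where the past is
  trivial, and at time n, where nothing is left, so the correction costs nothing at the ends. The
  price is the squared jump of \<open>P\<close>: the increment of (P_j - E P_j)^2 cancels it up to a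
  small predictable multiple of the jump itself.\<close>

lemma exp_quadratic_remainder:
  fixes x :: real
  assumes "\<bar>x\<bar> \<le> 1"
  shows "\<bar>exp x - (1 + x + x\<^sup>2 / 2)\<bar> \<le> \<bar>x\<bar> * x\<^sup>2"
proof -
  obtain y where y: "\<bar>y\<bar> \<le> \<bar>x\<bar>" "exp x = (\<Sum>m<3. x ^ m / fact m) + exp y / fact 3 * x ^ 3"
    using Maclaurin_exp_le[of x 3] by blast
  have eq: "exp x - (1 + x + x\<^sup>2 / 2) = exp y / 6 * x ^ 3"
    using y(2) by (simp add: eval_nat_numeral)
  have "exp y \<le> exp 1"
    using y(1) assms by simp
  also have "\<dots> \<le> 3"
    by (rule exp_le)
  finally have "exp y / 6 \<le> 1"
    by simp
  then have "exp y / 6 * \<bar>x ^ 3\<bar> \<le> 1 * \<bar>x ^ 3\<bar>"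
    by (intro mult_right_mono) auto
  then show ?thesis
    unfolding eq by (simp add: abs_mult power_abs eval_nat_numeral)
qed

text \<open>A weighted Young inequality, read off from the square of
  \<open>\<epsilon> * \<bar>d\<bar> - 4 * \<bar>e\<bar>\<close>. The weights keep the share of
  \<open>d\<^sup>2\<close> small and put the large factor on \<open>e\<^sup>2\<close>.\<close>

lemma abs_scaled_product_le:
  fixes d e \<epsilon> :: real
  assumes "\<epsilon> > 0"
  shows "2 * \<bar>d * e\<bar> \<le> \<epsilon> / 4 * d\<^sup>2 + 4 / \<epsilon> * e\<^sup>2"
proof -
  have "0 \<le> (\<epsilon> * \<bar>d\<bar> - 4 * \<bar>e\<bar>)\<^sup>2 / (4 * \<epsilon>)"
    using assms by simp
  also have "\<dots> = \<epsilon> / 4 * d\<^sup>2 + 4 / \<epsilon> * e\<^sup>2 - 2 * \<bar>d * e\<bar>"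
    using assms by (simp add: power2_diff abs_mult field_simps power2_eq_square)
  finally show ?thesis by simp
qed

text \<open>Taylor expansion to second order in \<open>d\<close>, with the jump \<open>r - q\<close>
  kept to first order and its square booked as an error. The factor \<open>\<kappa>\<close> is left
  free because in the application it depends on \<open>r\<close> and \<open>q\<close>.\<close>

lemma exp_step_bounds:
  fixes d q r s \<epsilon> \<kappa> :: real
  assumes eps: "0 < \<epsilon>" "\<epsilon> \<le> 1/4" and s: "s \<le> \<epsilon> / 100"
    and d: "\<bar>d\<bar> \<le> s" and q: "\<bar>q\<bar> \<le> s\<^sup>2" and r: "\<bar>r\<bar> \<le> s\<^sup>2"
    and k: "\<bar>\<kappa>\<bar> \<le> 1"
  defines "x \<equiv> d + \<kappa> * (r - q)"
  shows "exp x \<le> 1 + x + (1/2 + \<epsilon>/4) * d\<^sup>2 + 20 / \<epsilon> * (r - q)\<^sup>2"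
    and "exp x \<ge> 1 + x + (1/2 - \<epsilon>/4) * d\<^sup>2 - 20 / \<epsilon> * (r - q)\<^sup>2"
proof -
  have s0: "0 \<le> s" using d by linarith
  define e where "e = \<kappa> * (r - q)"
  have e2: "e\<^sup>2 \<le> (r - q)\<^sup>2"
    using k unfolding e_def power_mult_distrib
    by (intro mult_left_le_one_le) (auto simp: abs_square_le_1)
  have s2: "s\<^sup>2 \<le> s / 100"
  proof -
    have "s * s \<le> s * (1 / 100)"
      using s eps s0 by (intro mult_left_mono) auto
    then show ?thesis by (simp add: power2_eq_square)
  qed
  have "\<bar>e\<bar> \<le> 1 * \<bar>r - q\<bar>"
    unfolding e_def abs_mult using k by (intro mult_right_mono) auto
  moreover have "\<bar>r - q\<bar> \<le> 2 * s\<^sup>2"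
    using q r by linarith
  moreover have "\<bar>x\<bar> \<le> \<bar>d\<bar> + \<bar>e\<bar>"
    unfolding x_def e_def by (rule abs_triangle_ineq)
  ultimately have "\<bar>x\<bar> \<le> s + 2 * s\<^sup>2"
    using d by argo
  \<comment> \<open>The threshold \<open>\<epsilon> / 100\<close> for \<open>s\<close> is chosen so
    that the cubic remainder costs at most \<open>\<epsilon> / 32\<close> times
    \<open>x\<^sup>2\<close>.\<close>
  then have x: "\<bar>x\<bar> \<le> \<epsilon> / 32"
    using s s2 s0 eps by linarith
  have rem: "\<bar>exp x - (1 + x + x\<^sup>2 / 2)\<bar> \<le> \<epsilon> / 32 * x\<^sup>2"
    using exp_quadratic_remainder[of x] x eps mult_right_mono[OF x, of "x\<^sup>2"] by fastforce
  have xe: "x\<^sup>2 = d\<^sup>2 + 2 * (d * e) + e\<^sup>2"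
    unfolding x_def e_def by (simp add: power2_sum)
  have prod: "2 * \<bar>d * e\<bar> \<le> \<epsilon> / 4 * d\<^sup>2 + 4 / \<epsilon> * e\<^sup>2"
    by (rule abs_scaled_product_le[OF eps(1)])
  have up: "x\<^sup>2 \<le> (1 + \<epsilon> / 4) * d\<^sup>2 + (1 + 4 / \<epsilon>) * e\<^sup>2"
    using prod abs_ge_self[of "d * e"] unfolding xe distrib_right by linarith
  have lo: "x\<^sup>2 \<ge> (1 - \<epsilon> / 4) * d\<^sup>2 - 4 / \<epsilon> * e\<^sup>2"
    using prod abs_ge_minus_self[of "d * e"] zero_le_power2[of e] unfolding xe left_diff_distrib by linarith
  have "exp x \<le> 1 + x + (1/2 + \<epsilon>/32) * x\<^sup>2"
    using abs_le_D1[OF rem] unfolding distrib_right by linarith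
  also have "(1/2 + \<epsilon>/32) * x\<^sup>2 \<le> (1/2 + \<epsilon>/32) * ((1 + \<epsilon> / 4) * d\<^sup>2 + (1 + 4 / \<epsilon>) * e\<^sup>2)"
    using up eps by (intro mult_left_mono) auto
  also have "\<dots> = ((1/2 + \<epsilon>/32) * (1 + \<epsilon> / 4)) * d\<^sup>2 + ((1/2 + \<epsilon>/32) * (1 + 4 / \<epsilon>)) * e\<^sup>2"
    by (simp only: distrib_left[of _ "_ * _" "_ * _"] mult.assoc)
  also have "\<dots> \<le> (1/2 + \<epsilon>/4) * d\<^sup>2 + 20 / \<epsilon> * (r - q)\<^sup>2"
  proof (intro add_mono mult_mono e2 order_refl)
    have "\<epsilon> * \<epsilon> \<le> \<epsilon> * 1" using eps by (intro mult_left_mono) auto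
    moreover have "(1/2 + \<epsilon>/32) * (1 + \<epsilon> / 4) = 1/2 + \<epsilon> * 5 / 32 + \<epsilon> * \<epsilon> / 128"
      by (simp add: algebra_simps add_divide_distrib)
    ultimately show "(1/2 + \<epsilon>/32) * (1 + \<epsilon> / 4) \<le> 1/2 + \<epsilon>/4"
      using eps(1) by linarith
    have "(1/2 + \<epsilon>/32) * (1 + 4 / \<epsilon>) \<le> 1 * (1 + 4 / \<epsilon>)"
      using eps by (intro mult_right_mono) auto
    also have "\<dots> \<le> 20 / \<epsilon>"
      using eps by (simp add: field_simps)
    finally show "(1/2 + \<epsilon>/32) * (1 + 4 / \<epsilon>) \<le> 20 / \<epsilon>" .
  qed (use eps in auto)
  finally show "exp x \<le> 1 + x + (1/2 + \<epsilon>/4) * d\<^sup>2 + 20 / \<epsilon> * (r - q)\<^sup>2"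
    by simp
  have "(1/2 - \<epsilon>/4) * d\<^sup>2 - 20 / \<epsilon> * (r - q)\<^sup>2 \<le>
      ((1/2 - \<epsilon>/32) * (1 - \<epsilon> / 4)) * d\<^sup>2 - ((1/2 - \<epsilon>/32) * (4 / \<epsilon>)) * e\<^sup>2"
  proof (intro diff_mono mult_mono e2 order_refl)
    have "0 \<le> \<epsilon> * \<epsilon>" by simp
    then show "1/2 - \<epsilon>/4 \<le> (1/2 - \<epsilon>/32) * (1 - \<epsilon> / 4)"
      using eps(1) by (simp add: algebra_simps add_divide_distrib diff_divide_distrib)
    have "(1/2 - \<epsilon>/32) * (4 / \<epsilon>) \<le> 1 * (4 / \<epsilon>)"
      using eps by (intro mult_right_mono) auto
    also have "\<dots> \<le> 20 / \<epsilon>"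
      using eps by (simp add: field_simps)
    finally show "(1/2 - \<epsilon>/32) * (4 / \<epsilon>) \<le> 20 / \<epsilon>" .
  qed (use eps in auto)
  also have "\<dots> = (1/2 - \<epsilon>/32) * ((1 - \<epsilon> / 4) * d\<^sup>2 - 4 / \<epsilon> * e\<^sup>2)"
    by (simp only: right_diff_distrib[of _ "_ * _" "_ * _"] mult.assoc)
  also have "\<dots> \<le> (1/2 - \<epsilon>/32) * x\<^sup>2"
    using lo eps by (intro mult_left_mono) auto
  finally show "exp x \<ge> 1 + x + (1/2 - \<epsilon>/4) * d\<^sup>2 - 20 / \<epsilon> * (r - q)\<^sup>2"
    using abs_le_D2[OF rem] left_diff_distrib[of "1/2" "\<epsilon>/32" "x\<^sup>2"] by linarith
qed

text \<open>Since \<open>r\<^sup>2 - q\<^sup>2 = (r - q) * (r + q)\<close>, the exponent has the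
  form required by \<open>exp_step_bounds\<close>. Its error
  \<open>20 / \<epsilon> * (r - q)\<^sup>2\<close> then cancels exactly against the quadratic term,
  because \<open>(r - q)\<^sup>2 - (r\<^sup>2 - q\<^sup>2) = - 2 * q * (r - q)\<close>. What remains
  is a change of the coefficient of \<open>r - q\<close> that depends on the earlier value
  \<open>q\<close> only.\<close>

lemma potential_step_bounds:
  fixes d q r s \<epsilon> :: real
  assumes eps: "0 < \<epsilon>" "\<epsilon> \<le> 1/4" and s: "s \<le> \<epsilon> / 100"
    and d: "\<bar>d\<bar> \<le> s" and q: "\<bar>q\<bar> \<le> s\<^sup>2" and r: "\<bar>r\<bar> \<le> s\<^sup>2"
  shows "exp (d + (1/2 + \<epsilon>/2) * (r - q) - 20 / \<epsilon> * (r\<^sup>2 - q\<^sup>2))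
      \<le> 1 + d + (1/2 + \<epsilon>/2 - 40 / \<epsilon> * q) * (r - q) + (1/2 + \<epsilon>/4) * d\<^sup>2" (is ?U)
    and "exp (d + (1/2 - \<epsilon>/2) * (r - q) + 20 / \<epsilon> * (r\<^sup>2 - q\<^sup>2))
      \<ge> 1 + d + (1/2 - \<epsilon>/2 + 40 / \<epsilon> * q) * (r - q) + (1/2 - \<epsilon>/4) * d\<^sup>2" (is ?L)
    and "\<bar>40 / \<epsilon> * q\<bar> \<le> \<epsilon> / 4"
proof -
  have s0: "0 \<le> s" using d by linarith
  have "s\<^sup>2 \<le> (\<epsilon> / 100)\<^sup>2"
    using s s0 by (intro power_mono)
  then have s2: "s\<^sup>2 \<le> \<epsilon> * \<epsilon> / 10000"
    by (simp add: power2_eq_square)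
  have small: "\<bar>20 / \<epsilon> * y\<bar> \<le> \<epsilon> / 4" if "\<bar>y\<bar> \<le> 2 * s\<^sup>2" for y
  proof -
    have "\<bar>20 / \<epsilon> * y\<bar> = 20 / \<epsilon> * \<bar>y\<bar>"
      using eps by (simp add: abs_mult)
    also have "\<dots> \<le> 20 / \<epsilon> * (\<epsilon> * \<epsilon> / 5000)"
      using that s2 eps by (intro mult_left_mono) auto
    also have "\<dots> \<le> \<epsilon> / 4"
      using eps by simp
    finally show ?thesis .
  qed
  show "\<bar>40 / \<epsilon> * q\<bar> \<le> \<epsilon> / 4"
    using small[of "2 * q"] q by simp
  define k where "k = 20 / \<epsilon>"
  have k2: "40 / \<epsilon> = 2 * k"
    by (simp add: k_def)
  have rq: "\<bar>20 / \<epsilon> * (r + q)\<bar> \<le> \<epsilon> / 4"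
    using q r by (intro small) linarith
  have "\<bar>1/2 + \<epsilon>/2 - 20 / \<epsilon> * (r + q)\<bar> \<le> 1"
    using rq eps by linarith
  from exp_step_bounds(1)[OF eps s d q r this] show ?U
    unfolding k_def[symmetric] k2 by (simp add: algebra_simps power2_eq_square)
  have "\<bar>1/2 - \<epsilon>/2 + 20 / \<epsilon> * (r + q)\<bar> \<le> 1"
    using rq eps by linarith
  from exp_step_bounds(2)[OF eps s d q r this] show ?L
    unfolding k_def[symmetric] k2 by (simp add: algebra_simps power2_eq_square)
qed

text \<open>
  \<open>V j\<close> stands for the centred conditional variance of \<open>d (j + 1) + \<dots> + d n\<close> given \<open>F j\<close>. Its
  fluctuations, of size \<open>E (V j - V (j - 1))\<^sup>2\<close>, are not controlled by \<open>E (d j)\<^sup>2\<close>. The quadratic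
  term in the exponential potential \<open>L\<close> of the proof absorbs them.
\<close>

lemma (in prob_space) martingale_laplace_bounds:
  fixes F :: "nat \<Rightarrow> 'a measure" and d V :: "nat \<Rightarrow> 'a \<Rightarrow> real" and v :: "nat \<Rightarrow> real"
  assumes eps: "0 < \<epsilon>" "\<epsilon> \<le> 1/4" and s: "s \<le> \<epsilon> / 100"
    and subF: "\<And>j. subalgebra M (F j)"
    and monoF: "\<And>i j. i \<le> j \<Longrightarrow> sets (F i) \<subseteq> sets (F j)"
    and dF: "\<And>j. 1 \<le> j \<Longrightarrow> j \<le> n \<Longrightarrow> d j \<in> borel_measurable (F j)"
    and VF: "\<And>j. j \<le> n \<Longrightarrow> V j \<in> borel_measurable (F j)"
    and d_le: "\<And>j \<omega>. 1 \<le> j \<Longrightarrow> j \<le> n \<Longrightarrow> \<bar>d j \<omega>\<bar> \<le> s"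
    and V_le: "\<And>j \<omega>. j \<le> n \<Longrightarrow> \<bar>V j \<omega>\<bar> \<le> s\<^sup>2"
    and V0: "\<And>\<omega>. \<omega> \<in> space M \<Longrightarrow> V 0 \<omega> = 0" and Vn: "\<And>\<omega>. \<omega> \<in> space M \<Longrightarrow> V n \<omega> = 0"
    and d_orth: "\<And>j g C. 1 \<le> j \<Longrightarrow> j \<le> n \<Longrightarrow> g \<in> borel_measurable (F (j - 1)) \<Longrightarrow>
       (\<And>\<omega>. \<bar>g \<omega>\<bar> \<le> C) \<Longrightarrow> expectation (\<lambda>\<omega>. g \<omega> * d j \<omega>) = 0"
    and V_orth: "\<And>j g C. 1 \<le> j \<Longrightarrow> j \<le> n \<Longrightarrow> g \<in> borel_measurable (F (j - 1)) \<Longrightarrow>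
       (\<And>\<omega>. \<bar>g \<omega>\<bar> \<le> C) \<Longrightarrow>
       expectation (\<lambda>\<omega>. g \<omega> * (V j \<omega> - V (j - 1) \<omega> + (d j \<omega>)\<^sup>2)) = v j * expectation g"
    and v: "\<And>j. 1 \<le> j \<Longrightarrow> j \<le> n \<Longrightarrow> v j = expectation (\<lambda>\<omega>. (d j \<omega>)\<^sup>2)"
  shows "expectation (\<lambda>\<omega>. exp (\<Sum>j=1..n. d j \<omega>)) \<le> exp ((1/2 + \<epsilon>) * (\<Sum>j=1..n. v j))"
    and "expectation (\<lambda>\<omega>. exp (\<Sum>j=1..n. d j \<omega>)) \<ge> exp ((1/2 - \<epsilon>) * (\<Sum>j=1..n. v j))"
proof -
  have s0: "0 \<le> s" if "1 \<le> n"
    using d_le[of 1 undefined] that by simp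
  have F_le: "f \<in> borel_measurable (F j)"
    if "f \<in> borel_measurable (F i)" "i \<le> j" for i j and f :: "'a \<Rightarrow> real"
    using that monoF[of i j] subF[of i] subF[of j]
    by (intro measurable_from_subalg[of "F j" "F i"]) (auto simp: subalgebra_def)
  have F_M: "f \<in> borel_measurable M" if "f \<in> borel_measurable (F i)" for i and f :: "'a \<Rightarrow> real"
    by (rule measurable_from_subalg[OF subF that])
  have int_bdd: "integrable M f"
    if "f \<in> borel_measurable (F i)" "\<And>\<omega>. \<bar>f \<omega>\<bar> \<le> C" for f :: "'a \<Rightarrow> real" and i C
    by (rule integrable_const_bound[where B = C]) (simp_all add: that F_M[OF that(1)])
  \<comment> \<open>The upper bound uses \<open>c = 1/2 + \<epsilon>/2\<close> and
    \<open>k = - 20 / \<epsilon>\<close>, the lower bound \<open>c = 1/2 - \<epsilon>/2\<close> and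
    \<open>k = 20 / \<epsilon>\<close>: the two exponents of
    \<open>potential_step_bounds\<close>.\<close>
  define L where "L c k j \<omega> = exp ((\<Sum>i=1..j. d i \<omega>) + c * V j \<omega> + k * (V j \<omega>)\<^sup>2)" for c k j \<omega>
  have LF: "L c k j \<in> borel_measurable (F j)" if "j \<le> n" for c k j
  proof -
    have [measurable]: "d i \<in> borel_measurable (F j)" if "i \<in> {1..j}" for i
      by (rule F_le[OF dF]) (use that \<open>j \<le> n\<close> in auto)
    have [measurable]: "V j \<in> borel_measurable (F j)"
      by (rule VF[OF that])
    show ?thesis
      unfolding L_def by measurable
  qed
  have L_pos: "0 < L c k j \<omega>" for c k j \<omega>
    by (simp add: L_def)
  have L_bdd: "\<exists>C. \<forall>\<omega>. \<bar>L c k j \<omega>\<bar> \<le> C" if "j \<le> n" for c k j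
  proof (intro exI allI)
    fix \<omega>
    have "(\<Sum>i=1..j. d i \<omega>) \<le> (\<Sum>i=1..j. s)"
      by (rule sum_mono, rule abs_le_D1, rule d_le) (use that in auto)
    moreover have "\<bar>c * V j \<omega>\<bar> \<le> \<bar>c\<bar> * s\<^sup>2"
      unfolding abs_mult by (rule mult_left_mono[OF V_le[OF that]]) simp
    moreover have "\<bar>k * (V j \<omega>)\<^sup>2\<bar> \<le> \<bar>k\<bar> * (s\<^sup>2)\<^sup>2"
      unfolding abs_mult power_abs
      by (rule mult_left_mono[OF power_mono[OF V_le[OF that]]]) simp_all
    ultimately show "\<bar>L c k j \<omega>\<bar> \<le> exp ((\<Sum>i=1..j. s) + \<bar>c\<bar> * s\<^sup>2 + \<bar>k\<bar> * (s\<^sup>2)\<^sup>2)"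
      unfolding L_def abs_exp_cancel exp_le_cancel_iff by linarith
  qed
  have int_L: "integrable M (L c k j)" if "j \<le> n" for c k j
    using L_bdd[OF that] int_bdd[OF LF[OF that]] by blast
  have L_Suc: "L c k (Suc j) \<omega> = L c k j \<omega> *
      exp (d (Suc j) \<omega> + c * (V (Suc j) \<omega> - V j \<omega>) + k * ((V (Suc j) \<omega>)\<^sup>2 - (V j \<omega>)\<^sup>2))" for c k j \<omega>
  proof -
    have *: "(\<Sum>i=1..Suc j. d i \<omega>) = (\<Sum>i=1..j. d i \<omega>) + d (Suc j) \<omega>"
      by simp
    show ?thesis unfolding L_def exp_add[symmetric] * by (simp only: right_diff_distrib) simp
  qed
  have v_nonneg: "0 \<le> v (Suc j)" and v_le: "v (Suc j) \<le> s\<^sup>2" if "Suc j \<le> n" for j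
  proof -
    show "0 \<le> v (Suc j)"
      using v[of "Suc j"] that by simp
    have [measurable]: "d (Suc j) \<in> borel_measurable (F (Suc j))"
      using dF that by simp
    have le: "(d (Suc j) \<omega>)\<^sup>2 \<le> s\<^sup>2" for \<omega>
      using power_mono[OF d_le[of "Suc j" \<omega>] abs_ge_zero, of 2] that by simp
    have "expectation (\<lambda>\<omega>. (d (Suc j) \<omega>)\<^sup>2) \<le> s\<^sup>2"
      using le by (intro integral_le_const int_bdd[of _ "Suc j" "s\<^sup>2"]) auto
    then show "v (Suc j) \<le> s\<^sup>2"
      using v[of "Suc j"] that by simp
  qed
  text \<open>The part of the one-step expansion whose expectation is computed by orthogonality.\<close>
  define E where "E c k e j = (\<lambda>\<omega>. L c k j \<omega> + L c k j \<omega> * d (Suc j) \<omega> +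
      L c k j \<omega> * e \<omega> * (V (Suc j) \<omega> - V j \<omega> + (d (Suc j) \<omega>)\<^sup>2))" for c k e j
  have E_int: "integrable M (E c k e j)" (is ?I)
    and E_exp: "expectation (E c k e j) =
      expectation (L c k j) + v (Suc j) * expectation (\<lambda>\<omega>. L c k j \<omega> * e \<omega>)" (is ?E)
    and E_int': "integrable M (\<lambda>\<omega>. L c k j \<omega> * e \<omega>)"
    if j: "Suc j \<le> n" and eF: "e \<in> borel_measurable (F j)" and e: "\<And>\<omega>. \<bar>e \<omega>\<bar> \<le> 1" for c k e j
  proof -
    obtain C where C: "\<bar>L c k j \<omega>\<bar> \<le> C" for \<omega>
      using L_bdd[of j c k] j by auto
    have C0: "0 \<le> C" using C[of undefined] by simp
    have [measurable]: "d (Suc j) \<in> borel_measurable (F (Suc j))" "V (Suc j) \<in> borel_measurable (F (Suc j))"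
      "V j \<in> borel_measurable (F (Suc j))" "e \<in> borel_measurable (F (Suc j))"
      "L c k j \<in> borel_measurable (F (Suc j))"
      using dF[of "Suc j"] VF[of "Suc j"] F_le[OF VF, of j "Suc j"] F_le[OF eF, of "Suc j"]
        F_le[OF LF, of j "Suc j"] j by auto
    have [measurable]: "e \<in> borel_measurable (F j)" "L c k j \<in> borel_measurable (F j)"
      using eF LF[of j] j by auto
    have Le: "\<bar>L c k j \<omega> * e \<omega>\<bar> \<le> C" for \<omega>
      using mult_mono[OF C[of \<omega>] e[of \<omega>]] C0 by (simp add: abs_mult)
    have d: "\<bar>d (Suc j) \<omega>\<bar> \<le> s" for \<omega>
      using d_le j by simp
    have Ld: "\<bar>L c k j \<omega> * d (Suc j) \<omega>\<bar> \<le> C * s" for \<omega>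
      using mult_mono[OF C[of \<omega>] d[of \<omega>]] C0 by (simp add: abs_mult)
    have D: "\<bar>V (Suc j) \<omega> - V j \<omega> + (d (Suc j) \<omega>)\<^sup>2\<bar> \<le> 3 * s\<^sup>2" for \<omega>
    proof -
      have "(d (Suc j) \<omega>)\<^sup>2 \<le> s\<^sup>2"
        using power_mono[OF d[of \<omega>] abs_ge_zero, of 2] by simp
      then show ?thesis
        using V_le[of j \<omega>] V_le[of "Suc j" \<omega>] j zero_le_power2[of "d (Suc j) \<omega>"] by linarith
    qed
    have LeD: "\<bar>L c k j \<omega> * e \<omega> * (V (Suc j) \<omega> - V j \<omega> + (d (Suc j) \<omega>)\<^sup>2)\<bar> \<le> C * (3 * s\<^sup>2)" for \<omega>
      using mult_mono[OF Le[of \<omega>] D[of \<omega>]] C0 unfolding abs_mult by simp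
    have i1: "integrable M (\<lambda>\<omega>. L c k j \<omega> * d (Suc j) \<omega>)"
      by (rule int_bdd[of _ "Suc j", OF _ Ld]) measurable
    have i2: "integrable M (\<lambda>\<omega>. L c k j \<omega> * e \<omega> * (V (Suc j) \<omega> - V j \<omega> + (d (Suc j) \<omega>)\<^sup>2))"
      by (rule int_bdd[of _ "Suc j", OF _ LeD]) measurable
    show ?I
      unfolding E_def using i1 i2 int_L[of j c k] j by (intro Bochner_Integration.integrable_add) auto
    have m: "(\<lambda>\<omega>. L c k j \<omega> * e \<omega>) \<in> borel_measurable (F j)"
      by measurable
    show "integrable M (\<lambda>\<omega>. L c k j \<omega> * e \<omega>)"
      by (rule int_bdd[OF m Le])
    have "expectation (E c k e j) = expectation (L c k j) + expectation (\<lambda>\<omega>. L c k j \<omega> * d (Suc j) \<omega>) +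
       expectation (\<lambda>\<omega>. L c k j \<omega> * e \<omega> * (V (Suc j) \<omega> - V j \<omega> + (d (Suc j) \<omega>)\<^sup>2))"
      unfolding E_def using i1 i2 int_L[of j c k] j by simp
    then show ?E
      using d_orth[of "Suc j" "L c k j", OF _ j _ C] V_orth[of "Suc j" "\<lambda>\<omega>. L c k j \<omega> * e \<omega>", OF _ j _ Le] m
      by simp
  qed
  have bounds: "\<bar>d (Suc j) \<omega>\<bar> \<le> s" "\<bar>V j \<omega>\<bar> \<le> s\<^sup>2" "\<bar>V (Suc j) \<omega>\<bar> \<le> s\<^sup>2" if "Suc j \<le> n" for j \<omega>
    using d_le V_le that by auto
  have small: "\<bar>40 / \<epsilon> * V j \<omega>\<bar> \<le> \<epsilon> / 4" if "Suc j \<le> n" for j \<omega>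
    by (rule potential_step_bounds(3)[OF eps s bounds[OF that]])
  \<comment> \<open>Because \<open>V\<close> vanishes at 0 and at \<open>n\<close>, the potential
    starts at 1 and ends at the exponential of the sum, whatever \<open>c\<close> and
    \<open>k\<close> are.\<close>
  have L0: "expectation (L c k 0) = 1" for c k
  proof -
    have "expectation (L c k 0) = expectation (\<lambda>_. 1)"
      by (intro Bochner_Integration.integral_cong) (auto simp: L_def V0)
    then show ?thesis by (simp add: prob_space)
  qed
  have Ln: "expectation (L c k n) = expectation (\<lambda>\<omega>. exp (\<Sum>j=1..n. d j \<omega>))" for c k
    by (intro Bochner_Integration.integral_cong) (auto simp: L_def Vn)
  have up: "expectation (L (1/2 + \<epsilon>/2) (- 20 / \<epsilon>) j) \<le> exp ((1/2 + \<epsilon>) * (\<Sum>i=1..j. v i))" if "j \<le> n" for j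
    using that
  proof (induction j)
    case 0
    then show ?case by (simp add: L0)
  next
    case (Suc j)
    \<comment> \<open>\<open>e\<close> is the \<open>F j\<close>-measurable coefficient of the jump
      of \<open>V\<close>. Its lower bound allows the coefficient of the squared increment to be
      raised to \<open>e\<close>, so that jump and square occur only in the combination covered by
      \<open>V_orth\<close>; its upper bound gives the growth rate.\<close>
    define e where "e \<omega> = 1/2 + \<epsilon>/2 - 40 / \<epsilon> * V j \<omega>" for \<omega>
    let ?c = "1/2 + \<epsilon>/2" and ?k = "- 20 / \<epsilon>"
    have e_le: "e \<omega> \<le> 1/2 + \<epsilon>" and e_mid: "1/2 + \<epsilon>/4 \<le> e \<omega>" and e_abs: "\<bar>e \<omega>\<bar> \<le> 1" for \<omega>
      using small[OF Suc.prems, of \<omega>] eps unfolding e_def by linarith+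
    have eF: "e \<in> borel_measurable (F j)"
      using VF[of j] Suc.prems unfolding e_def by simp
    note E = E_int[OF Suc.prems eF e_abs] E_exp[OF Suc.prems eF e_abs]
      E_int'[OF Suc.prems eF e_abs]
    have "L ?c ?k (Suc j) \<omega> \<le> E ?c ?k e j \<omega>" for \<omega>
    proof -
      let ?d = "d (Suc j) \<omega>" and ?D = "V (Suc j) \<omega> - V j \<omega>"
      have "L ?c ?k (Suc j) \<omega> \<le> L ?c ?k j \<omega> * (1 + ?d + e \<omega> * ?D + (1/2 + \<epsilon>/4) * ?d\<^sup>2)"
        unfolding L_Suc e_def using potential_step_bounds(1)[OF eps s bounds[OF Suc.prems], of \<omega>] L_pos
        by (intro mult_left_mono) (auto simp: less_imp_le)
      also have "\<dots> \<le> L ?c ?k j \<omega> * (1 + ?d + e \<omega> * ?D + e \<omega> * ?d\<^sup>2)"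
        by (intro mult_left_mono add_left_mono mult_right_mono e_mid) (auto intro: less_imp_le L_pos)
      also have "\<dots> = E ?c ?k e j \<omega>"
        unfolding E_def by (simp add: algebra_simps)
      finally show ?thesis .
    qed
    then have "expectation (L ?c ?k (Suc j)) \<le> expectation (E ?c ?k e j)"
      by (intro integral_mono int_L Suc.prems E)
    also have "\<dots> = expectation (L ?c ?k j) + v (Suc j) * expectation (\<lambda>\<omega>. L ?c ?k j \<omega> * e \<omega>)"
      by (rule E)
    also have "\<dots> \<le> expectation (L ?c ?k j) + v (Suc j) * expectation (\<lambda>\<omega>. L ?c ?k j \<omega> * (1/2 + \<epsilon>))"
      using L_pos e_le Suc.prems v_nonneg[OF Suc.prems]
      by (intro add_left_mono mult_left_mono integral_mono E integrable_mult_left int_L) (auto simp: less_imp_le)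
    also have "\<dots> = expectation (L ?c ?k j) + v (Suc j) * (expectation (L ?c ?k j) * (1/2 + \<epsilon>))"
      by simp
    also have "\<dots> = expectation (L ?c ?k j) * (1 + (1/2 + \<epsilon>) * v (Suc j))"
      by (simp only: algebra_simps)
    also have "\<dots> \<le> exp ((1/2 + \<epsilon>) * (\<Sum>i=1..j. v i)) * exp ((1/2 + \<epsilon>) * v (Suc j))"
      using Suc v_nonneg[OF Suc.prems] eps by (intro mult_mono exp_ge_add_one_self) auto
    finally show ?case
      by (simp add: exp_add[symmetric] algebra_simps)
  qed
  show "expectation (\<lambda>\<omega>. exp (\<Sum>j=1..n. d j \<omega>)) \<le> exp ((1/2 + \<epsilon>) * (\<Sum>j=1..n. v j))"
    using up[of n] by (simp add: Ln)
  have lo: "expectation (L (1/2 - \<epsilon>/2) (20 / \<epsilon>) j) \<ge> exp ((1/2 - \<epsilon>) * (\<Sum>i=1..j. v i))" if "j \<le> n" for j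
    using that
  proof (induction j)
    case 0
    then show ?case by (simp add: L0)
  next
    case (Suc j)
    \<comment> \<open>Mirror image of the upper bound: the coefficient of the squared increment is
      lowered to \<open>e\<close>, and the bound \<open>1/2 - 3/4 * \<epsilon>\<close> leaves a
      reserve of \<open>\<epsilon>/4\<close> in the rate.\<close>
    define e where "e \<omega> = 1/2 - \<epsilon>/2 + 40 / \<epsilon> * V j \<omega>" for \<omega>
    let ?c = "1/2 - \<epsilon>/2" and ?k = "20 / \<epsilon>"
    have e_ge: "e \<omega> \<ge> 1/2 - 3/4 * \<epsilon>" and e_mid: "e \<omega> \<le> 1/2 - \<epsilon>/4" and e_abs: "\<bar>e \<omega>\<bar> \<le> 1" for \<omega>
      using small[OF Suc.prems, of \<omega>] eps unfolding e_def by linarith+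
    have eF: "e \<in> borel_measurable (F j)"
      using VF[of j] Suc.prems unfolding e_def by simp
    note E = E_int[OF Suc.prems eF e_abs] E_exp[OF Suc.prems eF e_abs]
      E_int'[OF Suc.prems eF e_abs]
    have le_E: "L ?c ?k (Suc j) \<omega> \<ge> E ?c ?k e j \<omega>" for \<omega>
    proof -
      let ?d = "d (Suc j) \<omega>" and ?D = "V (Suc j) \<omega> - V j \<omega>"
      have "E ?c ?k e j \<omega> = L ?c ?k j \<omega> * (1 + ?d + e \<omega> * ?D + e \<omega> * ?d\<^sup>2)"
        unfolding E_def by (simp add: algebra_simps)
      also have "\<dots> \<le> L ?c ?k j \<omega> * (1 + ?d + e \<omega> * ?D + (1/2 - \<epsilon>/4) * ?d\<^sup>2)"
        by (intro mult_left_mono add_left_mono mult_right_mono e_mid) (auto intro: less_imp_le L_pos)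
      also have "\<dots> \<le> L ?c ?k (Suc j) \<omega>"
        unfolding L_Suc e_def using potential_step_bounds(2)[OF eps s bounds[OF Suc.prems], of \<omega>] L_pos
        by (intro mult_left_mono) (auto simp: less_imp_le)
      finally show ?thesis .
    qed
    \<comment> \<open>The inequality \<open>1 + y \<le> exp y\<close>, sufficient for the upper
      bound, points the wrong way here. The quadratic term of the exponential is paid for by the
      reserve, since \<open>v (Suc j) \<le> \<epsilon> / 4\<close>.\<close>
    have exp_v: "exp ((1/2 - \<epsilon>) * v (Suc j)) \<le> 1 + (1/2 - 3/4 * \<epsilon>) * v (Suc j)"
    proof -
      let ?v = "v (Suc j)"
      have "s \<le> 1" using s eps by linarith
      then have "s\<^sup>2 \<le> s"
        using s0 Suc.prems by (simp add: power2_eq_square mult_left_le)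
      then have v1: "?v \<le> \<epsilon> / 4" and v0: "0 \<le> ?v"
        using v_le[OF Suc.prems] v_nonneg[OF Suc.prems] s eps by linarith+
      have y: "(1/2 - \<epsilon>) * ?v \<le> ?v" "0 \<le> (1/2 - \<epsilon>) * ?v"
        using eps v0 by (auto simp: mult_le_cancel_right1 intro!: mult_nonneg_nonneg mult_left_le_one_le)
      have "exp ((1/2 - \<epsilon>) * ?v) \<le> 1 + (1/2 - \<epsilon>) * ?v + ((1/2 - \<epsilon>) * ?v)\<^sup>2"
        using y v1 eps by (intro exp_bound) linarith+
      also have "((1/2 - \<epsilon>) * ?v)\<^sup>2 \<le> ?v * ?v"
        using y v0 unfolding power2_eq_square by (intro mult_mono) auto
      also have "\<dots> \<le> \<epsilon> / 4 * ?v"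
        using v1 v0 by (intro mult_right_mono)
      finally show ?thesis
        by (simp add: algebra_simps)
    qed
    have "exp ((1/2 - \<epsilon>) * (\<Sum>i=1..Suc j. v i)) =
        exp ((1/2 - \<epsilon>) * (\<Sum>i=1..j. v i)) * exp ((1/2 - \<epsilon>) * v (Suc j))"
      by (simp add: exp_add[symmetric] algebra_simps)
    also have "\<dots> \<le> expectation (L ?c ?k j) * (1 + (1/2 - 3/4 * \<epsilon>) * v (Suc j))"
    proof (rule mult_mono)
      show "0 \<le> expectation (L ?c ?k j)"
        using L_pos by (intro Bochner_Integration.integral_nonneg) (auto simp: less_imp_le)
    qed (use Suc exp_v in auto)
    also have "\<dots> = expectation (L ?c ?k j) + v (Suc j) * (expectation (L ?c ?k j) * (1/2 - 3/4 * \<epsilon>))"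
      by (simp only: algebra_simps)
    also have "\<dots> = expectation (L ?c ?k j) + v (Suc j) * expectation (\<lambda>\<omega>. L ?c ?k j \<omega> * (1/2 - 3/4 * \<epsilon>))"
      by simp
    also have "\<dots> \<le> expectation (L ?c ?k j) + v (Suc j) * expectation (\<lambda>\<omega>. L ?c ?k j \<omega> * e \<omega>)"
      using L_pos e_ge Suc.prems v_nonneg[OF Suc.prems]
      by (intro add_left_mono mult_left_mono integral_mono E integrable_mult_left int_L) (auto simp: less_imp_le)
    also have "\<dots> = expectation (E ?c ?k e j)"
      by (rule E(2)[symmetric])
    also have "\<dots> \<le> expectation (L ?c ?k (Suc j))"
      using le_E by (intro integral_mono int_L Suc.prems E)
    finally show ?case .
  qed
  show "expectation (\<lambda>\<omega>. exp (\<Sum>j=1..n. d j \<omega>)) \<ge> exp ((1/2 - \<epsilon>) * (\<Sum>j=1..n. v j))"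
    using lo[of n] by (simp add: Ln)
qed

section \<open>Bounded functions and \<open>\<phi>\<close>-mixing\<close>

text \<open>The bound is demanded at every point, not almost everywhere and not only on the space.
  Integrability and products then need no null sets; variables with only an almost sure bound are
  truncated first.\<close>

definition bounded_meas :: "'a measure \<Rightarrow> ('a \<Rightarrow> real) \<Rightarrow> bool" where
  "bounded_meas N f \<longleftrightarrow> f \<in> borel_measurable N \<and> (\<exists>C. \<forall>\<omega>. \<bar>f \<omega>\<bar> \<le> C)"

named_theorems bounded_meas_intros

lemma bounded_measI:
  assumes "f \<in> borel_measurable N" "\<And>\<omega>. \<bar>f \<omega>\<bar> \<le> C"
  shows "bounded_meas N f"
  using assms unfolding bounded_meas_def by auto

lemma bounded_meas_const [bounded_meas_intros]: "bounded_meas N (\<lambda>_. c)"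
  by (rule bounded_measI[of _ _ "\<bar>c\<bar>"]) auto

lemma bounded_meas_indicator [bounded_meas_intros]:
  "A \<in> sets N \<Longrightarrow> bounded_meas N (indicator A)"
  by (rule bounded_measI[of _ _ 1]) auto

lemma bounded_meas_add [bounded_meas_intros]:
  assumes "bounded_meas N f" "bounded_meas N g"
  shows "bounded_meas N (\<lambda>\<omega>. f \<omega> + g \<omega>)"
proof -
  obtain C D where f: "f \<in> borel_measurable N" "\<And>\<omega>. \<bar>f \<omega>\<bar> \<le> C"
    and g: "g \<in> borel_measurable N" "\<And>\<omega>. \<bar>g \<omega>\<bar> \<le> D"
    using assms unfolding bounded_meas_def by auto
  show ?thesis
    by (rule bounded_measI[of _ _ "C + D"])
      (auto intro!: borel_measurable_add f g order_trans[OF abs_triangle_ineq] add_mono)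
qed

lemma bounded_meas_mult [bounded_meas_intros]:
  assumes "bounded_meas N f" "bounded_meas N g"
  shows "bounded_meas N (\<lambda>\<omega>. f \<omega> * g \<omega>)"
proof -
  obtain C D where f: "f \<in> borel_measurable N" "\<And>\<omega>. \<bar>f \<omega>\<bar> \<le> C"
    and g: "g \<in> borel_measurable N" "\<And>\<omega>. \<bar>g \<omega>\<bar> \<le> D"
    using assms unfolding bounded_meas_def by auto
  show ?thesis
    by (rule bounded_measI[of _ _ "C * D"])
      (auto intro!: borel_measurable_times f g mult_mono order_trans[OF abs_ge_zero f(2)] simp: abs_mult)
qed

lemma bounded_meas_diff [bounded_meas_intros]:
  assumes "bounded_meas N f" "bounded_meas N g"
  shows "bounded_meas N (\<lambda>\<omega>. f \<omega> - g \<omega>)"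
  using bounded_meas_add[OF assms(1) bounded_meas_mult[OF bounded_meas_const[of N "-1"] assms(2)]]
  by simp

lemma bounded_meas_power [bounded_meas_intros]:
  "bounded_meas N f \<Longrightarrow> bounded_meas N (\<lambda>\<omega>. f \<omega> ^ k)"
  by (induction k) (auto intro: bounded_meas_const bounded_meas_mult)

lemma bounded_meas_sum [bounded_meas_intros]:
  "(\<And>i. i \<in> I \<Longrightarrow> bounded_meas N (f i)) \<Longrightarrow> bounded_meas N (\<lambda>\<omega>. \<Sum>i\<in>I. f i \<omega>)"
  by (induction I rule: infinite_finite_induct) (auto intro: bounded_meas_const bounded_meas_add)

lemma bounded_meas_abs [bounded_meas_intros]:
  "bounded_meas N f \<Longrightarrow> bounded_meas N (\<lambda>\<omega>. \<bar>f \<omega>\<bar>)"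
  unfolding bounded_meas_def by auto

lemma bounded_meas_subalg:
  "subalgebra N F \<Longrightarrow> bounded_meas F f \<Longrightarrow> bounded_meas N f"
  unfolding bounded_meas_def using measurable_from_subalg by blast

lemma (in finite_measure) integrable_bounded_meas:
  assumes "bounded_meas M f"
  shows "integrable M f"
proof -
  obtain C where "f \<in> borel_measurable M" "\<And>\<omega>. \<bar>f \<omega>\<bar> \<le> C"
    using assms unfolding bounded_meas_def by auto
  then show ?thesis
    by (intro integrable_const_bound[of f C]) auto
qed

text \<open>The sum counts the positive integers up to \<open>x\<close>, that is, it equals the
  floor of \<open>x\<close>. With \<open>x\<close> equal to \<open>m\<close> times a function with
  values in [0,1], this is a discrete layer-cake formula.\<close>

lemma card_real_le_approx:
  fixes x :: real
  assumes "0 \<le> x" "x \<le> real m"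
  shows "\<bar>x - (\<Sum>i=1..m. if real i \<le> x then 1 else 0)\<bar> \<le> 1"
proof -
  have "{i \<in> {1..m}. real i \<le> x} = {1..nat \<lfloor>x\<rfloor>}"
  proof (intro set_eqI iffI)
    fix i assume "i \<in> {i \<in> {1..m}. real i \<le> x}"
    then show "i \<in> {1..nat \<lfloor>x\<rfloor>}" by (auto simp: le_nat_floor)
  next
    fix i assume i: "i \<in> {1..nat \<lfloor>x\<rfloor>}"
    then have "real i \<le> x"
      using assms(1) by (metis atLeastAtMost_iff le_floor_iff nat_le_iff of_int_of_nat_eq le_nat_iff zero_le_floor)
    with i assms show "i \<in> {i \<in> {1..m}. real i \<le> x}" by auto
  qed
  then have "(\<Sum>i=1..m. if real i \<le> x then 1 else 0 :: real) = real (nat \<lfloor>x\<rfloor>)"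
    by (simp add: sum.If_cases Int_def)
  then show ?thesis
    using assms(1) by (simp add: abs_le_iff) linarith
qed

section \<open>Covariance inequalities under mixing and bounded versions of conditional
  expectations\<close>

context prob_space
begin

text \<open>\<open>Z\<close> is uniformly close to an average of indicators of its upper level sets,
  which lie in \<open>G\<close>. The covariance of an average is the average of the covariances, so
  \<open>\<kappa>\<close> survives without a factor for the number of levels.\<close>

lemma covariance_indicator_unit_interval:
  assumes A: "A \<in> events" and subG: "subalgebra M G"
    and mix: "\<And>C. C \<in> sets G \<Longrightarrow> \<bar>prob (A \<inter> C) - prob A * prob C\<bar> \<le> \<kappa>"
    and Z: "Z \<in> borel_measurable G" and Z01: "\<And>\<omega>. 0 \<le> Z \<omega>" "\<And>\<omega>. Z \<omega> \<le> 1"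
  shows "\<bar>expectation (\<lambda>\<omega>. indicator A \<omega> * (Z \<omega> - expectation Z))\<bar> \<le> \<kappa>"
proof (rule field_le_epsilon)
  fix e :: real assume "e > 0"
  \<comment> \<open>Replacing \<open>Z\<close> by its discretisation costs \<open>1 / m\<close> in
    the variable and \<open>1 / m\<close> in its mean, hence the 2.\<close>
  obtain m :: nat where m: "real m > 2 / e"
    using reals_Archimedean2 by blast
  then have m0: "real m > 0"
    using \<open>e > 0\<close> by (meson divide_pos_pos less_trans zero_less_numeral)
  define C where "C i = {\<omega> \<in> space M. real i \<le> real m * Z \<omega>}" for i
  have space: "space G = space M"
    using subG by (simp add: subalgebra_def)
  have [measurable]: "Z \<in> borel_measurable M"
    by (rule measurable_from_subalg[OF subG Z])
  have CG: "C i \<in> sets G" for i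
    unfolding C_def space[symmetric] using Z by measurable
  have CM: "C i \<in> events" for i
    using CG subG by (auto simp: subalgebra_def)
  define Y where "Y \<omega> = (1 / real m) * (\<Sum>i=1..m. indicator (C i) \<omega> :: real)" for \<omega>
  have ZY: "\<bar>Z \<omega> - Y \<omega>\<bar> \<le> 1 / real m" if "\<omega> \<in> space M" for \<omega>
  proof -
    have "(\<Sum>i=1..m. indicator (C i) \<omega> :: real) = (\<Sum>i=1..m. if real i \<le> real m * Z \<omega> then 1 else 0)"
      using that by (intro sum.cong) (auto simp: C_def indicator_def)
    then have "\<bar>real m * Z \<omega> - real m * Y \<omega>\<bar> \<le> 1"
      unfolding Y_def using card_real_le_approx[of "real m * Z \<omega>" m] Z01 m0
      by (simp add: mult_left_le)
    then have "real m * \<bar>Z \<omega> - Y \<omega>\<bar> \<le> 1"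
      using m0 by (simp add: right_diff_distrib[symmetric] abs_mult)
    then show ?thesis
      using m0 by (simp add: field_simps)
  qed
  have bZ: "bounded_meas M Z"
    by (rule bounded_measI[of _ _ 1]) (auto simp: Z01 abs_le_iff intro: order_trans[OF _ Z01(1)])
  have bY: "bounded_meas M Y"
    unfolding Y_def by (intro bounded_meas_intros CM)
  note int = integrable_bounded_meas bounded_meas_intros bZ bY
  have "\<bar>expectation (\<lambda>\<omega>. indicator A \<omega> * (Y \<omega> - expectation Y))\<bar> \<le> \<kappa>"
  proof -
    have iC: "integrable M (\<lambda>\<omega>. indicator (C i) \<omega> :: real)"
      "integrable M (\<lambda>\<omega>. indicator A \<omega> * indicator (C i) \<omega> :: real)" for i
      by (intro int CM A)+
    have EY: "expectation Y = (1 / real m) * (\<Sum>i=1..m. prob (C i))"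
      unfolding Y_def using iC CM by simp
    have "expectation (\<lambda>\<omega>. indicator A \<omega> * Y \<omega>) =
        expectation (\<lambda>\<omega>. (1 / real m) * (\<Sum>i=1..m. indicator A \<omega> * indicator (C i) \<omega>))"
      unfolding Y_def by (simp only: sum_distrib_left mult.left_commute)
    also have "\<dots> = (1 / real m) * (\<Sum>i=1..m. expectation (\<lambda>\<omega>. indicator A \<omega> * indicator (C i) \<omega>))"
      by (simp only: integral_mult_right_zero Bochner_Integration.integral_sum iC)
    also have "\<dots> = (1 / real m) * (\<Sum>i=1..m. prob (A \<inter> C i))"
      using A CM by (simp add: indicator_inter_arith[symmetric])
    finally have EAY: "expectation (\<lambda>\<omega>. indicator A \<omega> * Y \<omega>) = (1 / real m) * (\<Sum>i=1..m. prob (A \<inter> C i))" .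
    have "expectation (\<lambda>\<omega>. indicator A \<omega> * (Y \<omega> - expectation Y)) =
        expectation (\<lambda>\<omega>. indicator A \<omega> * Y \<omega> - expectation Y * indicator A \<omega>)"
      by (simp add: algebra_simps)
    also have "\<dots> = expectation (\<lambda>\<omega>. indicator A \<omega> * Y \<omega>) - expectation Y * prob A"
      using A by (subst Bochner_Integration.integral_diff) (auto intro!: int)
    also have "\<dots> = (1 / real m) * (\<Sum>i=1..m. prob (A \<inter> C i) - prob A * prob (C i))"
      unfolding EAY EY by (simp add: sum_subtractf sum_distrib_left sum_distrib_right algebra_simps)
    finally have "\<bar>expectation (\<lambda>\<omega>. indicator A \<omega> * (Y \<omega> - expectation Y))\<bar> =
        (1 / real m) * \<bar>\<Sum>i=1..m. prob (A \<inter> C i) - prob A * prob (C i)\<bar>"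
      using m0 by (simp add: abs_mult)
    also have "\<dots> \<le> (1 / real m) * (\<Sum>i=1..m. \<kappa>)"
      using m0 by (intro mult_left_mono order_trans[OF sum_abs] sum_mono mix CG) auto
    also have "\<dots> = \<kappa>"
      using m0 by simp
    finally show ?thesis .
  qed
  moreover have "\<bar>expectation (\<lambda>\<omega>. indicator A \<omega> * (Z \<omega> - expectation Z)) -
      expectation (\<lambda>\<omega>. indicator A \<omega> * (Y \<omega> - expectation Y))\<bar> \<le> 2 / real m"
  proof -
    have "\<bar>expectation Z - expectation Y\<bar> = \<bar>expectation (\<lambda>\<omega>. Z \<omega> - Y \<omega>)\<bar>"
      by (subst Bochner_Integration.integral_diff) (auto intro!: int)
    also have "\<dots> \<le> expectation (\<lambda>\<omega>. \<bar>Z \<omega> - Y \<omega>\<bar>)"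
      by (rule integral_abs_bound)
    also have "\<dots> \<le> 1 / real m"
      using ZY by (intro integral_le_const int) auto
    finally have E: "\<bar>expectation Z - expectation Y\<bar> \<le> 1 / real m" .
    have "\<bar>expectation (\<lambda>\<omega>. indicator A \<omega> * (Z \<omega> - expectation Z)) -
      expectation (\<lambda>\<omega>. indicator A \<omega> * (Y \<omega> - expectation Y))\<bar> =
      \<bar>expectation (\<lambda>\<omega>. indicator A \<omega> * (Z \<omega> - expectation Z) - indicator A \<omega> * (Y \<omega> - expectation Y))\<bar>"
      using A by (subst Bochner_Integration.integral_diff) (auto intro!: int)
    also have "\<dots> \<le> expectation (\<lambda>\<omega>. \<bar>indicator A \<omega> * (Z \<omega> - expectation Z) - indicator A \<omega> * (Y \<omega> - expectation Y)\<bar>)"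
      by (rule integral_abs_bound)
    also have "\<dots> \<le> 2 / real m"
    proof (intro integral_le_const int AE_I2 A)
      fix \<omega> assume "\<omega> \<in> space M"
      then show "\<bar>indicator A \<omega> * (Z \<omega> - expectation Z) - indicator A \<omega> * (Y \<omega> - expectation Y)\<bar> \<le> 2 / real m"
        using ZY[of \<omega>] E m0 by (cases "\<omega> \<in> A") (auto simp: abs_le_iff)
    qed
    finally show ?thesis .
  qed
  moreover have "2 / real m \<le> e"
    using m m0 \<open>e > 0\<close> by (simp add: field_simps)
  ultimately show "\<bar>expectation (\<lambda>\<omega>. indicator A \<omega> * (Z \<omega> - expectation Z))\<bar> \<le> \<kappa> + e"
    by linarith
qed

text \<open>Affine rescaling of [-K, K] to [0, 1]; the factor \<open>2 * K\<close> is the length of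
  the interval.\<close>

lemma covariance_indicator_bounded:
  assumes A: "A \<in> events" and subG: "subalgebra M G"
    and mix: "\<And>C. C \<in> sets G \<Longrightarrow> \<bar>prob (A \<inter> C) - prob A * prob C\<bar> \<le> \<kappa>"
    and Y: "Y \<in> borel_measurable G" and K: "\<And>\<omega>. \<bar>Y \<omega>\<bar> \<le> K"
  shows "\<bar>expectation (\<lambda>\<omega>. indicator A \<omega> * (Y \<omega> - expectation Y))\<bar> \<le> 2 * K * \<kappa>"
proof (cases "K = 0")
  case True
  then have "Y = (\<lambda>_. 0)" using K by auto
  then show ?thesis by (simp add: True)
next
  case False
  then have K0: "K > 0"
    using K[of undefined] by linarith
  define Z where "Z \<omega> = (Y \<omega> + K) / (2 * K)" for \<omega>
  have YZ: "Y = (\<lambda>\<omega>. 2 * K * Z \<omega> - K)"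
    using K0 by (auto simp: Z_def)
  have Z01: "0 \<le> Z \<omega>" "Z \<omega> \<le> 1" for \<omega>
    using K[of \<omega>] K0 by (auto simp: Z_def abs_le_iff field_simps)
  have ZG: "Z \<in> borel_measurable G"
    unfolding Z_def using Y by measurable
  have "bounded_meas M Z"
    using Z01 by (intro bounded_measI[of _ _ 1] measurable_from_subalg[OF subG ZG]) auto
  then have "expectation Y = 2 * K * expectation Z - K"
    unfolding YZ using integrable_bounded_meas by (simp add: prob_space)
  then have "indicator A \<omega> * (Y \<omega> - expectation Y) = 2 * K * (indicator A \<omega> * (Z \<omega> - expectation Z))" for \<omega>
    unfolding YZ by (simp add: algebra_simps)
  then have "\<bar>expectation (\<lambda>\<omega>. indicator A \<omega> * (Y \<omega> - expectation Y))\<bar> =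
      2 * K * \<bar>expectation (\<lambda>\<omega>. indicator A \<omega> * (Z \<omega> - expectation Z))\<bar>"
    using K0 by (simp only: integral_mult_right_zero abs_mult)
  also have "\<dots> \<le> 2 * K * \<kappa>"
    using K0 by (intro mult_left_mono covariance_indicator_unit_interval[OF A subG mix ZG Z01]) auto
  finally show ?thesis .
qed

text \<open>A bound on the averages over all sets of \<open>F\<close> forces an almost sure bound on
  the conditional expectation: otherwise the set where it fails would itself violate the bound.
  Clipping then produces a version that is bounded everywhere.\<close>

lemma exists_bounded_cond_exp:
  assumes subF: "subalgebra M F" and Y: "bounded_meas M Y"
    and c: "\<And>A. A \<in> sets F \<Longrightarrow> \<bar>expectation (\<lambda>\<omega>. indicator A \<omega> * (Y \<omega> - e))\<bar> \<le> c * prob A"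
  obtains h where "h \<in> borel_measurable F" "\<And>\<omega>. \<bar>h \<omega> - e\<bar> \<le> c"
    "\<And>g. bounded_meas F g \<Longrightarrow> expectation (\<lambda>\<omega>. g \<omega> * h \<omega>) = expectation (\<lambda>\<omega>. g \<omega> * Y \<omega>)"
proof -
  interpret finite_measure_subalgebra M F
    by standard (rule subF)
  have spaceF: "space F = space M"
    using subF by (simp add: subalgebra_def)
  define h where "h = real_cond_exp M F Y"
  have hF [measurable]: "h \<in> borel_measurable F" and hM [measurable]: "h \<in> borel_measurable M"
    unfolding h_def by auto
  have [measurable]: "Y \<in> borel_measurable M"
    using Y by (simp add: bounded_meas_def)
  have h_int: "integrable M h"
    unfolding h_def by (rule real_cond_exp_int[OF integrable_bounded_meas[OF Y]])
  have h_proj: "expectation (\<lambda>\<omega>. g \<omega> * h \<omega>) = expectation (\<lambda>\<omega>. g \<omega> * Y \<omega>)"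
    if "bounded_meas F g" for g
    unfolding h_def using that
    by (intro real_cond_exp_intg(2) integrable_bounded_meas bounded_meas_mult Y bounded_meas_subalg[OF subF])
      (auto simp: bounded_meas_def)
  \<comment> \<open>The whole space as test set shows \<open>0 \<le> c\<close>, so the clipping
    interval from \<open>e - c\<close> to \<open>e + c\<close> is not empty.\<close>
  have "\<bar>expectation (\<lambda>\<omega>. indicator (space M) \<omega> * (Y \<omega> - e))\<bar> \<le> c * prob (space M)"
    by (rule c) (metis sets.top spaceF)
  then have c0: "0 \<le> c" by (simp add: prob_space)
  \<comment> \<open>The sign \<open>s\<close> treats the upper and the lower deviation
    together.\<close>
  have AE_le: "AE \<omega> in M. s * (h \<omega> - e) \<le> c" if s: "\<bar>s\<bar> = 1" for s :: real
  proof -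
    define A where "A = {\<omega> \<in> space M. s * (h \<omega> - e) > c}"
    have AF: "A \<in> sets F"
      unfolding A_def spaceF[symmetric] by measurable
    then have A [measurable]: "A \<in> events"
      using subF by (auto simp: subalgebra_def)
    have Ah: "integrable M (\<lambda>\<omega>. indicator A \<omega> * h \<omega>)"
      using integrable_mult_indicator[OF A h_int] by simp
    have AY: "integrable M (\<lambda>\<omega>. indicator A \<omega> * Y \<omega>)"
      by (intro integrable_bounded_meas bounded_meas_intros Y A)
    have iA: "integrable M (indicator A :: _ \<Rightarrow> real)"
      by (intro integrable_bounded_meas bounded_meas_indicator A)
    have eq: "indicator A \<omega> * (s * (h \<omega> - e) - c) =
        s * (indicator A \<omega> * h \<omega>) - (s * e + c) * indicator A \<omega>" for \<omega>
      by (simp add: algebra_simps)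
    have i: "integrable M (\<lambda>\<omega>. indicator A \<omega> * (s * (h \<omega> - e) - c))"
      unfolding eq using Ah iA by simp
    have "expectation (\<lambda>\<omega>. indicator A \<omega> * (Y \<omega> - e)) = expectation (\<lambda>\<omega>. indicator A \<omega> * Y \<omega> - e * indicator A \<omega>)"
      by (simp add: algebra_simps)
    also have "\<dots> = expectation (\<lambda>\<omega>. indicator A \<omega> * Y \<omega>) - e * prob A"
      using AY iA A by simp
    finally have EY: "expectation (\<lambda>\<omega>. indicator A \<omega> * Y \<omega>) - e * prob A =
        expectation (\<lambda>\<omega>. indicator A \<omega> * (Y \<omega> - e))" by simp
    have "expectation (\<lambda>\<omega>. indicator A \<omega> * (s * (h \<omega> - e) - c)) =
        s * expectation (\<lambda>\<omega>. indicator A \<omega> * h \<omega>) - (s * e + c) * prob A"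
      unfolding eq using Ah iA A by simp
    also have "expectation (\<lambda>\<omega>. indicator A \<omega> * h \<omega>) = expectation (\<lambda>\<omega>. indicator A \<omega> * Y \<omega>)"
      by (rule h_proj[OF bounded_meas_indicator[OF AF]])
    also have "s * expectation (\<lambda>\<omega>. indicator A \<omega> * Y \<omega>) - (s * e + c) * prob A =
        s * expectation (\<lambda>\<omega>. indicator A \<omega> * (Y \<omega> - e)) - c * prob A"
      unfolding EY[symmetric] by (simp add: algebra_simps)
    also have "s * expectation (\<lambda>\<omega>. indicator A \<omega> * (Y \<omega> - e)) \<le> \<bar>s\<bar> * \<bar>expectation (\<lambda>\<omega>. indicator A \<omega> * (Y \<omega> - e))\<bar>"
      unfolding abs_mult[symmetric] by (rule abs_ge_self)
    finally have "expectation (\<lambda>\<omega>. indicator A \<omega> * (s * (h \<omega> - e) - c)) \<le> 0"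
      using c[OF AF] s by simp
    moreover have nn: "0 \<le> indicator A \<omega> * (s * (h \<omega> - e) - c)" for \<omega>
      by (auto simp: A_def indicator_def)
    ultimately have "expectation (\<lambda>\<omega>. indicator A \<omega> * (s * (h \<omega> - e) - c)) = 0"
      by (intro antisym Bochner_Integration.integral_nonneg) auto
    then have "AE \<omega> in M. indicator A \<omega> * (s * (h \<omega> - e) - c) = 0"
      using integral_nonneg_eq_0_iff_AE[OF i] nn by simp
    then show ?thesis
      using AE_space by eventually_elim (auto simp: A_def indicator_def not_less split: if_splits)
  qed
  \<comment> \<open>Clipping changes \<open>h\<close> on a null set only, so the projection identity
    persists, and \<open>k\<close> is still \<open>F\<close>-measurable.\<close>
  define k where "k \<omega> = max (e - c) (min (e + c) (h \<omega>))" for \<omega>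
  have AE_k: "AE \<omega> in M. k \<omega> = h \<omega>"
    using AE_le[of 1, simplified] AE_le[of "-1", simplified]
    by eventually_elim (auto simp: k_def max_def min_def)
  have kF [measurable]: "k \<in> borel_measurable F" and kM [measurable]: "k \<in> borel_measurable M"
    unfolding k_def by measurable
  show ?thesis
  proof (rule that[of k])
    show "\<bar>k \<omega> - e\<bar> \<le> c" for \<omega>
      using c0 unfolding k_def by (auto simp: max_def min_def abs_le_iff)
    show "expectation (\<lambda>\<omega>. g \<omega> * k \<omega>) = expectation (\<lambda>\<omega>. g \<omega> * Y \<omega>)" if g: "bounded_meas F g" for g
    proof -
      have [measurable]: "g \<in> borel_measurable M"
        using bounded_meas_subalg[OF subF g] by (simp add: bounded_meas_def)
      have "expectation (\<lambda>\<omega>. g \<omega> * k \<omega>) = expectation (\<lambda>\<omega>. g \<omega> * h \<omega>)"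
        using AE_k by (intro integral_cong_AE) auto
      with h_proj[OF g] show ?thesis by simp
    qed
  qed (rule kF)
qed

text \<open>The classical covariance inequality for \<open>\<phi>\<close>-mixing, with the L1 norm
  of \<open>U\<close> against the sup norm of \<open>Y\<close>: conditioning on \<open>F\<close>
  replaces \<open>Y\<close> by a function within \<open>2 * K * \<kappa>\<close> of its mean. The L1
  norm matters, as for \<open>U\<close> supported on a set \<open>A\<close> it yields the factor
  \<open>prob A\<close>.\<close>

lemma covariance_phi_mixing:
  assumes subF: "subalgebra M F" and subG: "subalgebra M G"
    and mix: "\<And>A C. A \<in> sets F \<Longrightarrow> C \<in> sets G \<Longrightarrow> \<bar>prob (A \<inter> C) - prob A * prob C\<bar> \<le> \<kappa> * prob A"
    and Y: "Y \<in> borel_measurable G" and K: "\<And>\<omega>. \<bar>Y \<omega>\<bar> \<le> K"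
    and U: "bounded_meas F U"
  shows "\<bar>expectation (\<lambda>\<omega>. U \<omega> * Y \<omega>) - expectation U * expectation Y\<bar> \<le> 2 * K * \<kappa> * expectation (\<lambda>\<omega>. \<bar>U \<omega>\<bar>)"
proof -
  have bY: "bounded_meas M Y"
    by (rule bounded_measI[OF measurable_from_subalg[OF subG Y] K])
  have c: "\<bar>expectation (\<lambda>\<omega>. indicator A \<omega> * (Y \<omega> - expectation Y))\<bar> \<le> 2 * K * \<kappa> * prob A" if "A \<in> sets F" for A
  proof -
    have "A \<in> events"
      using that subF by (auto simp: subalgebra_def)
    from covariance_indicator_bounded[OF this subG mix[OF that] Y K] show ?thesis by simp
  qed
  obtain h where h: "h \<in> borel_measurable F" "\<And>\<omega>. \<bar>h \<omega> - expectation Y\<bar> \<le> 2 * K * \<kappa>"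
    "\<And>g. bounded_meas F g \<Longrightarrow> expectation (\<lambda>\<omega>. g \<omega> * h \<omega>) = expectation (\<lambda>\<omega>. g \<omega> * Y \<omega>)"
    by (rule exists_bounded_cond_exp[OF subF bY c]) auto
  have bU: "bounded_meas M U"
    by (rule bounded_meas_subalg[OF subF U])
  have bh: "bounded_meas M (\<lambda>\<omega>. h \<omega> - expectation Y)"
    by (rule bounded_measI[OF _ h(2)]) (intro borel_measurable_diff measurable_from_subalg[OF subF h(1)] borel_measurable_const)
  have bh': "bounded_meas M h"
    using bounded_meas_add[OF bh bounded_meas_const[of _ "expectation Y"]] by simp
  have "expectation (\<lambda>\<omega>. U \<omega> * (h \<omega> - expectation Y) + U \<omega> * expectation Y) =
      expectation (\<lambda>\<omega>. U \<omega> * (h \<omega> - expectation Y)) + expectation U * expectation Y"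
    using bU bh by (subst Bochner_Integration.integral_add) (auto intro!: integrable_bounded_meas bounded_meas_intros)
  then have "expectation (\<lambda>\<omega>. U \<omega> * Y \<omega>) - expectation U * expectation Y = expectation (\<lambda>\<omega>. U \<omega> * (h \<omega> - expectation Y))"
    using h(3)[OF U] by (simp add: algebra_simps)
  also have "\<bar>\<dots>\<bar> \<le> expectation (\<lambda>\<omega>. \<bar>U \<omega> * (h \<omega> - expectation Y)\<bar>)"
    by (rule integral_abs_bound)
  also have "\<dots> \<le> expectation (\<lambda>\<omega>. 2 * K * \<kappa> * \<bar>U \<omega>\<bar>)"
  proof (intro integral_mono integrable_bounded_meas bounded_meas_intros bU bh')
    show "\<bar>U \<omega> * (h \<omega> - expectation Y)\<bar> \<le> 2 * K * \<kappa> * \<bar>U \<omega>\<bar>" for \<omega>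
      unfolding abs_mult using mult_right_mono[OF h(2)[of \<omega>], of "\<bar>U \<omega>\<bar>"] by (simp add: mult.commute)
  qed
  finally show ?thesis by simp
qed

end

section \<open>Sums of a bounded \<open>\<phi>\<close>-mixing row\<close>

lemma le_sqrt_mult_sqrt:
  assumes "0 \<le> x" "x \<le> a" "x \<le> b"
  shows "x \<le> sqrt a * sqrt b"
proof -
  have "x = sqrt x * sqrt x"
    using assms(1) by simp
  also have "\<dots> \<le> sqrt a * sqrt b"
    using assms by (intro mult_mono) auto
  finally show ?thesis .
qed

lemma integral_double_sum:
  fixes Z :: "'i \<Rightarrow> 'i \<Rightarrow> 'a \<Rightarrow> real"
  assumes "\<And>i k. i \<in> J \<Longrightarrow> k \<in> J \<Longrightarrow> integrable M (Z i k)"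
  shows "(\<integral>\<omega>. (\<Sum>i\<in>J. \<Sum>k\<in>J. Z i k \<omega>) \<partial>M) = (\<Sum>i\<in>J. \<Sum>k\<in>J. \<integral>\<omega>. Z i k \<omega> \<partial>M)"
proof -
  have "(\<integral>\<omega>. (\<Sum>i\<in>J. \<Sum>k\<in>J. Z i k \<omega>) \<partial>M) = (\<Sum>i\<in>J. \<integral>\<omega>. (\<Sum>k\<in>J. Z i k \<omega>) \<partial>M)"
    by (intro Bochner_Integration.integral_sum Bochner_Integration.integrable_sum assms)
  also have "\<dots> = (\<Sum>i\<in>J. \<Sum>k\<in>J. \<integral>\<omega>. Z i k \<omega> \<partial>M)"
    by (intro sum.cong refl Bochner_Integration.integral_sum assms)
  finally show ?thesis .
qed

text \<open>\<open>F j\<close> is the past up to time \<open>j\<close>, \<open>G i\<close> the future from time \<open>i\<close>, and \<open>h\<close> plays the role of \<open>\<phi>\<^sub>n\<close>.\<close>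

locale phi_mixing_row = prob_space M for M :: "'a measure" +
  fixes F G :: "nat \<Rightarrow> 'a measure" and X :: "nat \<Rightarrow> 'a \<Rightarrow> real" and n :: nat and K :: real and h :: "nat \<Rightarrow> real"
  assumes subF: "subalgebra M (F j)" and subG: "subalgebra M (G j)"
    and monoF: "i \<le> j \<Longrightarrow> sets (F i) \<subseteq> sets (F j)"
    and F0: "sets (F 0) = {{}, space M}"
    and XF: "1 \<le> i \<Longrightarrow> i \<le> j \<Longrightarrow> j \<le> n \<Longrightarrow> X i \<in> borel_measurable (F j)"
    and XG: "1 \<le> i \<Longrightarrow> i \<le> j \<Longrightarrow> j \<le> n \<Longrightarrow> X j \<in> borel_measurable (G i)"
    and K_nonneg: "0 \<le> K" and X_le: "1 \<le> i \<Longrightarrow> i \<le> n \<Longrightarrow> \<bar>X i \<omega>\<bar> \<le> K"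
    and X_mean: "1 \<le> i \<Longrightarrow> i \<le> n \<Longrightarrow> expectation (X i) = 0"
    and h_nonneg: "1 \<le> l \<Longrightarrow> l \<le> n \<Longrightarrow> 0 \<le> h l" and h_le_1: "1 \<le> l \<Longrightarrow> l \<le> n \<Longrightarrow> h l \<le> 1"
    and mix: "s < i \<Longrightarrow> i \<le> n \<Longrightarrow> A \<in> sets (F s) \<Longrightarrow> C \<in> sets (G i) \<Longrightarrow>
      \<bar>prob (A \<inter> C) - prob A * prob C\<bar> \<le> h (i - s) * prob A"
begin

text \<open>The square roots stem from the geometric mean of two mixing bounds in the second-moment
  estimate. As \<open>h \<le> 1\<close>, the same quantity also bounds the sum of the coefficients
  themselves, which governs the first moment.\<close>

definition H :: real where "H = (\<Sum>l=1..n. sqrt (h l))"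

definition T :: "nat \<Rightarrow> 'a \<Rightarrow> real" where "T j \<omega> = (\<Sum>i\<in>{j<..n}. X i \<omega>)"

lemma sqrt_h_bounds: "1 \<le> l \<Longrightarrow> l \<le> n \<Longrightarrow> 0 \<le> sqrt (h l)" "1 \<le> l \<Longrightarrow> l \<le> n \<Longrightarrow> h l \<le> sqrt (h l)"
  using h_nonneg[of l] h_le_1[of l] le_sqrt_mult_sqrt[of "h l" "h l" 1] by auto

lemma H_nonneg: "0 \<le> H"
  unfolding H_def by (intro sum_nonneg sqrt_h_bounds) auto

lemma sum_sqrt_h_le: "(\<Sum>i\<in>{j<..n}. sqrt (h (i - j))) \<le> H"
proof -
  have "(\<Sum>i\<in>{j<..n}. sqrt (h (i - j))) = (\<Sum>l\<in>{1..n-j}. sqrt (h l))"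
    by (rule sum.reindex_bij_witness[where i = "\<lambda>l. l + j" and j = "\<lambda>i. i - j"]) auto
  also have "\<dots> \<le> H"
    unfolding H_def by (intro sum_mono2 sqrt_h_bounds) auto
  finally show ?thesis .
qed

lemma bounded_meas_mono:
  assumes "bounded_meas (F i) f" "i \<le> j"
  shows "bounded_meas (F j) f"
  using assms monoF[OF assms(2)] subF[of i] subF[of j]
  by (intro bounded_meas_subalg[of "F j" "F i"]) (auto simp: subalgebra_def)

lemma bounded_meas_M: "bounded_meas (F i) f \<Longrightarrow> bounded_meas M f"
  by (rule bounded_meas_subalg[OF subF])

lemma bounded_meas_X: "1 \<le> i \<Longrightarrow> i \<le> j \<Longrightarrow> j \<le> n \<Longrightarrow> bounded_meas (F j) (X i)"
  by (rule bounded_measI[OF XF X_le]) auto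

lemma bounded_meas_XM: "1 \<le> i \<Longrightarrow> i \<le> n \<Longrightarrow> bounded_meas M (X i)"
  by (rule bounded_meas_M[OF bounded_meas_X[of i i]]) auto

lemma bounded_meas_T: "bounded_meas M (T j)"
  unfolding T_def by (intro bounded_meas_sum bounded_meas_XM) auto

lemma events_F: "A \<in> sets (F j) \<Longrightarrow> A \<in> events"
  using subF[of j] by (auto simp: subalgebra_def)

lemma covariance_X:
  assumes "s < i" "i \<le> n" "bounded_meas (F s) U"
  shows "\<bar>expectation (\<lambda>\<omega>. U \<omega> * X i \<omega>)\<bar> \<le> 2 * K * h (i - s) * expectation (\<lambda>\<omega>. \<bar>U \<omega>\<bar>)"
proof -
  have "\<bar>expectation (\<lambda>\<omega>. U \<omega> * X i \<omega>) - expectation U * expectation (X i)\<bar>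
      \<le> 2 * K * h (i - s) * expectation (\<lambda>\<omega>. \<bar>U \<omega>\<bar>)"
    by (rule covariance_phi_mixing[OF subF subG mix[OF assms(1,2)] XG X_le assms(3)]) (use assms in auto)
  moreover have "expectation (X i) = 0"
    using assms by (intro X_mean) auto
  ultimately show ?thesis by simp
qed

text \<open>A bound proportional to \<open>prob A\<close>, for all \<open>A\<close> in
  \<open>F j\<close>, is the form that \<open>exists_bounded_cond_exp\<close> converts into a
  pointwise bound on the conditional mean of the remaining sum.\<close>

lemma T_conditional_mean:
  assumes "j \<le> n" and A: "A \<in> sets (F j)"
  shows "\<bar>expectation (\<lambda>\<omega>. indicator A \<omega> * T j \<omega>)\<bar> \<le> 2 * K * H * prob A"
proof -
  have bX: "integrable M (\<lambda>\<omega>. indicator A \<omega> * X i \<omega>)" if "i \<in> {j<..n}" for i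
    using that by (intro integrable_bounded_meas bounded_meas_mult bounded_meas_indicator bounded_meas_XM events_F[OF A]) auto
  have "expectation (\<lambda>\<omega>. indicator A \<omega> * T j \<omega>) = (\<Sum>i\<in>{j<..n}. expectation (\<lambda>\<omega>. indicator A \<omega> * X i \<omega>))"
    unfolding T_def sum_distrib_left by (rule Bochner_Integration.integral_sum[OF bX])
  also have "\<bar>\<dots>\<bar> \<le> (\<Sum>i\<in>{j<..n}. 2 * K * prob A * sqrt (h (i - j)))"
  proof (intro order_trans[OF sum_abs] sum_mono)
    fix i assume i: "i \<in> {j<..n}"
    have "\<bar>expectation (\<lambda>\<omega>. indicator A \<omega> * X i \<omega>)\<bar> \<le> 2 * K * h (i - j) * expectation (\<lambda>\<omega>. \<bar>indicator A \<omega>\<bar>)"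
      using i by (intro covariance_X bounded_meas_indicator A) auto
    also have "\<dots> = 2 * K * prob A * h (i - j)"
      using events_F[OF A] by simp
    also have "\<dots> \<le> 2 * K * prob A * sqrt (h (i - j))"
      using i K_nonneg by (intro mult_left_mono sqrt_h_bounds) auto
    finally show "\<bar>expectation (\<lambda>\<omega>. indicator A \<omega> * X i \<omega>)\<bar> \<le> 2 * K * prob A * sqrt (h (i - j))" .
  qed
  also have "\<dots> = 2 * K * prob A * (\<Sum>i\<in>{j<..n}. sqrt (h (i - j)))"
    by (simp add: sum_distrib_left)
  also have "\<dots> \<le> 2 * K * prob A * H"
    using K_nonneg by (intro mult_left_mono sum_sqrt_h_le) auto
  finally show ?thesis by (simp add: mult_ac)
qed

text \<open>
  For \<open>j < i \<le> i'\<close> the mixing between \<open>F j\<close> and \<open>G i\<close> and the mixing between \<open>F i\<close> and \<open>G i'\<close> each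
  give a bound; the geometric mean of the two is summable over both indices.
\<close>

definition gap_weight :: "nat \<Rightarrow> real" where "gap_weight l = (if l = 0 then 1 else sqrt (h l))"

lemma sum_gap_weight_le: "(\<Sum>i'\<in>{j<..n}. if i \<le> i' then gap_weight (i' - i) else 0) \<le> 1 + H"
proof -
  have "(\<Sum>i'\<in>{j<..n}. if i \<le> i' then gap_weight (i' - i) else 0) = (\<Sum>i'\<in>{i'\<in>{j<..n}. i \<le> i'}. gap_weight (i' - i))"
    by (rule sum.inter_filter[symmetric]) simp
  also have "\<dots> \<le> (\<Sum>i'\<in>insert i {i<..n}. gap_weight (i' - i))"
    by (intro sum_mono2) (auto simp: gap_weight_def sqrt_h_bounds h_nonneg)
  also have "\<dots> = 1 + (\<Sum>i'\<in>{i<..n}. sqrt (h (i' - i)))"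
    by (simp add: gap_weight_def)
  finally show ?thesis
    using sum_sqrt_h_le[of i] by linarith
qed

lemma pair_covariance:
  assumes "j < i" "i \<le> i'" "i' \<le> n" and A: "A \<in> sets (F j)"
  shows "\<bar>expectation (\<lambda>\<omega>. indicator A \<omega> * (X i \<omega> * X i' \<omega> - expectation (\<lambda>\<omega>. X i \<omega> * X i' \<omega>)))\<bar>
    \<le> 4 * K\<^sup>2 * (sqrt (h (i - j)) * gap_weight (i' - i)) * prob A" (is "?l \<le> _")
proof -
  let ?P = "4 * K\<^sup>2 * prob A"
  have AM: "A \<in> events"
    by (rule events_F[OF A])
  have Xi: "\<bar>X i \<omega>\<bar> \<le> K" and Xi': "\<bar>X i' \<omega>\<bar> \<le> K" for \<omega>
    using assms by (auto intro!: X_le)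
  have XX: "\<bar>X i \<omega> * X i' \<omega>\<bar> \<le> K\<^sup>2" for \<omega>
    unfolding abs_mult power2_eq_square by (intro mult_mono Xi Xi' K_nonneg) auto
  \<comment> \<open>The product of the two summands lies in the future from time \<open>i\<close>
    and is bounded by \<open>K\<^sup>2\<close>. The constant 2 is then enlarged to 4 to match the
    other bound.\<close>
  have "?l \<le> 2 * K\<^sup>2 * (h (i - j) * prob A)"
  proof (rule covariance_indicator_bounded[OF AM subG[of i] _ _ XX])
    show "(\<lambda>\<omega>. X i \<omega> * X i' \<omega>) \<in> borel_measurable (G i)"
      using assms XG[of i i] XG[of i i'] by (intro borel_measurable_times) auto
  qed (use assms mix[of j i] in auto)
  also have "\<dots> \<le> h (i - j) * ?P"
    using h_nonneg[of "i - j"] assms by simp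
  finally have near: "?l \<le> h (i - j) * ?P" .
  \<comment> \<open>Here the two terms of the covariance are small separately, since
    \<open>X i'\<close> is centred and far from everything up to time \<open>i\<close>: each
    contributes \<open>2 * K\<^sup>2 * h (i' - i) * prob A\<close>.\<close>
  have far: "?l \<le> h (i' - i) * ?P" if "i < i'"
  proof -
    have bA: "bounded_meas (F i) (indicator A :: _ \<Rightarrow> real)"
      using assms by (intro bounded_meas_mono[OF bounded_meas_indicator[OF A]]) auto
    have bX: "bounded_meas (F i) (X i)"
      using assms by (intro bounded_meas_X) auto
    have bAX: "bounded_meas (F i) (\<lambda>\<omega>. indicator A \<omega> * X i \<omega>)"
      by (rule bounded_meas_mult[OF bA bX])
    have h0: "0 \<le> h (i' - i)"
      using h_nonneg[of "i' - i"] that assms by auto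
    have "\<bar>expectation (\<lambda>\<omega>. indicator A \<omega> * X i \<omega> * X i' \<omega>)\<bar> \<le>
        2 * K * h (i' - i) * expectation (\<lambda>\<omega>. \<bar>indicator A \<omega> * X i \<omega>\<bar>)"
      using that assms by (intro covariance_X[OF _ _ bAX]) auto
    also have "expectation (\<lambda>\<omega>. \<bar>indicator A \<omega> * X i \<omega>\<bar>) \<le> expectation (\<lambda>\<omega>. K * indicator A \<omega>)"
    proof (intro integral_mono integrable_bounded_meas bounded_meas_abs bounded_meas_M[OF bAX]
        bounded_meas_mult bounded_meas_const bounded_meas_M[OF bA])
      show "\<bar>indicator A \<omega> * X i \<omega>\<bar> \<le> K * indicator A \<omega>" for \<omega>
        using Xi[of \<omega>] by (auto simp: indicator_def)
    qed
    also have "\<dots> = K * prob A"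
      using AM by simp
    finally have 1: "\<bar>expectation (\<lambda>\<omega>. indicator A \<omega> * X i \<omega> * X i' \<omega>)\<bar> \<le> 2 * K * h (i' - i) * (K * prob A)"
      using K_nonneg h0 by (simp add: mult_left_mono)
    have "\<bar>expectation (\<lambda>\<omega>. X i \<omega> * X i' \<omega>)\<bar> \<le> 2 * K * h (i' - i) * expectation (\<lambda>\<omega>. \<bar>X i \<omega>\<bar>)"
      using that assms by (intro covariance_X[OF _ _ bX]) auto
    also have "expectation (\<lambda>\<omega>. \<bar>X i \<omega>\<bar>) \<le> K"
      using Xi by (intro integral_le_const integrable_bounded_meas bounded_meas_abs bounded_meas_M[OF bX]) auto
    finally have 2: "\<bar>expectation (\<lambda>\<omega>. X i \<omega> * X i' \<omega>)\<bar> \<le> 2 * K * h (i' - i) * K"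
      using K_nonneg h0 by (simp add: mult_left_mono)
    have "expectation (\<lambda>\<omega>. indicator A \<omega> * (X i \<omega> * X i' \<omega> - expectation (\<lambda>\<omega>. X i \<omega> * X i' \<omega>))) =
        expectation (\<lambda>\<omega>. indicator A \<omega> * X i \<omega> * X i' \<omega> - indicator A \<omega> * expectation (\<lambda>\<omega>. X i \<omega> * X i' \<omega>))"
      by (simp only: right_diff_distrib mult.assoc)
    also have "\<dots> = expectation (\<lambda>\<omega>. indicator A \<omega> * X i \<omega> * X i' \<omega>) - prob A * expectation (\<lambda>\<omega>. X i \<omega> * X i' \<omega>)"
      using AM assms
      by (subst Bochner_Integration.integral_diff)
        (auto intro!: integrable_bounded_meas bounded_meas_intros bounded_meas_XM)
    also have "\<bar>\<dots>\<bar> \<le> 2 * K * h (i' - i) * (K * prob A) + prob A * (2 * K * h (i' - i) * K)"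
      using mult_left_mono[OF 2, of "prob A"] 1
      by (intro order_trans[OF abs_triangle_ineq4] add_mono) (auto simp: abs_mult)
    finally show ?thesis
      by (simp add: power2_eq_square mult_ac)
  qed
  have P0: "0 \<le> ?P" by simp
  have "?l \<le> (sqrt (h (i - j)) * gap_weight (i' - i)) * ?P"
  proof (cases "i = i'")
    case True
    have "h (i - j) * ?P \<le> sqrt (h (i - j)) * ?P"
      using assms P0 by (intro mult_right_mono sqrt_h_bounds) auto
    then show ?thesis
      using near True by (simp add: gap_weight_def)
  next
    case False
    have "?l \<le> sqrt (h (i - j) * ?P) * sqrt (h (i' - i) * ?P)"
      using near far False assms by (intro le_sqrt_mult_sqrt) auto
    also have "\<dots> = (sqrt (h (i - j)) * sqrt (h (i' - i))) * (sqrt ?P * sqrt ?P)"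
      by (simp only: real_sqrt_mult mult_ac)
    also have "sqrt ?P * sqrt ?P = ?P"
      using P0 by simp
    finally show ?thesis
      using False assms by (simp add: gap_weight_def)
  qed
  then show ?thesis
    by (simp only: mult_ac)
qed

text \<open>Expand the square and sum \<open>pair_covariance\<close>: the weight of the later gap
  sums to at most \<open>1 + H\<close>, that of the gap after \<open>j\<close> to at most
  \<open>H\<close>. No factor for the number of summands appears, which is what the product form of
  the pair bound is for.\<close>

lemma T_conditional_variance:
  assumes "j \<le> n" and A: "A \<in> sets (F j)"
  shows "\<bar>expectation (\<lambda>\<omega>. indicator A \<omega> * ((T j \<omega>)\<^sup>2 - expectation (\<lambda>\<omega>. (T j \<omega>)\<^sup>2)))\<bar>
    \<le> 8 * K\<^sup>2 * (H * (1 + H)) * prob A"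
proof -
  let ?J = "{j<..n}"
  define c where "c i i' = expectation (\<lambda>\<omega>. X i \<omega> * X i' \<omega>)" for i i'
  define D where "D i i' \<omega> = indicator A \<omega> * (X i \<omega> * X i' \<omega> - c i i')" for i i' and \<omega> :: 'a
  \<comment> \<open>\<open>f\<close> is supported on ordered pairs. As \<open>D\<close> is
    symmetric, \<open>f i i' + f i' i\<close> covers both orders, and the doubling turns 4 into
    8.\<close>
  define f where "f i i' = (if i \<le> i' then sqrt (h (i - j)) * gap_weight (i' - i) else 0)" for i i'
  have AM: "A \<in> events"
    by (rule events_F[OF A])
  have bXX: "bounded_meas M (\<lambda>\<omega>. X i \<omega> * X i' \<omega>)" if "i \<in> ?J" "i' \<in> ?J" for i i'
    using that by (intro bounded_meas_mult bounded_meas_XM) auto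
  have iD: "integrable M (D i i')" if "i \<in> ?J" "i' \<in> ?J" for i i'
    unfolding D_def using that
    by (intro integrable_bounded_meas bounded_meas_mult bounded_meas_diff bounded_meas_indicator
        bounded_meas_const bounded_meas_XM AM) auto
  have T2: "(T j \<omega>)\<^sup>2 = (\<Sum>i\<in>?J. \<Sum>i'\<in>?J. X i \<omega> * X i' \<omega>)" for \<omega>
    unfolding T_def power2_eq_square by (simp add: sum_product)
  have ET2: "expectation (\<lambda>\<omega>. (T j \<omega>)\<^sup>2) = (\<Sum>i\<in>?J. \<Sum>i'\<in>?J. c i i')"
    unfolding T2 c_def by (rule integral_double_sum) (rule integrable_bounded_meas[OF bXX])
  have "indicator A \<omega> * ((T j \<omega>)\<^sup>2 - expectation (\<lambda>\<omega>. (T j \<omega>)\<^sup>2)) = (\<Sum>i\<in>?J. \<Sum>i'\<in>?J. D i i' \<omega>)" for \<omega>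
    unfolding ET2 unfolding T2 D_def by (simp only: sum_subtractf[symmetric] sum_distrib_left)
  then have "expectation (\<lambda>\<omega>. indicator A \<omega> * ((T j \<omega>)\<^sup>2 - expectation (\<lambda>\<omega>. (T j \<omega>)\<^sup>2))) =
      (\<Sum>i\<in>?J. \<Sum>i'\<in>?J. expectation (D i i'))"
    using integral_double_sum[of ?J M D, OF iD] by simp
  also have "\<bar>\<dots>\<bar> \<le> (\<Sum>i\<in>?J. \<Sum>i'\<in>?J. \<bar>expectation (D i i')\<bar>)"
    by (intro order_trans[OF sum_abs] sum_mono order_refl)
  also have "\<dots> \<le> (\<Sum>i\<in>?J. \<Sum>i'\<in>?J. 4 * K\<^sup>2 * prob A * (f i i' + f i' i))"
  proof (intro sum_mono)
    fix i i' assume i: "i \<in> ?J" "i' \<in> ?J"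
    have f0: "0 \<le> f a b" if "a \<in> ?J" "b \<in> ?J" for a b
      using that sqrt_h_bounds(1)[of "a - j"] sqrt_h_bounds(1)[of "b - a"]
      by (auto simp: f_def gap_weight_def intro!: mult_nonneg_nonneg)
    have le: "\<bar>expectation (D a b)\<bar> \<le> 4 * K\<^sup>2 * prob A * f a b" if "a \<in> ?J" "b \<in> ?J" "a \<le> b" for a b
      using pair_covariance[of j a b A] that A by (simp add: D_def[abs_def] c_def f_def mult_ac)
    have sym: "D i i' = D i' i"
      by (auto simp: D_def c_def mult.commute)
    have f_le: "4 * K\<^sup>2 * prob A * f a b \<le> 4 * K\<^sup>2 * prob A * (f i i' + f i' i)"
      if "f a b \<le> f i i' + f i' i" for a b
      using that by (intro mult_left_mono) auto
    show "\<bar>expectation (D i i')\<bar> \<le> 4 * K\<^sup>2 * prob A * (f i i' + f i' i)"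
    proof (cases "i \<le> i'")
      case True
      show ?thesis
        by (rule order_trans[OF le[OF i True] f_le]) (use f0 i in auto)
    next
      case False
      then have "i' \<le> i" by simp
      show ?thesis
        unfolding sym by (rule order_trans[OF le[OF i(2,1) \<open>i' \<le> i\<close>] f_le]) (use f0 i in auto)
    qed
  qed
  also have "\<dots> = 4 * K\<^sup>2 * prob A * ((\<Sum>i\<in>?J. \<Sum>i'\<in>?J. f i i') + (\<Sum>i\<in>?J. \<Sum>i'\<in>?J. f i' i))"
    by (simp only: sum_distrib_left[symmetric] sum.distrib)
  also have "(\<Sum>i\<in>?J. \<Sum>i'\<in>?J. f i' i) = (\<Sum>i\<in>?J. \<Sum>i'\<in>?J. f i i')"
    by (rule sum.swap)
  finally have le: "\<bar>expectation (\<lambda>\<omega>. indicator A \<omega> * ((T j \<omega>)\<^sup>2 - expectation (\<lambda>\<omega>. (T j \<omega>)\<^sup>2)))\<bar>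
    \<le> 8 * K\<^sup>2 * prob A * (\<Sum>i\<in>?J. \<Sum>i'\<in>?J. f i i')"
    by simp
  have "(\<Sum>i\<in>?J. \<Sum>i'\<in>?J. f i i') \<le> (\<Sum>i\<in>?J. sqrt (h (i - j)) * (1 + H))"
  proof (intro sum_mono)
    fix i assume i: "i \<in> ?J"
    have "(\<Sum>i'\<in>?J. f i i') = sqrt (h (i - j)) * (\<Sum>i'\<in>?J. if i \<le> i' then gap_weight (i' - i) else 0)"
      unfolding f_def sum_distrib_left by (intro sum.cong) auto
    also have "\<dots> \<le> sqrt (h (i - j)) * (1 + H)"
      using i by (intro mult_left_mono sum_gap_weight_le sqrt_h_bounds) auto
    finally show "(\<Sum>i'\<in>?J. f i i') \<le> sqrt (h (i - j)) * (1 + H)" .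
  qed
  also have "\<dots> \<le> H * (1 + H)"
    unfolding sum_distrib_right[symmetric] using H_nonneg by (intro mult_right_mono sum_sqrt_h_le) auto
  finally have "8 * K\<^sup>2 * prob A * (\<Sum>i\<in>?J. \<Sum>i'\<in>?J. f i i') \<le> 8 * K\<^sup>2 * prob A * (H * (1 + H))"
    by (intro mult_left_mono) auto
  with le show ?thesis
    by (simp only: mult_ac)
qed

lemma expectation_T: "expectation (T j) = 0"
proof -
  have "expectation (T j) = (\<Sum>i\<in>{j<..n}. expectation (X i))"
    unfolding T_def by (intro Bochner_Integration.integral_sum integrable_bounded_meas bounded_meas_XM) auto
  also have "\<dots> = 0"
    by (intro sum.neutral ballI X_mean) auto
  finally show ?thesis .
qed

text \<open>At time 0 the past contains only the trivial events, and at time \<open>n\<close> the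
  remaining sum is 0. This exactness makes the centred conditional variance vanish at both
  ends.\<close>

lemma covariance_at_ends:
  assumes j: "j = 0 \<or> j = n" and A: "A \<in> sets (F j)" and f: "bounded_meas M (\<lambda>\<omega>. f (T j \<omega>))"
  shows "expectation (\<lambda>\<omega>. indicator A \<omega> * (f (T j \<omega>) - expectation (\<lambda>\<omega>. f (T j \<omega>)))) = 0"
proof (cases "j = n")
  case True
  then have "T j \<omega> = 0" for \<omega>
    by (simp add: T_def)
  then show ?thesis
    by (simp add: prob_space)
next
  case False
  with j A F0 have "A = {} \<or> A = space M"
    by auto
  moreover have "expectation (\<lambda>\<omega>. indicator (space M) \<omega> * (f (T j \<omega>) - expectation (\<lambda>\<omega>. f (T j \<omega>)))) =
      expectation (\<lambda>\<omega>. f (T j \<omega>) - expectation (\<lambda>\<omega>. f (T j \<omega>)))"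
    by (intro Bochner_Integration.integral_cong) auto
  moreover have "\<dots> = 0"
    using integrable_bounded_meas[OF f] by (simp add: prob_space)
  ultimately show ?thesis
    by auto
qed

text \<open>Chooses, for all times at once, versions of the conditional expectation of
  \<open>f (T j)\<close> given \<open>F j\<close>. It is applied to the identity and to the square,
  which together give the conditional variance.\<close>

lemma exists_conditional_expectations:
  assumes f: "\<And>j. bounded_meas M (\<lambda>\<omega>. f (T j \<omega>))"
    and c: "\<And>j A. j \<le> n \<Longrightarrow> A \<in> sets (F j) \<Longrightarrow>
      \<bar>expectation (\<lambda>\<omega>. indicator A \<omega> * (f (T j \<omega>) - expectation (\<lambda>\<omega>. f (T j \<omega>))))\<bar> \<le> c * prob A"
    and c0: "0 \<le> c"
  obtains m where "\<And>j. j \<le> n \<Longrightarrow> bounded_meas (F j) (m j)"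
    and "\<And>j \<omega>. j \<le> n \<Longrightarrow> \<bar>m j \<omega> - expectation (\<lambda>\<omega>. f (T j \<omega>))\<bar> \<le> c"
    and "\<And>j \<omega>. j = 0 \<or> j = n \<Longrightarrow> m j \<omega> = expectation (\<lambda>\<omega>. f (T j \<omega>))"
    and "\<And>j u. j \<le> n \<Longrightarrow> bounded_meas (F j) u \<Longrightarrow>
      expectation (\<lambda>\<omega>. u \<omega> * m j \<omega>) = expectation (\<lambda>\<omega>. u \<omega> * f (T j \<omega>))"
proof -
  define e where "e j = expectation (\<lambda>\<omega>. f (T j \<omega>))" for j
  \<comment> \<open>The radius 0 at the two ends turns the deviation bound into equality at every
    point.\<close>
  define c' where "c' j = (if j = 0 \<or> j = n then 0 else c)" for j
  define Q where "Q j m \<longleftrightarrow> m \<in> borel_measurable (F j) \<and> (\<forall>\<omega>. \<bar>m \<omega> - e j\<bar> \<le> c' j) \<and>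
    (\<forall>u. bounded_meas (F j) u \<longrightarrow> expectation (\<lambda>\<omega>. u \<omega> * m \<omega>) = expectation (\<lambda>\<omega>. u \<omega> * f (T j \<omega>)))" for j m
  have "\<exists>m. Q j m" if "j \<le> n" for j
  proof -
    have "\<bar>expectation (\<lambda>\<omega>. indicator A \<omega> * (f (T j \<omega>) - e j))\<bar> \<le> c' j * prob A" if A: "A \<in> sets (F j)" for A
      using c[OF \<open>j \<le> n\<close> A] covariance_at_ends[OF _ A f] by (auto simp: c'_def e_def)
    then obtain m where "m \<in> borel_measurable (F j)" "\<And>\<omega>. \<bar>m \<omega> - e j\<bar> \<le> c' j"
      "\<And>u. bounded_meas (F j) u \<Longrightarrow> expectation (\<lambda>\<omega>. u \<omega> * m \<omega>) = expectation (\<lambda>\<omega>. u \<omega> * f (T j \<omega>))"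
      by (rule exists_bounded_cond_exp[OF subF f]) auto
    then show ?thesis
      unfolding Q_def by blast
  qed
  then have "\<forall>j\<in>{..n}. \<exists>m. Q j m" by simp
  then have "\<exists>m. \<forall>j\<in>{..n}. Q j (m j)" by (rule bchoice)
  then obtain m where m: "\<And>j. j \<le> n \<Longrightarrow> Q j (m j)" by auto
  have le: "\<bar>m j \<omega> - e j\<bar> \<le> c' j" if "j \<le> n" for j \<omega>
    using m[OF that] by (simp add: Q_def)
  show ?thesis
  proof (rule that[of m, folded e_def])
    show "bounded_meas (F j) (m j)" if "j \<le> n" for j
    proof (rule bounded_measI)
      show "\<bar>m j \<omega>\<bar> \<le> \<bar>e j\<bar> + c' j" for \<omega>
        using le[OF that, of \<omega>] by linarith
    qed (use m[OF that] in \<open>simp add: Q_def\<close>)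
    show "\<bar>m j \<omega> - e j\<bar> \<le> c" if "j \<le> n" for j \<omega>
      using le[OF that, of \<omega>] c0 by (auto simp: c'_def split: if_splits)
    show "m j \<omega> = e j" if "j = 0 \<or> j = n" for j \<omega>
    proof -
      have "j \<le> n" using that by auto
      from le[OF this, of \<omega>] show ?thesis
        using that by (simp add: c'_def)
    qed
    show "expectation (\<lambda>\<omega>. u \<omega> * m j \<omega>) = expectation (\<lambda>\<omega>. u \<omega> * f (T j \<omega>))"
      if "j \<le> n" "bounded_meas (F j) u" for j u
      using m[OF that(1)] that(2) by (simp add: Q_def)
  qed
qed

text \<open>The sum of the first \<open>j\<close> summands plus \<open>m j\<close> is the martingale
  of conditional means of the whole sum; its increments and the centred conditional variances
  satisfy the hypotheses of \<open>martingale_laplace_bounds\<close>.\<close>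

theorem laplace_bounds:
  assumes eps: "0 < \<epsilon>" "\<epsilon> \<le> 1/4" and small: "5 * K * (1 + H) \<le> \<epsilon> / 100"
  shows "expectation (\<lambda>\<omega>. exp (\<Sum>i=1..n. X i \<omega>))
      \<le> exp ((1/2 + \<epsilon>) * expectation (\<lambda>\<omega>. (\<Sum>i=1..n. X i \<omega>)\<^sup>2))"
    and "expectation (\<lambda>\<omega>. exp (\<Sum>i=1..n. X i \<omega>))
      \<ge> exp ((1/2 - \<epsilon>) * expectation (\<lambda>\<omega>. (\<Sum>i=1..n. X i \<omega>)\<^sup>2))"
proof -
  \<comment> \<open>The factor 5 serves both requirements: increments are at most
    \<open>K + 4 * K * H\<close>, and centred conditional variances at most
    \<open>16 * K\<^sup>2 * H * (1 + H) + 8 * (K * H)\<^sup>2\<close>, which is below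
    \<open>s\<^sup>2\<close>.\<close>
  define s where "s = 5 * K * (1 + H)"
  define c where "c = 8 * K\<^sup>2 * (H * (1 + H))"
  have KH: "0 \<le> K * H"
    using K_nonneg H_nonneg by simp
  have c0: "0 \<le> c"
    unfolding c_def using H_nonneg by simp
  have KH2: "0 \<le> 2 * K * H"
    using KH by simp
  have mean: "\<bar>expectation (\<lambda>\<omega>. indicator A \<omega> * (T j \<omega> - expectation (T j)))\<bar> \<le> 2 * K * H * prob A"
    if "j \<le> n" "A \<in> sets (F j)" for j A
    using T_conditional_mean[OF that] by (simp add: expectation_T)
  obtain m where mF: "\<And>j. j \<le> n \<Longrightarrow> bounded_meas (F j) (m j)"
    and m_le': "\<And>j \<omega>. j \<le> n \<Longrightarrow> \<bar>m j \<omega> - expectation (T j)\<bar> \<le> 2 * K * H"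
    and m_ends': "\<And>j \<omega>. j = 0 \<or> j = n \<Longrightarrow> m j \<omega> = expectation (T j)"
    and m_proj: "\<And>j u. j \<le> n \<Longrightarrow> bounded_meas (F j) u \<Longrightarrow>
      expectation (\<lambda>\<omega>. u \<omega> * m j \<omega>) = expectation (\<lambda>\<omega>. u \<omega> * T j \<omega>)"
    by (rule exists_conditional_expectations[where f = "\<lambda>x. x", OF bounded_meas_T mean KH2]) auto
  note m_le = m_le'[unfolded expectation_T diff_0_right]
  note m_ends = m_ends'[unfolded expectation_T]
  define e where "e j = expectation (\<lambda>\<omega>. (T j \<omega>)\<^sup>2)" for j
  have bT2: "bounded_meas M (\<lambda>\<omega>. (T j \<omega>)\<^sup>2)" for j
    by (intro bounded_meas_power bounded_meas_T)
  obtain q where qF: "\<And>j. j \<le> n \<Longrightarrow> bounded_meas (F j) (q j)"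
    and q_le: "\<And>j \<omega>. j \<le> n \<Longrightarrow> \<bar>q j \<omega> - e j\<bar> \<le> c"
    and q_ends: "\<And>j \<omega>. j = 0 \<or> j = n \<Longrightarrow> q j \<omega> = e j"
    and q_proj: "\<And>j u. j \<le> n \<Longrightarrow> bounded_meas (F j) u \<Longrightarrow>
      expectation (\<lambda>\<omega>. u \<omega> * q j \<omega>) = expectation (\<lambda>\<omega>. u \<omega> * (T j \<omega>)\<^sup>2)"
    unfolding e_def
    by (rule exists_conditional_expectations[where f = "\<lambda>x. x\<^sup>2", OF bT2 T_conditional_variance c0[unfolded c_def], folded c_def])
      auto
  \<comment> \<open>With \<open>m\<close> and \<open>q\<close> the conditional first and second
    moments of the remaining sum, \<open>P\<close> is its conditional variance.\<close>
  define P where "P j \<omega> = q j \<omega> - (m j \<omega>)\<^sup>2" for j \<omega>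
  define V where "V j \<omega> = P j \<omega> - expectation (P j)" for j \<omega>
  define d where "d j \<omega> = X j \<omega> + m j \<omega> - m (j - 1) \<omega>" for j \<omega>
  define v where "v j = expectation (\<lambda>\<omega>. (d j \<omega>)\<^sup>2)" for j
  have PF: "bounded_meas (F j) (P j)" if "j \<le> n" for j
    unfolding P_def by (intro bounded_meas_intros mF qF that)
  have m_pred: "bounded_meas (F j) (m (j - 1))" if "j \<le> n" for j
    using that by (intro bounded_meas_mono[OF mF]) auto
  have dF: "bounded_meas (F j) (d j)" if "1 \<le> j" "j \<le> n" for j
    unfolding d_def by (intro bounded_meas_intros bounded_meas_X mF m_pred that order_refl)
  have s_le: "s \<le> \<epsilon> / 100"
    using small by (simp add: s_def)
  have d_le: "\<bar>d j \<omega>\<bar> \<le> s" if "1 \<le> j" "j \<le> n" for j \<omega>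
  proof -
    have "s = 5 * K + 5 * (K * H)"
      unfolding s_def by (simp add: algebra_simps)
    moreover have "\<bar>d j \<omega>\<bar> \<le> \<bar>X j \<omega>\<bar> + \<bar>m j \<omega>\<bar> + \<bar>m (j - 1) \<omega>\<bar>"
      unfolding d_def by linarith
    moreover have "j - 1 \<le> n"
      using that by simp
    then have "\<bar>X j \<omega>\<bar> \<le> K" "\<bar>m j \<omega>\<bar> \<le> 2 * (K * H)" "\<bar>m (j - 1) \<omega>\<bar> \<le> 2 * (K * H)"
      using X_le[OF that, of \<omega>] m_le[OF that(2), of \<omega>] m_le[of "j - 1" \<omega>] by (simp_all only: mult.assoc)
    ultimately show ?thesis
      using K_nonneg KH by linarith
  qed
  have V_le: "\<bar>V j \<omega>\<bar> \<le> s\<^sup>2" if "j \<le> n" for j \<omega>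
  proof -
    \<comment> \<open>\<open>r\<close> bounds the distance of \<open>P j\<close> from the number
      \<open>e j\<close>. The mean of \<open>P j\<close> is equally close to \<open>e j\<close>, so
      centring doubles \<open>r\<close>.\<close>
    define r where "r = c + 4 * (K * H)\<^sup>2"
    have P_le: "\<bar>P j \<omega> - e j\<bar> \<le> r" for \<omega>
    proof -
      have "(m j \<omega>)\<^sup>2 \<le> 4 * (K * H)\<^sup>2"
        using power_mono[OF m_le[OF that, of \<omega>] abs_ge_zero, of 2] by (simp add: power_mult_distrib)
      then show ?thesis
        using q_le[OF that, of \<omega>] zero_le_power2[of "m j \<omega>"] unfolding P_def r_def by linarith
    qed
    have "expectation (P j) \<le> e j + r"
      using P_le by (intro integral_le_const integrable_bounded_meas bounded_meas_M[OF PF[OF that]] AE_I2)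
        (simp add: abs_le_iff algebra_simps)
    moreover have "expectation (P j) \<ge> e j - r"
      using P_le by (intro integral_ge_const integrable_bounded_meas bounded_meas_M[OF PF[OF that]] AE_I2)
        (simp add: abs_le_iff algebra_simps)
    ultimately have "\<bar>V j \<omega>\<bar> \<le> 2 * r"
      using P_le[of \<omega>] unfolding V_def by linarith
    also have "2 * r \<le> s\<^sup>2"
    proof -
      have "s\<^sup>2 - 2 * r = 25 * K\<^sup>2 + 34 * (K\<^sup>2 * H) + K\<^sup>2 * H\<^sup>2"
        unfolding s_def r_def c_def by (simp add: power2_eq_square algebra_simps)
      moreover have "\<dots> \<ge> 0"
        using H_nonneg by simp
      ultimately show ?thesis by linarith
    qed
    finally show ?thesis .
  qed
  have V_ends: "V j \<omega> = 0" if "j = 0 \<or> j = n" for j \<omega>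
    using that unfolding V_def P_def by (simp add: m_ends q_ends prob_space)
  \<comment> \<open>\<open>projP\<close> is the conditional law of total variance in weak form:
    tested against the past, \<open>P (j - 1)\<close> equals \<open>P j\<close> plus the squared
    increment.\<close>
  have proj: "expectation (\<lambda>\<omega>. u \<omega> * d j \<omega>) = 0"
    and projP: "expectation (\<lambda>\<omega>. u \<omega> * (P j \<omega> - P (j - 1) \<omega> + (d j \<omega>)\<^sup>2)) = 0"
    if j: "1 \<le> j" "j \<le> n" and u: "bounded_meas (F (j - 1)) u" for j u
  proof -
    have j1: "j - 1 \<le> n" using j by simp
    have T_pred: "T (j - 1) \<omega> = X j \<omega> + T j \<omega>" for \<omega>
    proof -
      have "{j - 1<..n} = insert j {j<..n}"
        using j by auto
      then show ?thesis by (simp add: T_def)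
    qed
    have uj: "bounded_meas (F j) u"
      by (rule bounded_meas_mono[OF u]) simp
    have um': "bounded_meas (F (j - 1)) (\<lambda>\<omega>. u \<omega> * m (j - 1) \<omega>)"
      by (intro bounded_meas_mult u mF j1)
    have um'j: "bounded_meas (F j) (\<lambda>\<omega>. u \<omega> * m (j - 1) \<omega>)"
      by (rule bounded_meas_mono[OF um']) simp
    have uX: "bounded_meas (F j) (\<lambda>\<omega>. u \<omega> * X j \<omega>)"
      by (intro bounded_meas_mult uj bounded_meas_X j order_refl)
    note bM = bounded_meas_M[OF uj] bounded_meas_M[OF mF[OF j(2)]] bounded_meas_M[OF mF[OF j1]]
      bounded_meas_M[OF qF[OF j(2)]] bounded_meas_M[OF qF[OF j1]] bounded_meas_XM[OF j] bounded_meas_T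
    note int = integrable_bounded_meas bounded_meas_add bounded_meas_diff bounded_meas_mult
      bounded_meas_power bounded_meas_const bM
    have "expectation (\<lambda>\<omega>. u \<omega> * d j \<omega>) =
        expectation (\<lambda>\<omega>. u \<omega> * X j \<omega> + u \<omega> * m j \<omega> - u \<omega> * m (j - 1) \<omega>)"
      by (simp add: d_def algebra_simps del: One_nat_def)
    also have "\<dots> = expectation (\<lambda>\<omega>. u \<omega> * X j \<omega>) + expectation (\<lambda>\<omega>. u \<omega> * m j \<omega>) -
        expectation (\<lambda>\<omega>. u \<omega> * m (j - 1) \<omega>)"
      by (simp add: int del: One_nat_def)
    also have "\<dots> = expectation (\<lambda>\<omega>. u \<omega> * X j \<omega>) + expectation (\<lambda>\<omega>. u \<omega> * T j \<omega>) -
        expectation (\<lambda>\<omega>. u \<omega> * X j \<omega> + u \<omega> * T j \<omega>)"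
      unfolding m_proj[OF j(2) uj] m_proj[OF j1 u] T_pred by (simp add: distrib_left del: One_nat_def)
    also have "\<dots> = 0"
      by (simp add: int del: One_nat_def)
    finally show "expectation (\<lambda>\<omega>. u \<omega> * d j \<omega>) = 0" .
    let ?m' = "m (j - 1)"
    \<comment> \<open>The square of \<open>m j\<close> in \<open>P j\<close> cancels against the one
      in the squared increment. Every term left is linear in a conditional moment, with a multiplier
      measurable at the corresponding time, so the moments may be replaced by powers of the
      remaining sums.\<close>
    have "expectation (\<lambda>\<omega>. u \<omega> * (P j \<omega> - P (j - 1) \<omega> + (d j \<omega>)\<^sup>2)) =
      expectation (\<lambda>\<omega>. u \<omega> * q j \<omega> - u \<omega> * q (j - 1) \<omega> + u \<omega> * (X j \<omega>)\<^sup>2 + 2 * (u \<omega> * X j \<omega> * m j \<omega>) +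
        2 * (u \<omega> * ?m' \<omega> * ?m' \<omega>) - 2 * (u \<omega> * ?m' \<omega> * X j \<omega>) - 2 * (u \<omega> * ?m' \<omega> * m j \<omega>))"
      unfolding P_def d_def by (intro Bochner_Integration.integral_cong refl) (simp add: power2_eq_square algebra_simps del: One_nat_def)
    also have "\<dots> = expectation (\<lambda>\<omega>. u \<omega> * q j \<omega>) - expectation (\<lambda>\<omega>. u \<omega> * q (j - 1) \<omega>) +
        expectation (\<lambda>\<omega>. u \<omega> * (X j \<omega>)\<^sup>2) + 2 * expectation (\<lambda>\<omega>. u \<omega> * X j \<omega> * m j \<omega>) +
        2 * expectation (\<lambda>\<omega>. u \<omega> * ?m' \<omega> * ?m' \<omega>) - 2 * expectation (\<lambda>\<omega>. u \<omega> * ?m' \<omega> * X j \<omega>) -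
        2 * expectation (\<lambda>\<omega>. u \<omega> * ?m' \<omega> * m j \<omega>)"
      by (simp add: int del: One_nat_def)
    also have "\<dots> = expectation (\<lambda>\<omega>. u \<omega> * (T j \<omega>)\<^sup>2) - expectation (\<lambda>\<omega>. u \<omega> * (X j \<omega> + T j \<omega>)\<^sup>2) +
        expectation (\<lambda>\<omega>. u \<omega> * (X j \<omega>)\<^sup>2) + 2 * expectation (\<lambda>\<omega>. u \<omega> * X j \<omega> * T j \<omega>) +
        2 * expectation (\<lambda>\<omega>. u \<omega> * ?m' \<omega> * (X j \<omega> + T j \<omega>)) - 2 * expectation (\<lambda>\<omega>. u \<omega> * ?m' \<omega> * X j \<omega>) -
        2 * expectation (\<lambda>\<omega>. u \<omega> * ?m' \<omega> * T j \<omega>)"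
      \<comment> \<open>In the square of \<open>m (j - 1)\<close> one factor is counted as
        multiplier and the other is projected. After all substitutions the integrand is identically
        0.\<close>
      unfolding q_proj[OF j(2) uj] q_proj[OF j1 u] m_proj[OF j(2) uX] m_proj[OF j1 um'] m_proj[OF j(2) um'j] T_pred ..
    also have "\<dots> = expectation (\<lambda>\<omega>. u \<omega> * (T j \<omega>)\<^sup>2 - u \<omega> * (X j \<omega> + T j \<omega>)\<^sup>2 +
        u \<omega> * (X j \<omega>)\<^sup>2 + 2 * (u \<omega> * X j \<omega> * T j \<omega>) +
        2 * (u \<omega> * ?m' \<omega> * (X j \<omega> + T j \<omega>)) - 2 * (u \<omega> * ?m' \<omega> * X j \<omega>) -
        2 * (u \<omega> * ?m' \<omega> * T j \<omega>))"
      by (simp add: int del: One_nat_def)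
    also have "\<dots> = expectation (\<lambda>\<omega>. 0)"
      by (intro Bochner_Integration.integral_cong refl) (simp add: power2_eq_square algebra_simps del: One_nat_def)
    finally show "expectation (\<lambda>\<omega>. u \<omega> * (P j \<omega> - P (j - 1) \<omega> + (d j \<omega>)\<^sup>2)) = 0"
      by simp
  qed
  have iP: "integrable M (P j)" if "j \<le> n" for j
    by (intro integrable_bounded_meas bounded_meas_M[OF PF[OF that]])
  have id: "integrable M (\<lambda>\<omega>. (d j \<omega>)\<^sup>2)" if "1 \<le> j" "j \<le> n" for j
    by (intro integrable_bounded_meas bounded_meas_power bounded_meas_M[OF dF[OF that]])
  have v_eq: "expectation (P (j - 1)) - expectation (P j) = v j" if "1 \<le> j" "j \<le> n" for j
  proof -
    have "j - 1 \<le> n" using that by simp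
    have "expectation (\<lambda>\<omega>. P j \<omega> - P (j - 1) \<omega> + (d j \<omega>)\<^sup>2) = 0"
      using projP[OF that bounded_meas_const[of _ 1]] by (simp del: One_nat_def)
    then show ?thesis
      unfolding v_def using iP[OF that(2)] iP[OF \<open>j - 1 \<le> n\<close>] id[OF that] by (simp del: One_nat_def)
  qed
  have V_orth: "expectation (\<lambda>\<omega>. u \<omega> * (V j \<omega> - V (j - 1) \<omega> + (d j \<omega>)\<^sup>2)) = v j * expectation u"
    if j: "1 \<le> j" "j \<le> n" and u: "bounded_meas (F (j - 1)) u" for j u
  proof -
    have "j - 1 \<le> n" using j by simp
    note int = integrable_bounded_meas bounded_meas_intros bounded_meas_M[OF u]
      bounded_meas_M[OF PF[OF j(2)]] bounded_meas_M[OF PF[OF \<open>j - 1 \<le> n\<close>]] bounded_meas_M[OF dF[OF j]]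
    have "u \<omega> * (V j \<omega> - V (j - 1) \<omega> + (d j \<omega>)\<^sup>2) =
        u \<omega> * (P j \<omega> - P (j - 1) \<omega> + (d j \<omega>)\<^sup>2) + v j * u \<omega>" for \<omega>
      unfolding V_def v_eq[OF j, symmetric] by (simp add: algebra_simps del: One_nat_def)
    then have "expectation (\<lambda>\<omega>. u \<omega> * (V j \<omega> - V (j - 1) \<omega> + (d j \<omega>)\<^sup>2)) =
        expectation (\<lambda>\<omega>. u \<omega> * (P j \<omega> - P (j - 1) \<omega> + (d j \<omega>)\<^sup>2) + v j * u \<omega>)"
      by simp
    also have "\<dots> = expectation (\<lambda>\<omega>. u \<omega> * (P j \<omega> - P (j - 1) \<omega> + (d j \<omega>)\<^sup>2)) + expectation (\<lambda>\<omega>. v j * u \<omega>)"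
      by (intro Bochner_Integration.integral_add int)
    finally show ?thesis
      using projP[OF j u] by (simp del: One_nat_def)
  qed
  have sum_d: "(\<Sum>j=1..n. d j \<omega>) = (\<Sum>i=1..n. X i \<omega>)" for \<omega>
  proof -
    \<comment> \<open>The telescoping leaves only \<open>m n\<close> and \<open>m 0\<close>, and
      both vanish.\<close>
    have "(\<Sum>j=1..k. d j \<omega>) = (\<Sum>i=1..k. X i \<omega>) + m k \<omega> - m 0 \<omega>" for k
      by (induction k) (auto simp: d_def)
    from this[of n] show ?thesis by (simp add: m_ends)
  qed
  have sum_v: "(\<Sum>j=1..n. v j) = expectation (\<lambda>\<omega>. (\<Sum>i=1..n. X i \<omega>)\<^sup>2)"
  proof -
    have "(\<Sum>j=1..k. v j) = expectation (P 0) - expectation (P k)" if "k \<le> n" for k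
      using that
    proof (induction k)
      case (Suc k)
      then show ?case using v_eq[of "Suc k"] by simp
    qed simp
    then have "(\<Sum>j=1..n. v j) = expectation (P 0) - expectation (P n)"
      by simp
    also have "\<dots> = e 0 - e n"
      unfolding P_def by (simp add: m_ends q_ends prob_space)
    also have "e n = 0"
      by (simp add: e_def T_def)
    also have "e 0 - 0 = expectation (\<lambda>\<omega>. (\<Sum>i=1..n. X i \<omega>)\<^sup>2)"
    proof -
      have "{0<..n} = {1..n}" by auto
      then show ?thesis by (simp add: e_def T_def)
    qed
    finally show ?thesis .
  qed
  have d_orth: "expectation (\<lambda>\<omega>. u \<omega> * d j \<omega>) = 0"
    if "1 \<le> j" "j \<le> n" "u \<in> borel_measurable (F (j - 1))" "\<And>\<omega>. \<bar>u \<omega>\<bar> \<le> C" for j u C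
    using that by (intro proj bounded_measI)
  have V_orth': "expectation (\<lambda>\<omega>. u \<omega> * (V j \<omega> - V (j - 1) \<omega> + (d j \<omega>)\<^sup>2)) = v j * expectation u"
    if "1 \<le> j" "j \<le> n" "u \<in> borel_measurable (F (j - 1))" "\<And>\<omega>. \<bar>u \<omega>\<bar> \<le> C" for j u C
    using that by (intro V_orth bounded_measI)
  have dF': "d j \<in> borel_measurable (F j)" if "1 \<le> j" "j \<le> n" for j
    using dF[OF that] by (simp add: bounded_meas_def)
  have VF: "V j \<in> borel_measurable (F j)" if "j \<le> n" for j
    using bounded_meas_diff[OF PF[OF that] bounded_meas_const] unfolding V_def bounded_meas_def by simp
  have V0: "V 0 \<omega> = 0" and Vn: "V n \<omega> = 0" if "\<omega> \<in> space M" for \<omega>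
    by (simp_all add: V_ends)
  have v_d: "v j = expectation (\<lambda>\<omega>. (d j \<omega>)\<^sup>2)" if "1 \<le> j" "j \<le> n" for j
    by (rule v_def)
  note facts = eps s_le subF monoF dF' VF d_le V_le V0 Vn d_orth V_orth' v_d
  have "expectation (\<lambda>\<omega>. exp (\<Sum>j=1..n. d j \<omega>)) \<le> exp ((1/2 + \<epsilon>) * (\<Sum>j=1..n. v j))"
    by (rule martingale_laplace_bounds(1)[where F = F and d = d and V = V and v = v and n = n and s = s and \<epsilon> = \<epsilon>])
      (fact facts)+
  then show "expectation (\<lambda>\<omega>. exp (\<Sum>i=1..n. X i \<omega>))
      \<le> exp ((1/2 + \<epsilon>) * expectation (\<lambda>\<omega>. (\<Sum>i=1..n. X i \<omega>)\<^sup>2))"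
    unfolding sum_d sum_v .
  have "expectation (\<lambda>\<omega>. exp (\<Sum>j=1..n. d j \<omega>)) \<ge> exp ((1/2 - \<epsilon>) * (\<Sum>j=1..n. v j))"
    by (rule martingale_laplace_bounds(2)[where F = F and d = d and V = V and v = v and n = n and s = s and \<epsilon> = \<epsilon>])
      (fact facts)+
  then show "expectation (\<lambda>\<omega>. exp (\<Sum>i=1..n. X i \<omega>))
      \<ge> exp ((1/2 - \<epsilon>) * expectation (\<lambda>\<omega>. (\<Sum>i=1..n. X i \<omega>)\<^sup>2))"
    unfolding sum_d sum_v .
qed

end

section \<open>Generated sigma-algebras of a row and elementary properties of the
  phi-coefficients\<close>

definition row_sigma ::
    "'a measure \<Rightarrow> (nat \<Rightarrow> 'b measure) \<Rightarrow> (nat \<Rightarrow> 'a \<Rightarrow> 'b) \<Rightarrow> nat set \<Rightarrow> 'a measure" where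
  "row_sigma M N Z J = sigma (space M) (\<Union>j\<in>J. {Z j -` C \<inter> space M | C. C \<in> sets (N j)})"

lemma sets_row_sigma: "sets (row_sigma M N Z J) = sigma_gen M N Z J"
  unfolding row_sigma_def sigma_gen_def by (rule sets_measure_of) auto

lemma space_row_sigma: "space (row_sigma M N Z J) = space M"
  unfolding row_sigma_def by (rule space_measure_of) auto

lemma sigma_gen_mono: "I \<subseteq> J \<Longrightarrow> sigma_gen M N Z I \<subseteq> sigma_gen M N Z J"
  unfolding sigma_gen_def by (intro sigma_sets_mono') auto

lemma subalgebra_row_sigma:
  assumes "\<And>j. j \<in> J \<Longrightarrow> Z j \<in> M \<rightarrow>\<^sub>M N j"
  shows "subalgebra M (row_sigma M N Z J)"
  unfolding subalgebra_def sets_row_sigma space_row_sigma sigma_gen_def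
  using assms by (auto intro!: sets.sigma_sets_subset)

lemma measurable_row_sigma:
  assumes "Z j \<in> M \<rightarrow>\<^sub>M N j" "j \<in> J"
  shows "Z j \<in> row_sigma M N Z J \<rightarrow>\<^sub>M N j"
proof (rule measurableI)
  show "Z j \<omega> \<in> space (N j)" if "\<omega> \<in> space (row_sigma M N Z J)" for \<omega>
    using measurable_space[OF assms(1)] that by (simp add: space_row_sigma)
  show "Z j -` C \<inter> space (row_sigma M N Z J) \<in> sets (row_sigma M N Z J)" if "C \<in> sets (N j)" for C
    unfolding space_row_sigma sets_row_sigma sigma_gen_def
    using that assms(2) by (intro sigma_sets.Basic) auto
qed

context prob_space
begin

text \<open>Null sets \<open>A\<close> are covered as well, the quotient being 0 by convention. The
  bound keeps the real suprema in \<open>phi_coeff\<close> meaningful.\<close>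

lemma conditional_prob_diff_le_1:
  "\<bar>measure M (A \<inter> B) / measure M A - measure M B\<bar> \<le> 1" if "A \<in> events" "B \<in> events"
proof -
  have "measure M (A \<inter> B) \<le> measure M A"
    using that by (intro finite_measure_mono) auto
  then have "measure M (A \<inter> B) / measure M A \<le> 1"
    by (auto simp: divide_le_eq_1 zero_less_measure_iff)
  moreover have "0 \<le> measure M (A \<inter> B) / measure M A" "measure M B \<le> 1" "0 \<le> measure M B"
    by auto
  ultimately show ?thesis
    by (simp only: abs_le_iff) linarith
qed

lemma bdd_above_phi_coeff:
  assumes "G \<subseteq> events" "H \<subseteq> events"
  shows "bdd_above {\<bar>measure M (A \<inter> B) / measure M A - measure M B\<bar> | A B. A \<in> G \<and> B \<in> H \<and> measure M A > 0}"
  using assms conditional_prob_diff_le_1 by (intro bdd_aboveI[of _ 1]) blast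

lemma phi_coeff_bounds:
  assumes "G \<subseteq> events" "H \<subseteq> events" "space M \<in> G" "{} \<in> H"
  shows "0 \<le> phi_coeff M G H" "phi_coeff M G H \<le> 1"
proof -
  let ?S = "{\<bar>measure M (A \<inter> B) / measure M A - measure M B\<bar> | A B. A \<in> G \<and> B \<in> H \<and> measure M A > 0}"
  \<comment> \<open>The pair of the whole space and the empty set contributes the value 0, so the
    supremum is over a nonempty set.\<close>
  have "\<bar>measure M (space M \<inter> {}) / measure M (space M) - measure M {}\<bar> \<in> ?S"
    using assms(3,4) prob_space by (intro CollectI exI[of _ "space M"] exI[of _ "{}"]) auto
  then have 0: "0 \<in> ?S" by simp
  show "0 \<le> phi_coeff M G H"
    unfolding phi_coeff_def by (rule cSup_upper[OF 0 bdd_above_phi_coeff[OF assms(1,2)]])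
  have "x \<le> 1" if "x \<in> ?S" for x
    using that assms(1,2) conditional_prob_diff_le_1 by blast
  then show "phi_coeff M G H \<le> 1"
    unfolding phi_coeff_def using 0 by (intro cSup_least) auto
qed

text \<open>The multiplied form extends to null \<open>A\<close>, where both sides are 0, and is the
  one demanded by \<open>phi_mixing_row\<close>.\<close>

lemma phi_coeff_upper:
  assumes "G \<subseteq> events" "H \<subseteq> events" "A \<in> G" "B \<in> H"
  shows "\<bar>prob (A \<inter> B) - prob A * prob B\<bar> \<le> phi_coeff M G H * prob A"
proof (cases "prob A = 0")
  case True
  have "prob (A \<inter> B) \<le> prob A"
    using assms by (intro finite_measure_mono) auto
  then have "prob (A \<inter> B) = 0"
    using True measure_nonneg[of M "A \<inter> B"] by linarith
  then show ?thesis
    using True by simp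
next
  case False
  then have A: "0 < prob A"
    by (simp add: zero_less_measure_iff)
  have "\<bar>measure M (A \<inter> B) / measure M A - measure M B\<bar> \<le> phi_coeff M G H"
    unfolding phi_coeff_def using assms A by (intro cSup_upper bdd_above_phi_coeff) auto
  then have "\<bar>measure M (A \<inter> B) / measure M A - measure M B\<bar> * prob A \<le> phi_coeff M G H * prob A"
    using A by (intro mult_right_mono) auto
  moreover have "\<bar>measure M (A \<inter> B) / measure M A - measure M B\<bar> * prob A = \<bar>prob (A \<inter> B) - prob A * prob B\<bar>"
  proof -
    have "\<bar>measure M (A \<inter> B) / measure M A - measure M B\<bar> * prob A =
        \<bar>(measure M (A \<inter> B) / measure M A - measure M B) * prob A\<bar>"
      by (simp add: abs_mult)
    also have "(measure M (A \<inter> B) / measure M A - measure M B) * prob A = prob (A \<inter> B) - prob A * prob B"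
      using A by (simp add: field_simps)
    finally show ?thesis .
  qed
  ultimately show ?thesis by simp
qed

context
  fixes N :: "nat \<Rightarrow> 'b measure" and Z :: "nat \<Rightarrow> 'a \<Rightarrow> 'b" and n :: nat
  assumes Z: "\<And>j. 1 \<le> j \<Longrightarrow> j \<le> n \<Longrightarrow> Z j \<in> M \<rightarrow>\<^sub>M N j"
begin

lemma sigma_gen_events: "J \<subseteq> {1..n} \<Longrightarrow> sigma_gen M N Z J \<subseteq> events"
  using subalgebra_row_sigma[of J Z M N] Z unfolding subalgebra_def sets_row_sigma by fastforce

lemma sigma_gen_trivial: "space M \<in> sigma_gen M N Z J" "{} \<in> sigma_gen M N Z J"
  unfolding sigma_gen_def by (auto intro: sigma_sets_top sigma_sets.Empty)

lemma phi_coeff_row_bounds: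
  assumes "1 \<le> k" "k \<le> n" "s \<in> {0..n - k}"
  shows "0 \<le> phi_coeff M (sigma_gen M N Z {1..s}) (sigma_gen M N Z {s + k..n})"
    and "phi_coeff M (sigma_gen M N Z {1..s}) (sigma_gen M N Z {s + k..n}) \<le> 1"
  using assms by (auto intro!: phi_coeff_bounds sigma_gen_events sigma_gen_trivial)

lemma phi_coeff_le_row_phi:
  assumes "s \<in> {0..n - k}"
  shows "phi_coeff M (sigma_gen M N Z {1..s}) (sigma_gen M N Z {s + k..n}) \<le> row_phi M N Z n k"
  unfolding row_phi_def using assms by (intro cSUP_upper bdd_above_finite finite_imageI) auto

lemma row_phi_bounds:
  assumes "1 \<le> k" "k \<le> n"
  shows "0 \<le> row_phi M N Z n k" "row_phi M N Z n k \<le> 1"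
proof -
  show "0 \<le> row_phi M N Z n k"
    using phi_coeff_row_bounds(1)[OF assms, of 0] phi_coeff_le_row_phi[of 0 k] by simp
  show "row_phi M N Z n k \<le> 1"
    unfolding row_phi_def using phi_coeff_row_bounds(2)[OF assms] by (intro cSUP_least) auto
qed

lemma row_phi_mixing:
  assumes "s < i" "i \<le> n" "A \<in> sigma_gen M N Z {1..s}" "C \<in> sigma_gen M N Z {i..n}"
  shows "\<bar>prob (A \<inter> C) - prob A * prob C\<bar> \<le> row_phi M N Z n (i - s) * prob A"
proof -
  have "\<bar>prob (A \<inter> C) - prob A * prob C\<bar> \<le>
      phi_coeff M (sigma_gen M N Z {1..s}) (sigma_gen M N Z {i..n}) * prob A"
    using assms by (intro phi_coeff_upper sigma_gen_events) auto
  also have "\<dots> \<le> row_phi M N Z n (i - s) * prob A"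
    using phi_coeff_le_row_phi[of s "i - s"] assms by (intro mult_right_mono) auto
  finally show ?thesis .
qed

end

section \<open>From the essential bounds of a row to its Laplace transform\<close>

lemma AE_le_row_Kinf:
  assumes X: "X j \<in> borel_measurable M" and bdd: "Linf_norm M (X j) < \<infinity>" and j: "1 \<le> j" "j \<le> n"
  shows "AE \<omega> in M. \<bar>X j \<omega>\<bar> \<le> row_Kinf M X n"
proof -
  have "AE \<omega> in M. ereal \<bar>X j \<omega>\<bar> \<le> Linf_norm M (X j)"
    unfolding Linf_norm_def by (rule esssup_AE)
  then show ?thesis
  proof eventually_elim
    case (elim \<omega>)
    \<comment> \<open>Finiteness is essential, because \<open>real_of_ereal\<close> sends infinity
      to 0; the value minus infinity is excluded by \<open>elim\<close>.\<close>
    then have "\<bar>X j \<omega>\<bar> \<le> real_of_ereal (Linf_norm M (X j))"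
      using bdd by (cases "Linf_norm M (X j)") auto
    also have "\<dots> \<le> row_Kinf M X n"
      unfolding row_Kinf_def using j by (intro Max_ge) auto
    finally show ?case .
  qed
qed

lemma row_Kinf_nonneg:
  assumes X: "X 1 \<in> borel_measurable M" and bdd: "Linf_norm M (X 1) < \<infinity>" and n: "1 \<le> n"
  shows "0 \<le> row_Kinf M X n"
proof -
  have "AE \<omega> in M. 0 \<le> row_Kinf M X n"
    using AE_le_row_Kinf[where X = X, OF assms(1,2) order_refl n] by eventually_elim (meson abs_ge_zero order_trans)
  then show ?thesis by simp
qed

text \<open>Instance of \<open>laplace_bounds\<close> for the scaled row: truncation at the
  essential bound changes the summands on null sets only, and leaves both the Laplace transform and
  the second moment intact.\<close>

lemma row_laplace_bounds:
  fixes N :: "nat \<Rightarrow> 'b measure" and Z :: "nat \<Rightarrow> 'a \<Rightarrow> 'b" and g :: "nat \<Rightarrow> 'b \<Rightarrow> real"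
    and X :: "nat \<Rightarrow> 'a \<Rightarrow> real"
  assumes n: "1 \<le> n"
    and Z: "\<And>j. 1 \<le> j \<Longrightarrow> j \<le> n \<Longrightarrow> Z j \<in> M \<rightarrow>\<^sub>M N j"
    and g: "\<And>j. 1 \<le> j \<Longrightarrow> j \<le> n \<Longrightarrow> g j \<in> borel_measurable (N j)"
    and X: "X = (\<lambda>j \<omega>. g j (Z j \<omega>))"
    and centered: "\<And>j. 1 \<le> j \<Longrightarrow> j \<le> n \<Longrightarrow> expectation (X j) = 0"
    and bdd: "\<And>j. 1 \<le> j \<Longrightarrow> j \<le> n \<Longrightarrow> Linf_norm M (X j) < \<infinity>"
    and eps: "0 < \<epsilon>" "\<epsilon> \<le> 1/4"
    and small: "5 * (\<bar>\<theta>\<bar> * row_Kinf M X n) * (1 + (\<Sum>l=1..n. sqrt (row_phi M N Z n l))) \<le> \<epsilon> / 100"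
  shows "expectation (\<lambda>\<omega>. exp (\<theta> * row_sum X n \<omega>)) \<le> exp ((1/2 + \<epsilon>) * (\<theta>\<^sup>2 * (row_sd M X n)\<^sup>2))"
    and "expectation (\<lambda>\<omega>. exp (\<theta> * row_sum X n \<omega>)) \<ge> exp ((1/2 - \<epsilon>) * (\<theta>\<^sup>2 * (row_sd M X n)\<^sup>2))"
proof -
  define K where "K = row_Kinf M X n"
  define Y where "Y j \<omega> = max (- (\<bar>\<theta>\<bar> * K)) (min (\<bar>\<theta>\<bar> * K) (\<theta> * X j \<omega>))" for j \<omega>
  \<comment> \<open>Indices are cut off to stay in \<open>{1..n}\<close>, since
    \<open>phi_mixing_row\<close> asks for sub-sigma-algebras at every index. At 0 the generating
    family is empty, which yields the trivial sigma-algebra.\<close>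
  define F where "F j = row_sigma M N Z {1..min j n}" for j
  define G where "G i = row_sigma M N Z {max 1 i..n}" for i
  have XM: "X j \<in> borel_measurable M" if "1 \<le> j" "j \<le> n" for j
    unfolding X using Z[OF that] g[OF that] by measurable
  have K0: "0 \<le> K"
    unfolding K_def using XM[of 1] bdd[of 1] n by (intro row_Kinf_nonneg) auto
  have AE_X: "AE \<omega> in M. \<bar>X j \<omega>\<bar> \<le> K" if "1 \<le> j" "j \<le> n" for j
    unfolding K_def by (rule AE_le_row_Kinf[where X = X, OF XM[OF that] bdd[OF that] that])
  have Y_le: "\<bar>Y j \<omega>\<bar> \<le> \<bar>\<theta>\<bar> * K" for j \<omega>
    unfolding Y_def using K0 by (auto simp: max_def min_def abs_le_iff)
  have AE_Y: "AE \<omega> in M. Y j \<omega> = \<theta> * X j \<omega>" if "1 \<le> j" "j \<le> n" for j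
    using AE_X[OF that]
  proof eventually_elim
    case (elim \<omega>)
    then have "\<bar>\<theta> * X j \<omega>\<bar> \<le> \<bar>\<theta>\<bar> * K"
      unfolding abs_mult by (intro mult_left_mono) auto
    then show ?case
      unfolding Y_def by (auto simp: max_def min_def abs_le_iff)
  qed
  have Y_meas: "Y j \<in> borel_measurable (row_sigma M N Z J)" if "1 \<le> j" "j \<le> n" "j \<in> J" for j J
  proof -
    have "(\<lambda>\<omega>. g j (Z j \<omega>)) \<in> borel_measurable (row_sigma M N Z J)"
      by (rule measurable_compose[OF measurable_row_sigma[where Z = Z and N = N, OF Z[OF that(1,2)] that(3)] g[OF that(1,2)]])
    then show ?thesis
      unfolding Y_def X by measurable
  qed
  have sub: "subalgebra M (row_sigma M N Z J)" if "J \<subseteq> {1..n}" for J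
    using that Z by (intro subalgebra_row_sigma) auto
  have YM [measurable]: "Y j \<in> borel_measurable M" if "j \<in> {1..n}" for j
    using that by (intro measurable_from_subalg[OF sub[of "{j}"] Y_meas]) auto
  have iX: "integrable M (X j)" if "1 \<le> j" "j \<le> n" for j
    using AE_X[OF that] XM[OF that] by (intro integrable_const_bound[of _ K]) auto
  have EY: "expectation (Y j) = 0" if "1 \<le> j" "j \<le> n" for j
  proof -
    have "expectation (Y j) = expectation (\<lambda>\<omega>. \<theta> * X j \<omega>)"
      using AE_Y[OF that] YM[of j] XM[OF that] that by (intro integral_cong_AE) auto
    then show ?thesis
      using centered[OF that] by simp
  qed
  interpret phi_mixing_row M F G Y n "\<bar>\<theta>\<bar> * K" "row_phi M N Z n"
  proof
    show "subalgebra M (F j)" for j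
      unfolding F_def by (intro sub) auto
    show "subalgebra M (G j)" for j
      unfolding G_def by (intro sub) auto
    show "sets (F i) \<subseteq> sets (F j)" if "i \<le> j" for i j
      unfolding F_def sets_row_sigma using that by (intro sigma_gen_mono) auto
    show "sets (F 0) = {{}, space M}"
      unfolding F_def sets_row_sigma sigma_gen_def by (simp add: sigma_sets_empty_eq)
    show "Y i \<in> borel_measurable (F j)" if "1 \<le> i" "i \<le> j" "j \<le> n" for i j
      unfolding F_def using that by (intro Y_meas) auto
    show "Y j \<in> borel_measurable (G i)" if "1 \<le> i" "i \<le> j" "j \<le> n" for i j
      unfolding G_def using that by (intro Y_meas) auto
    show "0 \<le> \<bar>\<theta>\<bar> * K" using K0 by simp
    show "\<bar>Y i \<omega>\<bar> \<le> \<bar>\<theta>\<bar> * K" for i \<omega>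
      by (rule Y_le)
    show "expectation (Y i) = 0" if "1 \<le> i" "i \<le> n" for i
      by (rule EY[OF that])
    show "0 \<le> row_phi M N Z n l" "row_phi M N Z n l \<le> 1" if "1 \<le> l" "l \<le> n" for l
      using row_phi_bounds[where Z = Z and N = N and n = n, OF Z that] by auto
    show "\<bar>prob (A \<inter> C) - prob A * prob C\<bar> \<le> row_phi M N Z n (i - s) * prob A"
      if "s < i" "i \<le> n" "A \<in> sets (F s)" "C \<in> sets (G i)" for s i A C
    proof (rule row_phi_mixing[OF Z that(1,2)])
      have "min s n = s" "max 1 i = i"
        using that by auto
      then show "A \<in> sigma_gen M N Z {1..s}" "C \<in> sigma_gen M N Z {i..n}"
        using that(3,4) unfolding F_def G_def sets_row_sigma by auto
    qed
  qed
  have small': "5 * (\<bar>\<theta>\<bar> * K) * (1 + H) \<le> \<epsilon> / 100"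
    using small unfolding H_def K_def .
  have AE_sum: "AE \<omega> in M. (\<Sum>j=1..n. Y j \<omega>) = \<theta> * row_sum X n \<omega>"
  proof -
    have "AE \<omega> in M. \<forall>j\<in>{1..n}. Y j \<omega> = \<theta> * X j \<omega>"
      by (intro AE_finite_allI AE_Y) auto
    then show ?thesis
      by eventually_elim (simp add: row_sum_def sum_distrib_left)
  qed
  have SM [measurable]: "row_sum X n \<in> borel_measurable M"
    unfolding row_sum_def[abs_def] using XM by (intro borel_measurable_sum) auto
  have YS [measurable]: "(\<lambda>\<omega>. \<Sum>j=1..n. Y j \<omega>) \<in> borel_measurable M"
    using YM by (intro borel_measurable_sum) auto
  have e1: "expectation (\<lambda>\<omega>. exp (\<Sum>j=1..n. Y j \<omega>)) = expectation (\<lambda>\<omega>. exp (\<theta> * row_sum X n \<omega>))"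
  proof (rule integral_cong_AE)
    show "AE \<omega> in M. exp (\<Sum>j=1..n. Y j \<omega>) = exp (\<theta> * row_sum X n \<omega>)"
      using AE_sum by eventually_elim simp
  qed measurable
  have "expectation (row_sum X n) = 0"
  proof -
    have "expectation (row_sum X n) = (\<Sum>j=1..n. expectation (X j))"
      unfolding row_sum_def[abs_def] using iX by (intro Bochner_Integration.integral_sum) auto
    also have "\<dots> = 0"
      using centered by (intro sum.neutral) auto
    finally show ?thesis .
  qed
  then have var: "(row_sd M X n)\<^sup>2 = expectation (\<lambda>\<omega>. (row_sum X n \<omega>)\<^sup>2)"
    unfolding row_sd_def by simp
  have "expectation (\<lambda>\<omega>. (\<Sum>j=1..n. Y j \<omega>)\<^sup>2) = expectation (\<lambda>\<omega>. \<theta>\<^sup>2 * (row_sum X n \<omega>)\<^sup>2)"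
  proof (rule integral_cong_AE)
    show "AE \<omega> in M. (\<Sum>j=1..n. Y j \<omega>)\<^sup>2 = \<theta>\<^sup>2 * (row_sum X n \<omega>)\<^sup>2"
      using AE_sum by eventually_elim (simp add: power_mult_distrib)
  qed measurable
  then have e2: "expectation (\<lambda>\<omega>. (\<Sum>j=1..n. Y j \<omega>)\<^sup>2) = \<theta>\<^sup>2 * (row_sd M X n)\<^sup>2"
    unfolding var by simp
  show "expectation (\<lambda>\<omega>. exp (\<theta> * row_sum X n \<omega>)) \<le> exp ((1/2 + \<epsilon>) * (\<theta>\<^sup>2 * (row_sd M X n)\<^sup>2))"
    using laplace_bounds(1)[OF eps small'] unfolding e1 e2 .
  show "expectation (\<lambda>\<omega>. exp (\<theta> * row_sum X n \<omega>)) \<ge> exp ((1/2 - \<epsilon>) * (\<theta>\<^sup>2 * (row_sd M X n)\<^sup>2))"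
    using laplace_bounds(2)[OF eps small'] unfolding e1 e2 .
qed

end

section \<open>Deviations from the limit of Laplace transforms\<close>

lemma scaled_eln_le:
  assumes "0 < t" "0 \<le> p" "p \<le> exp (t\<^sup>2 * c)"
  shows "ereal (1 / t\<^sup>2) * eln p \<le> ereal c"
proof (cases "p = 0")
  case True
  then show ?thesis using assms by (simp add: eln_def)
next
  case False
  then have "ln p \<le> t\<^sup>2 * c"
    using assms by (metis exp_gt_zero less_eq_real_def ln_exp ln_le_cancel_iff)
  then show ?thesis
    using False assms by (simp add: eln_def field_simps)
qed

lemma le_scaled_eln:
  assumes "0 < t" "exp (t\<^sup>2 * c) \<le> p"
  shows "ereal c \<le> ereal (1 / t\<^sup>2) * eln p"
proof -
  have p: "0 < p"
    using assms(2) exp_gt_zero[of "t\<^sup>2 * c"] by linarith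
  then have "t\<^sup>2 * c \<le> ln p"
    using assms by (metis exp_gt_zero ln_exp ln_le_cancel_iff)
  then show ?thesis
    using p assms by (simp add: eln_def field_simps)
qed

text \<open>The situation of the Gaertner-Ellis theorem on the line at speed
  \<open>(t n)\<^sup>2\<close>, with limit \<open>l\<^sup>2 / 2\<close>, whose convex conjugate is
  again \<open>x\<^sup>2 / 2\<close>. The limit is written as two one-sided estimates, free of
  logarithms.\<close>

locale gaussian_laplace_limit = prob_space M for M :: "'a measure" +
  fixes W :: "nat \<Rightarrow> 'a \<Rightarrow> real" and t :: "nat \<Rightarrow> real"
  assumes W [measurable]: "\<And>n. W n \<in> borel_measurable M"
    and t_lim: "filterlim t at_top sequentially"
    and laplace_le: "\<And>\<epsilon> l. 0 < \<epsilon> \<Longrightarrow>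
      \<forall>\<^sub>F n in sequentially. expectation (\<lambda>\<omega>. exp (l * (t n)\<^sup>2 * W n \<omega>)) \<le> exp ((t n)\<^sup>2 * (l\<^sup>2 / 2 + \<epsilon>))"
    and laplace_ge: "\<And>\<epsilon> l. 0 < \<epsilon> \<Longrightarrow>
      \<forall>\<^sub>F n in sequentially. expectation (\<lambda>\<omega>. exp (l * (t n)\<^sup>2 * W n \<omega>)) \<ge> exp ((t n)\<^sup>2 * (l\<^sup>2 / 2 - \<epsilon>))"
begin

text \<open>A positive Bochner integral forces integrability, since the integral of a non-integrable function is 0.\<close>

lemma laplace_integrable:
  "\<forall>\<^sub>F n in sequentially. integrable M (\<lambda>\<omega>. exp (l * (t n)\<^sup>2 * W n \<omega>))"
  using laplace_ge[of 1 l, OF zero_less_one]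
proof eventually_elim
  case (elim n)
  then have "expectation (\<lambda>\<omega>. exp (l * (t n)\<^sup>2 * W n \<omega>)) \<noteq> 0"
    using exp_gt_zero[of "(t n)\<^sup>2 * (l\<^sup>2 / 2 - 1)"] by linarith
  then show ?case
    using not_integrable_integral_eq by blast
qed

lemma t_pos: "\<forall>\<^sub>F n in sequentially. 0 < t n"
  using t_lim by (simp add: filterlim_at_top_dense)

text \<open>Constant factors in front of exponentials are negligible at speed
  \<open>(t n)\<^sup>2\<close>.\<close>

lemma t_square_large:
  assumes "0 < \<epsilon>"
  shows "\<forall>\<^sub>F n in sequentially. C \<le> exp ((t n)\<^sup>2 * \<epsilon>)"
proof -
  have "\<forall>\<^sub>F n in sequentially. max 1 (C / \<epsilon>) \<le> t n"
    using t_lim unfolding filterlim_at_top by blast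
  then show ?thesis
  proof eventually_elim
    case (elim n)
    then have "C / \<epsilon> \<le> t n" "1 \<le> t n" by auto
    moreover have "t n \<le> (t n)\<^sup>2"
      using \<open>1 \<le> t n\<close> by (simp add: power2_eq_square)
    ultimately have "C / \<epsilon> \<le> (t n)\<^sup>2" by linarith
    then have "C \<le> (t n)\<^sup>2 * \<epsilon>"
      using assms by (simp add: field_simps)
    also have "\<dots> \<le> exp ((t n)\<^sup>2 * \<epsilon>)"
      using exp_ge_add_one_self[of "(t n)\<^sup>2 * \<epsilon>"] by linarith
    finally show ?case .
  qed
qed

text \<open>Exponential Chebyshev inequality with the optimal slope \<open>s * x\<close>; the sign
  \<open>s\<close> selects the tail.\<close>

lemma one_sided_tail:
  assumes "0 < \<epsilon>" "0 \<le> x" and s: "s\<^sup>2 = 1"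
  shows "\<forall>\<^sub>F n in sequentially. prob {\<omega> \<in> space M. x \<le> s * W n \<omega>} \<le> exp ((t n)\<^sup>2 * (- (x\<^sup>2 / 2) + \<epsilon>))"
  using laplace_le[of \<epsilon> "s * x", OF assms(1)] laplace_integrable[of "s * x"]
proof eventually_elim
  case (elim n)
  let ?A = "{\<omega> \<in> space M. x \<le> s * W n \<omega>}" and ?k = "(t n)\<^sup>2"
  have A: "?A \<in> events" by measurable
  have "prob ?A = expectation (indicator ?A)"
    using A by simp
  also have "\<dots> \<le> expectation (\<lambda>\<omega>. exp (- (?k * x\<^sup>2)) * exp (s * x * ?k * W n \<omega>))"
  proof (intro integral_mono integrable_mult_right elim)
    show "integrable M (indicator ?A :: _ \<Rightarrow> real)"
      using A by (simp add: emeasure_eq_measure)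
    fix \<omega> assume "\<omega> \<in> space M"
    show "indicator ?A \<omega> \<le> exp (- (?k * x\<^sup>2)) * exp (s * x * ?k * W n \<omega>)"
    proof (cases "\<omega> \<in> ?A")
      case True
      then have "?k * x * x \<le> ?k * x * (s * W n \<omega>)"
        using assms(2) by (intro mult_left_mono) auto
      then have "0 \<le> - (?k * x\<^sup>2) + s * x * ?k * W n \<omega>"
        by (simp add: power2_eq_square mult_ac)
      then have "1 \<le> exp (- (?k * x\<^sup>2) + s * x * ?k * W n \<omega>)"
        by (simp only: one_le_exp_iff)
      then show ?thesis
        using True unfolding exp_add by simp
    qed simp
  qed
  also have "\<dots> = exp (- (?k * x\<^sup>2)) * expectation (\<lambda>\<omega>. exp (s * x * ?k * W n \<omega>))"
    by simp
  also have "\<dots> \<le> exp (- (?k * x\<^sup>2)) * exp (?k * ((s * x)\<^sup>2 / 2 + \<epsilon>))"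
    by (intro mult_left_mono elim) simp
  also have "\<dots> = exp (?k * (- (x\<^sup>2 / 2) + \<epsilon>))"
    using s by (simp add: exp_add[symmetric] power_mult_distrib algebra_simps)
  finally show ?case .
qed

lemma two_sided_tail:
  assumes "0 < \<epsilon>" "0 \<le> x"
  shows "\<forall>\<^sub>F n in sequentially. prob {\<omega> \<in> space M. x \<le> \<bar>W n \<omega>\<bar>} \<le> exp ((t n)\<^sup>2 * (- (x\<^sup>2 / 2) + \<epsilon>))"
proof -
  have e: "0 < \<epsilon> / 2" using assms by simp
  have s: "1\<^sup>2 = (1 :: real)" "(- 1)\<^sup>2 = (1 :: real)" by simp_all
  show ?thesis
    using one_sided_tail[OF e assms(2) s(1)] one_sided_tail[OF e assms(2) s(2)]
      t_square_large[of "\<epsilon>/2" 2, OF e]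
  proof eventually_elim
    case (elim n)
    let ?k = "(t n)\<^sup>2"
    have "{\<omega> \<in> space M. x \<le> \<bar>W n \<omega>\<bar>} =
        {\<omega> \<in> space M. x \<le> 1 * W n \<omega>} \<union> {\<omega> \<in> space M. x \<le> - 1 * W n \<omega>}"
      by auto
    then have "prob {\<omega> \<in> space M. x \<le> \<bar>W n \<omega>\<bar>} \<le>
        prob {\<omega> \<in> space M. x \<le> 1 * W n \<omega>} + prob {\<omega> \<in> space M. x \<le> - 1 * W n \<omega>}"
      by (simp only:) (rule measure_Un_le; measurable)
    also have "\<dots> \<le> 2 * exp (?k * (- (x\<^sup>2 / 2) + \<epsilon> / 2))"
      using elim by simp
    also have "\<dots> \<le> exp (?k * (\<epsilon> / 2)) * exp (?k * (- (x\<^sup>2 / 2) + \<epsilon> / 2))"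
      using elim by (intro mult_right_mono) auto
    also have "\<dots> = exp (?k * (- (x\<^sup>2 / 2) + \<epsilon>))"
      by (simp add: exp_add[symmetric] algebra_simps)
    finally show ?case .
  qed
qed

text \<open>Exponential tilting without a change of measure: the transform at slope \<open>x\<close>
  is split into the contribution of the window around \<open>x\<close> and those of the two sides.
  Each side is dominated by the transform at slope \<open>x + \<delta>\<close> or
  \<open>x - \<delta>\<close>; by strict convexity it is exponentially smaller than the whole, so
  the window carries at least half.\<close>

lemma local_lower_bound:
  assumes d: "0 < \<delta>"
  shows "\<forall>\<^sub>F n in sequentially.
    exp ((t n)\<^sup>2 * (- (x\<^sup>2 / 2) - \<delta>\<^sup>2 / 4 - \<bar>x\<bar> * \<delta>)) \<le> prob {\<omega> \<in> space M. \<bar>W n \<omega> - x\<bar> < \<delta>}"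
proof -
  have e: "0 < \<delta>\<^sup>2 / 8" using d by simp
  show ?thesis
    using laplace_ge[of "\<delta>\<^sup>2 / 8" x, OF e] laplace_le[of "\<delta>\<^sup>2 / 8" "x + \<delta>", OF e]
      laplace_le[of "\<delta>\<^sup>2 / 8" "x - \<delta>", OF e] laplace_integrable[of x] laplace_integrable[of "x + \<delta>"]
      laplace_integrable[of "x - \<delta>"] t_square_large[of "\<delta>\<^sup>2 / 8" 4, OF e]
  proof eventually_elim
    case (elim n)
    let ?k = "(t n)\<^sup>2" and ?A = "{\<omega> \<in> space M. \<bar>W n \<omega> - x\<bar> < \<delta>}"
    let ?e = "\<lambda>l \<omega>. exp (l * ?k * W n \<omega>)"
    have A: "?A \<in> events" by measurable
    \<comment> \<open>\<open>a\<close> bounds the tilted density on the window, \<open>b\<close> and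
      \<open>c\<close> are the Chebyshev factors of the right and left side, and \<open>y\<close> is
      the lower bound for the total. The tolerance \<open>\<delta>\<^sup>2 / 8\<close> leaves a gain
      of \<open>\<delta>\<^sup>2 / 4\<close> on either side.\<close>
    define a where "a = exp (?k * (x\<^sup>2 + \<bar>x\<bar> * \<delta>))"
    define b where "b = exp (- (?k * (\<delta> * (x + \<delta>))))"
    define c where "c = exp (?k * (\<delta> * (x - \<delta>)))"
    define y where "y = exp (?k * (x\<^sup>2 / 2 - \<delta>\<^sup>2 / 8))"
    have iA: "integrable M (indicator ?A :: _ \<Rightarrow> real)"
      using A by (simp add: emeasure_eq_measure)
    have "y \<le> expectation (?e x)"
      using elim(1) by (simp add: y_def)
    also have "\<dots> \<le> expectation (\<lambda>\<omega>. a * indicator ?A \<omega> + b * ?e (x + \<delta>) \<omega> + c * ?e (x - \<delta>) \<omega>)"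
    proof (intro integral_mono Bochner_Integration.integrable_add integrable_mult_right elim iA)
      fix \<omega> assume \<omega>: "\<omega> \<in> space M"
      let ?w = "W n \<omega>"
      have nn: "0 \<le> a * indicator ?A \<omega>" "0 \<le> b * ?e (x + \<delta>) \<omega>" "0 \<le> c * ?e (x - \<delta>) \<omega>"
        by (simp_all add: a_def b_def c_def)
      consider "\<bar>?w - x\<bar> < \<delta>" | "?w \<ge> x + \<delta>" | "?w \<le> x - \<delta>" by linarith
      then have "?e x \<omega> \<le> a * indicator ?A \<omega> \<or> ?e x \<omega> \<le> b * ?e (x + \<delta>) \<omega> \<or> ?e x \<omega> \<le> c * ?e (x - \<delta>) \<omega>"
      proof cases
        case 1
        have "x * (?w - x) \<le> \<bar>x\<bar> * \<bar>?w - x\<bar>"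
          unfolding abs_mult[symmetric] by (rule abs_ge_self)
        also have "\<dots> \<le> \<bar>x\<bar> * \<delta>"
          using 1 by (intro mult_left_mono) auto
        finally have "x * (?w - x) \<le> \<bar>x\<bar> * \<delta>" .
        then have "?k * (x * ?w) \<le> ?k * (x\<^sup>2 + \<bar>x\<bar> * \<delta>)"
          by (intro mult_left_mono) (auto simp: algebra_simps power2_eq_square)
        then have "?e x \<omega> \<le> a"
          by (simp add: a_def mult_ac)
        then show ?thesis
          using 1 \<omega> by simp
      next
        case 2
        then have "?k * \<delta> * (x + \<delta>) \<le> ?k * \<delta> * ?w"
          using d by (intro mult_left_mono) auto
        then have "?e x \<omega> \<le> b * ?e (x + \<delta>) \<omega>"
          unfolding b_def exp_add[symmetric] by (simp add: algebra_simps)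
        then show ?thesis by simp
      next
        case 3
        then have "?k * \<delta> * ?w \<le> ?k * \<delta> * (x - \<delta>)"
          using d by (intro mult_left_mono) auto
        then have "?e x \<omega> \<le> c * ?e (x - \<delta>) \<omega>"
          unfolding c_def exp_add[symmetric] by (simp add: algebra_simps)
        then show ?thesis by simp
      qed
      with nn show "?e x \<omega> \<le> a * indicator ?A \<omega> + b * ?e (x + \<delta>) \<omega> + c * ?e (x - \<delta>) \<omega>"
        by linarith
    qed
    also have "\<dots> = a * prob ?A + b * expectation (?e (x + \<delta>)) + c * expectation (?e (x - \<delta>))"
      using A iA elim by simp
    also have "b * expectation (?e (x + \<delta>)) \<le> b * exp (?k * ((x + \<delta>)\<^sup>2 / 2 + \<delta>\<^sup>2 / 8))"
      using elim by (intro mult_left_mono) (auto simp: b_def)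
    also have "b * exp (?k * ((x + \<delta>)\<^sup>2 / 2 + \<delta>\<^sup>2 / 8)) = y * exp (- (?k * (\<delta>\<^sup>2 / 4)))"
      unfolding b_def y_def exp_add[symmetric] by (simp add: power2_eq_square field_simps)
    also have "c * expectation (?e (x - \<delta>)) \<le> c * exp (?k * ((x - \<delta>)\<^sup>2 / 2 + \<delta>\<^sup>2 / 8))"
      using elim by (intro mult_left_mono) (auto simp: c_def)
    also have "c * exp (?k * ((x - \<delta>)\<^sup>2 / 2 + \<delta>\<^sup>2 / 8)) = y * exp (- (?k * (\<delta>\<^sup>2 / 4)))"
      unfolding c_def y_def exp_add[symmetric] by (simp add: power2_eq_square field_simps)
    finally have main: "y \<le> a * prob ?A + y * exp (- (?k * (\<delta>\<^sup>2 / 4))) + y * exp (- (?k * (\<delta>\<^sup>2 / 4)))"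
      by simp
    have "4 \<le> exp (?k * (\<delta>\<^sup>2 / 8))"
      using elim by simp
    also have "\<dots> \<le> exp (?k * (\<delta>\<^sup>2 / 4))"
      by (simp add: mult_left_mono)
    finally have "exp (- (?k * (\<delta>\<^sup>2 / 4))) \<le> 1 / 4"
      by (simp add: exp_minus field_simps)
    then have "y * exp (- (?k * (\<delta>\<^sup>2 / 4))) \<le> y * (1 / 4)"
      by (intro mult_left_mono) (auto simp: y_def)
    with main have "y / 2 \<le> a * prob ?A" by simp
    \<comment> \<open>The factor 1/2 is weakened to an exponential so that the result is a pure
      exponential at speed \<open>(t n)\<^sup>2\<close>.\<close>
    moreover have "exp (- (?k * (\<delta>\<^sup>2 / 8))) \<le> 1 / 2"
      using \<open>4 \<le> exp (?k * (\<delta>\<^sup>2 / 8))\<close> by (simp add: exp_minus field_simps)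
    then have "y * exp (- (?k * (\<delta>\<^sup>2 / 8))) \<le> y * (1 / 2)"
      by (intro mult_left_mono) (auto simp: y_def)
    ultimately have "y * exp (- (?k * (\<delta>\<^sup>2 / 8))) \<le> a * prob ?A" by simp
    then have "y * exp (- (?k * (\<delta>\<^sup>2 / 8))) / a \<le> prob ?A"
      by (simp add: a_def field_simps)
    also have "y * exp (- (?k * (\<delta>\<^sup>2 / 8))) / a = exp (?k * (- (x\<^sup>2 / 2) - \<delta>\<^sup>2 / 4 - \<bar>x\<bar> * \<delta>))"
      unfolding y_def a_def exp_add[symmetric] exp_diff[symmetric] by (simp add: field_simps)
    finally show ?case .
  qed
qed

theorem large_deviation_lower:
  assumes G [measurable]: "\<Gamma> \<in> sets borel"
  shows "- (INF x\<in>interior \<Gamma>. ereal (x\<^sup>2 / 2))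
    \<le> liminf (\<lambda>n. ereal (1 / (t n)\<^sup>2) * eln (prob {\<omega> \<in> space M. W n \<omega> \<in> \<Gamma>}))" (is "_ \<le> ?L")
proof -
  \<comment> \<open>Negated, the claim is a bound below every element of the infimum, so an empty
    interior, with infimum infinity, needs no separate case.\<close>
  have "- ?L \<le> (INF x\<in>interior \<Gamma>. ereal (x\<^sup>2 / 2))"
  proof (rule INF_greatest)
    fix x assume "x \<in> interior \<Gamma>"
    then obtain r where r: "0 < r" "ball x r \<subseteq> \<Gamma>"
      by (meson mem_interior)
    have le: "ereal (- (x\<^sup>2 / 2)) \<le> ?L + ereal e" if e: "0 < e" for e
    proof -
      \<comment> \<open>The window must fit into the ball inside \<open>\<Gamma>\<close>, and its
        loss \<open>\<delta>\<^sup>2 / 4 + \<bar>x\<bar> * \<delta>\<close> must stay below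
        \<open>e\<close>.\<close>
      define \<delta> where "\<delta> = min (min r 1) (e / (2 * (\<bar>x\<bar> + 1)))"
      have d: "0 < \<delta>" "\<delta> \<le> r" "\<delta> \<le> 1" "\<delta> \<le> e / (2 * (\<bar>x\<bar> + 1))"
        using r e by (auto simp: \<delta>_def)
      have "\<delta> * (\<bar>x\<bar> + 1) \<le> e / 2"
        using d(4) by (simp add: field_simps)
      moreover have "\<delta>\<^sup>2 \<le> \<delta>"
        using d by (simp add: power2_eq_square mult_left_le)
      ultimately have de: "\<delta>\<^sup>2 / 4 + \<bar>x\<bar> * \<delta> \<le> e"
        using d(1) e by (simp add: algebra_simps)
      have "\<forall>\<^sub>F n in sequentially. ereal (- (x\<^sup>2 / 2) - e) \<le>
          ereal (1 / (t n)\<^sup>2) * eln (prob {\<omega> \<in> space M. W n \<omega> \<in> \<Gamma>})"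
        using local_lower_bound[of \<delta> x, OF d(1)] t_pos
      proof eventually_elim
        case (elim n)
        show ?case
        proof (rule le_scaled_eln[OF elim(2)])
          have "exp ((t n)\<^sup>2 * (- (x\<^sup>2 / 2) - e)) \<le> exp ((t n)\<^sup>2 * (- (x\<^sup>2 / 2) - \<delta>\<^sup>2 / 4 - \<bar>x\<bar> * \<delta>))"
            using de by (intro iffD2[OF exp_le_cancel_iff] mult_left_mono) auto
          also have "\<dots> \<le> prob {\<omega> \<in> space M. \<bar>W n \<omega> - x\<bar> < \<delta>}"
            by (rule elim)
          also have "\<dots> \<le> prob {\<omega> \<in> space M. W n \<omega> \<in> \<Gamma>}"
          proof (rule finite_measure_mono)
            show "{\<omega> \<in> space M. \<bar>W n \<omega> - x\<bar> < \<delta>} \<subseteq> {\<omega> \<in> space M. W n \<omega> \<in> \<Gamma>}"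
              using r(2) d(2) by (auto simp: ball_def dist_real_def abs_minus_commute)
          qed measurable
          finally show "exp ((t n)\<^sup>2 * (- (x\<^sup>2 / 2) - e)) \<le> prob {\<omega> \<in> space M. W n \<omega> \<in> \<Gamma>}" .
        qed
      qed
      then have "ereal (- (x\<^sup>2 / 2) - e) \<le> ?L"
        by (rule Liminf_bounded)
      then have "ereal (- (x\<^sup>2 / 2) - e) + ereal e \<le> ?L + ereal e"
        by (rule add_right_mono)
      then show ?thesis by simp
    qed
    have "ereal (- (x\<^sup>2 / 2)) \<le> ?L"
      by (rule ereal_le_epsilon2) (rule le)
    then show "- ?L \<le> ereal (x\<^sup>2 / 2)"
      unfolding ereal_uminus_le_reorder[of ?L] uminus_ereal.simps(1) .
  qed
  then show ?thesis
    by (rule iffD1[OF ereal_uminus_le_reorder])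
qed

text \<open>The rate is an increasing function of \<open>\<bar>x\<bar>\<close>, so a set on which it
  is at least \<open>l\<close> lies in the symmetric tail beyond \<open>sqrt (2 * l)\<close>. One
  tail estimate therefore replaces a covering argument.\<close>

theorem large_deviation_upper:
  assumes G [measurable]: "\<Gamma> \<in> sets borel"
  shows "limsup (\<lambda>n. ereal (1 / (t n)\<^sup>2) * eln (prob {\<omega> \<in> space M. W n \<omega> \<in> \<Gamma>}))
    \<le> - (INF x\<in>closure \<Gamma>. ereal (x\<^sup>2 / 2))" (is "?L \<le> - ?I")
proof (rule ereal_le_real)
  fix z assume z: "- ?I \<le> ereal z"
  \<comment> \<open>Comparison with real \<open>z\<close> also handles an infinite infimum, for
    empty \<open>\<Gamma>\<close>. The maximum with 0 keeps the square root meaningful and is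
    harmless, the rate being nonnegative.\<close>
  define l where "l = max 0 (- z)"
  have l_le: "l \<le> x\<^sup>2 / 2" if "x \<in> \<Gamma>" for x
  proof -
    have "- ereal z \<le> ?I"
      using z by (rule iffD1[OF ereal_uminus_le_reorder])
    also have "\<dots> \<le> ereal (x\<^sup>2 / 2)"
      using that closure_subset by (intro INF_lower) auto
    finally have "- z \<le> x\<^sup>2 / 2"
      by simp
    then show ?thesis
      using zero_le_power2[of x] unfolding l_def by linarith
  qed
  have le: "?L \<le> ereal (- l) + ereal e" if e: "0 < e" for e
  proof -
    let ?x = "sqrt (2 * l)"
    have x: "0 \<le> ?x" "?x\<^sup>2 / 2 = l"
      by (auto simp: l_def)
    have "\<forall>\<^sub>F n in sequentially.
        ereal (1 / (t n)\<^sup>2) * eln (prob {\<omega> \<in> space M. W n \<omega> \<in> \<Gamma>}) \<le> ereal (- l + e)"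
      using two_sided_tail[of e ?x, OF e x(1)] t_pos
    proof eventually_elim
      case (elim n)
      have "prob {\<omega> \<in> space M. W n \<omega> \<in> \<Gamma>} \<le> prob {\<omega> \<in> space M. ?x \<le> \<bar>W n \<omega>\<bar>}"
      proof (rule finite_measure_mono)
        show "{\<omega> \<in> space M. W n \<omega> \<in> \<Gamma>} \<subseteq> {\<omega> \<in> space M. ?x \<le> \<bar>W n \<omega>\<bar>}"
        proof safe
          fix \<omega> assume "W n \<omega> \<in> \<Gamma>"
          from l_le[OF this] have "2 * l \<le> (W n \<omega>)\<^sup>2" by simp
          then show "?x \<le> \<bar>W n \<omega>\<bar>"
            by (intro real_le_lsqrt) (auto simp: l_def)
        qed
      qed measurable
      also have "\<dots> \<le> exp ((t n)\<^sup>2 * (- l + e))"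
        using elim(1) unfolding x(2) .
      finally show ?case
        by (intro scaled_eln_le[OF elim(2)]) auto
    qed
    then show ?thesis
      by (simp add: Limsup_bounded)
  qed
  have "?L \<le> ereal (- l)"
    by (rule ereal_le_epsilon2) (rule le)
  also have "\<dots> \<le> ereal z"
    by (simp add: l_def)
  finally show "?L \<le> ereal z" .
qed

end

section \<open>The moderate deviations principle\<close>

text \<open>The function y^r exp(-y) is largest at y = r; the constant is that maximum up to the
  factor exp(-r).\<close>

lemma powr_le_exp:
  fixes y r :: real
  assumes "0 < y" "0 < r"
  shows "y powr r \<le> exp (r * ln r) * exp y"
proof -
  have "ln (y / r) \<le> y / r - 1"
    using assms by (intro ln_le_minus_one) simp
  then have "r * (ln y - ln r) \<le> r * (y / r - 1)"
    using assms by (intro mult_left_mono) (auto simp: ln_div)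
  then have "r * ln y \<le> r * ln r + y"
    using assms by (simp add: right_diff_distrib)
  then show ?thesis
    using assms by (simp add: powr_def exp_add[symmetric])
qed

text \<open>
  The factor \<open>exp (a powr - u)\<close> dominates every power of \<open>1 / a\<close>, in particular the power
  \<open>2 / \<eta>\<close> that arises from summing \<open>exp (- a l\<^sup>\<eta> / 2)\<close>.
\<close>

lemma sum_sqrt_stretched_exp:
  fixes \<eta> u :: real
  assumes eta: "0 < \<eta>" and u: "0 < u"
  shows "\<exists>C\<ge>0. \<forall>(n :: nat) a B h. 0 < a \<longrightarrow> 1 \<le> B \<longrightarrow>
    (\<forall>l\<in>{1..n}. h l \<le> B * exp (- a * real l powr \<eta>)) \<longrightarrow>
    (\<Sum>l=1..n. sqrt (h l)) \<le> C * (B * exp (a powr (- u)))"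
proof -
  \<comment> \<open>The exponent makes the power \<open>- s\<close> of
    \<open>real l powr \<eta>\<close> equal to the summable \<open>real l powr (- 2)\<close>. The
    resulting power \<open>a powr (- s)\<close> is the one that the exponential must absorb.\<close>
  define s where "s = 2 / \<eta>"
  define c where "c = exp (s * ln s) * 2 powr s * exp (s / u * ln (s / u))"
  define D where "D = (\<Sum>l. inverse (real l ^ 2))"
  have s: "0 < s" using eta by (simp add: s_def)
  have summ: "summable (\<lambda>l. inverse (real l ^ 2))"
    by (rule inverse_power_summable) simp
  have D0: "0 \<le> D"
    unfolding D_def by (intro suminf_nonneg summ) simp
  show ?thesis
  proof (intro exI[of _ "c * D"] conjI allI impI)
    show "0 \<le> c * D"
      using D0 by (simp add: c_def)
    fix n :: nat and a B :: real and h :: "nat \<Rightarrow> real"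
    assume a: "0 < a" and B: "1 \<le> B"
      and h: "\<forall>l\<in>{1..n}. h l \<le> B * exp (- a * real l powr \<eta>)"
    let ?E = "exp (a powr (- u))"
    have a_powr: "a powr (- s) \<le> exp (s / u * ln (s / u)) * ?E"
    proof -
      have "a powr (- s) = (a powr (- u)) powr (s / u)"
        using u by (simp add: powr_powr)
      also have "\<dots> \<le> exp (s / u * ln (s / u)) * ?E"
        using a s u by (intro powr_le_exp) auto
      finally show ?thesis .
    qed
    have term_le: "sqrt (h l) \<le> c * (B * ?E) * inverse (real l ^ 2)" if l: "1 \<le> l" "l \<le> n" for l
    proof -
      define y where "y = a / 2 * real l powr \<eta>"
      have l0: "0 < real l" using l by simp
      have y: "0 < y" using a l0 by (simp add: y_def)
      have "sqrt (h l) \<le> sqrt (B * exp (- a * real l powr \<eta>))"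
        using h l by simp
      also have "\<dots> = sqrt B * exp (- y)"
      proof -
        have "exp (- a * real l powr \<eta>) = (exp (- y))\<^sup>2"
          unfolding y_def exp_double[symmetric] by simp
        then show ?thesis by (simp add: real_sqrt_mult)
      qed
      also have "\<dots> \<le> B * exp (- y)"
      \<comment> \<open>\<open>B \<ge> 1\<close> allows \<open>sqrt B\<close> to be replaced by
        \<open>B\<close>, the form in which it occurs in the normalising sequence.\<close>
      proof (intro mult_right_mono)
        have "sqrt B \<le> sqrt (B * B)"
          using B by (intro real_sqrt_le_mono) simp
        then show "sqrt B \<le> B" using B by simp
      qed simp
      also have "exp (- y) \<le> exp (s * ln s) * y powr (- s)"
        using powr_le_exp[OF y s] y by (simp add: powr_minus exp_minus field_simps)
      also have "y powr (- s) = 2 powr s * a powr (- s) * inverse (real l ^ 2)"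
      proof -
        have "y powr (- s) = (a / 2) powr (- s) * (real l powr \<eta>) powr (- s)"
          unfolding y_def by (rule powr_mult)
        also have "(real l powr \<eta>) powr (- s) = real l powr (- 2)"
          using eta by (simp add: powr_powr s_def)
        also have "\<dots> = inverse (real l ^ 2)"
          using l0 by (simp add: powr_minus)
        also have "(a / 2) powr (- s) = 2 powr s * a powr (- s)"
          using a by (simp add: powr_divide powr_minus field_simps)
        finally show ?thesis .
      qed
      also have "2 powr s * a powr (- s) * inverse (real l ^ 2) \<le>
          2 powr s * (exp (s / u * ln (s / u)) * ?E) * inverse (real l ^ 2)"
        by (intro mult_right_mono mult_left_mono a_powr) auto
      finally have "sqrt (h l) \<le> B * (exp (s * ln s) * (2 powr s * (exp (s / u * ln (s / u)) * ?E) * inverse (real l ^ 2)))"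
        using B by (simp add: mult_left_mono)
      then show ?thesis
        by (simp add: c_def mult_ac)
    qed
    have "(\<Sum>l=1..n. sqrt (h l)) \<le> (\<Sum>l=1..n. c * (B * ?E) * inverse (real l ^ 2))"
      by (intro sum_mono term_le) auto
    also have "\<dots> = c * (B * ?E) * (\<Sum>l=1..n. inverse (real l ^ 2))"
      by (simp add: sum_distrib_left)
    also have "\<dots> \<le> c * (B * ?E) * D"
      unfolding D_def using B by (intro mult_left_mono sum_le_suminf summ) (auto simp: c_def)
    finally show "(\<Sum>l=1..n. sqrt (h l)) \<le> c * D * (B * ?E)"
      by (simp add: mult_ac)
  qed
qed

text \<open>With \<open>y = \<sigma> / R ^ 3\<close>, which is at least 1 by \<open>R_le\<close>,
  one has \<open>R / \<sigma> \<le> 1 / y\<close>, and a negative power of \<open>y\<close> grows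
  when its exponent is moved from -1 towards 0.\<close>

lemma moderate_scale_le:
  fixes R \<sigma> t \<gamma> :: real
  assumes \<gamma>: "0 \<le> \<gamma>" and R: "1 \<le> R" and \<sigma>: "0 < \<sigma>" and R_le: "R \<le> \<sigma> powr (1/3)" and t: "0 \<le> t"
  shows "t * R / \<sigma> \<le> t * (R powr (- 3) * \<sigma>) powr (- (1 / (1 + 2 * \<gamma>)))"
proof -
  define y where "y = R powr (- 3) * \<sigma>"
  have y_eq: "y = \<sigma> / R ^ 3"
    unfolding y_def using R by (simp add: powr_minus field_simps flip: powr_numeral)
  have "R ^ 3 \<le> (\<sigma> powr (1/3)) ^ 3"
    using R_le R by (intro power_mono) auto
  also have "\<dots> = \<sigma>"
    using \<sigma> by (simp add: powr_power)
  finally have y1: "1 \<le> y"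
    unfolding y_eq using R by simp
  have "R / \<sigma> \<le> R ^ 3 / \<sigma>"
    using R \<sigma> self_le_power[of R 3] by (intro divide_right_mono) auto
  also have "\<dots> = y powr (- 1)"
    unfolding y_eq using R \<sigma> by (simp add: powr_minus)
  also have "\<dots> \<le> y powr (- (1 / (1 + 2 * \<gamma>)))"
    using y1 \<gamma> by (intro powr_mono) auto
  finally show ?thesis
    unfolding y_def[symmetric] times_divide_eq_right[symmetric] using t by (intro mult_left_mono)
qed

theorem theorem2p11:
  fixes M :: "'a measure"
    and N :: "nat \<Rightarrow> nat \<Rightarrow> 'b measure"
    and \<zeta> :: "nat \<Rightarrow> nat \<Rightarrow> 'a \<Rightarrow> 'b"
    and g :: "nat \<Rightarrow> nat \<Rightarrow> 'b \<Rightarrow> real"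
    and \<xi> :: "nat \<Rightarrow> nat \<Rightarrow> 'a \<Rightarrow> real"
    and p q \<epsilon> \<eta> \<gamma> u :: real
    and jj :: "nat \<Rightarrow> nat"
    and a B R t \<sigma> :: "nat \<Rightarrow> real"
    and W :: "nat \<Rightarrow> 'a \<Rightarrow> real"
    and I :: "real \<Rightarrow> real"
    and \<Gamma> :: "real set"
  assumes M: "prob_space M"
    and zeta: "\<And>n j. 1 \<le> j \<Longrightarrow> j \<le> n \<Longrightarrow> \<zeta> n j \<in> M \<rightarrow>\<^sub>M N n j"
    and g: "\<And>n j. 1 \<le> j \<Longrightarrow> j \<le> n \<Longrightarrow> g n j \<in> borel_measurable (N n j)"
    and xi: "\<xi> = (\<lambda>n j \<omega>. g n j (\<zeta> n j \<omega>))"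
    and centered: "\<And>n j. 1 \<le> j \<Longrightarrow> j \<le> n \<Longrightarrow> prob_space.expectation M (\<xi> n j) = 0"
    and bdd: "\<And>n j. 1 \<le> j \<Longrightarrow> j \<le> n \<Longrightarrow> Linf_norm M (\<xi> n j) < \<infinity>"
    and sigma: "\<sigma> = (\<lambda>n. row_sd M (\<xi> n) n)"
    and sigma_lim: "filterlim \<sigma> at_top sequentially"
    and pq: "2 < p" "p < q"
    and eps: "\<epsilon> > 0"
    and jj: "\<And>n. n \<ge> 2 \<Longrightarrow>
               0 < jj n \<and> jj n < n \<and> row_phi M (N n) (\<zeta> n) n (jj n) < 1 / 2 - \<epsilon>"
    and eta: "\<eta> > 0"
    and gamma: "\<gamma> = 1 / \<eta>"
    and a_pos: "\<And>n. n \<ge> 1 \<Longrightarrow> a n > 0"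
    and a_bdd: "Bseq a"
    and B_ge: "\<And>n. n \<ge> 1 \<Longrightarrow> B n \<ge> 1"
    and phi: "\<And>n j. 1 \<le> j \<Longrightarrow> j \<le> n \<Longrightarrow>
               row_phi M (N n) (\<zeta> n) n j \<le> B n * exp (- a n * real j powr \<eta>)"
    and u: "u > 1"
    and R: "R = (\<lambda>n. row_A p q M (N n) (\<zeta> n) (\<xi> n) n *
                      (row_Kinf M (\<xi> n) n * real (jj n) + 1) * B n * exp (a n powr (- u)))"
    and R_small: "R \<in> o(\<lambda>n. \<sigma> n powr (1 / 3))"
    and t_lim: "filterlim t at_top sequentially"
    and t_small: "(\<lambda>n. t n * (R n powr (- 3) * \<sigma> n) powr (- (1 / (1 + 2 * \<gamma>)))) \<longlonglongrightarrow> 0"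
    and W: "W = (\<lambda>n \<omega>. row_sum (\<xi> n) n \<omega> / (\<sigma> n * t n))"
    and I: "I = (\<lambda>x. x\<^sup>2 / 2)"
    and Gamma: "\<Gamma> \<in> sets borel"
  shows "- (INF x\<in>interior \<Gamma>. ereal (I x))
           \<le> liminf (\<lambda>n. ereal (1 / (t n)\<^sup>2) * eln (measure M {\<omega> \<in> space M. W n \<omega> \<in> \<Gamma>}))
       \<and> liminf (\<lambda>n. ereal (1 / (t n)\<^sup>2) * eln (measure M {\<omega> \<in> space M. W n \<omega> \<in> \<Gamma>}))
           \<le> limsup (\<lambda>n. ereal (1 / (t n)\<^sup>2) * eln (measure M {\<omega> \<in> space M. W n \<omega> \<in> \<Gamma>}))
       \<and> limsup (\<lambda>n. ereal (1 / (t n)\<^sup>2) * eln (measure M {\<omega> \<in> space M. W n \<omega> \<in> \<Gamma>}))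
           \<le> - (INF x\<in>closure \<Gamma>. ereal (I x))"
proof -
  interpret prob_space M by (rule M)
  have xi_n: "\<xi> n = (\<lambda>j \<omega>. g n j (\<zeta> n j \<omega>))" for n
    by (simp add: xi)
  have xi_meas: "\<xi> n j \<in> borel_measurable M" if "1 \<le> j" "j \<le> n" for n j
    unfolding xi using zeta[OF that] g[OF that] by measurable
  have u0: "0 < u"
    using u by simp
  \<comment> \<open>\<open>C\<close> depends only on \<open>\<eta>\<close> and \<open>u\<close>,
    hence serves all rows.\<close>
  obtain C where C0: "0 \<le> C" and C: "\<forall>(n :: nat) a B h. 0 < a \<longrightarrow> 1 \<le> B \<longrightarrow>
    (\<forall>l\<in>{1..n}. h l \<le> B * exp (- a * real l powr \<eta>)) \<longrightarrow>
    (\<Sum>l=1..n. sqrt (h l)) \<le> C * (B * exp (a powr (- u)))"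
    using sum_sqrt_stretched_exp[OF eta u0] by blast
  define K where "K n = row_Kinf M (\<xi> n) n" for n
  define H where "H n = (\<Sum>l=1..n. sqrt (row_phi M (N n) (\<zeta> n) n l))" for n
  have K0: "0 \<le> K n" if "1 \<le> n" for n
    unfolding K_def using that by (intro row_Kinf_nonneg xi_meas bdd) auto
  \<comment> \<open>The factors \<open>row_A\<close> and \<open>jj n\<close> are at least 1, so
    \<open>R n\<close> dominates both the essential bound and the mixing sum. The row must have
    \<open>n \<ge> 2\<close>, where \<open>jj n\<close> is positive.\<close>
  have R_ge: "(1 + K n) * (B n * exp (a n powr (- u))) \<le> R n" if n: "2 \<le> n" for n
  proof -
    have "Lr_norm 2 M (\<xi> n 1) \<le> row_K 2 M (\<xi> n) n"
      unfolding row_K_def using n by (intro Max_ge) auto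
    moreover have "0 \<le> Lr_norm 2 M (\<xi> n 1)"
      by (simp add: Lr_norm_def)
    ultimately have "1 * 1 \<le> real (row_r p q M (N n) (\<zeta> n) (\<xi> n) n) * (1 + row_K 2 M (\<xi> n) n)"
      by (intro mult_mono) (auto simp: row_r_def)
    then have A: "1 \<le> row_A p q M (N n) (\<zeta> n) (\<xi> n) n"
      by (simp add: row_A_def)
    have "1 \<le> real (jj n)"
      using jj[OF n] by simp
    then have KJ: "1 + K n \<le> K n * real (jj n) + 1"
      using K0[of n] n mult_left_mono[of 1 "real (jj n)" "K n"] by simp
    have BE: "0 \<le> B n * exp (a n powr (- u))"
      using B_ge[of n] n by simp
    have "1 * (1 + K n) \<le> row_A p q M (N n) (\<zeta> n) (\<xi> n) n * (K n * real (jj n) + 1)"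
      using A KJ K0[of n] n by (intro mult_mono) auto
    then have "(1 + K n) * (B n * exp (a n powr (- u))) \<le>
        row_A p q M (N n) (\<zeta> n) (\<xi> n) n * (K n * real (jj n) + 1) * (B n * exp (a n powr (- u)))"
      using BE by (intro mult_right_mono) auto
    then show ?thesis
      by (simp add: R K_def mult.assoc)
  qed
  have BE1: "1 \<le> B n * exp (a n powr (- u))" if "2 \<le> n" for n
    using mult_mono[of 1 "B n" 1 "exp (a n powr (- u))"] B_ge[of n] that by simp
  have R1: "1 \<le> R n" if n: "2 \<le> n" for n
    using mult_mono[of 1 "1 + K n" 1 "B n * exp (a n powr (- u))"] BE1[OF n] K0[of n] n R_ge[OF n] by simp
  have KH: "K n * (1 + H n) \<le> (1 + C) * R n" if n: "2 \<le> n" for n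
  proof -
    let ?e = "B n * exp (a n powr (- u))"
    have "H n \<le> C * ?e"
      unfolding H_def using a_pos[of n] B_ge[of n] n phi by (intro C[rule_format]) auto
    then have "1 + H n \<le> (1 + C) * ?e"
      using BE1[OF n] by (simp add: algebra_simps)
    then have "K n * (1 + H n) \<le> K n * ((1 + C) * ?e)"
      using K0[of n] n by (intro mult_left_mono) auto
    also have "\<dots> = (1 + C) * (K n * ?e)"
      by simp
    also have "\<dots> \<le> (1 + C) * ((1 + K n) * ?e)"
      using C0 BE1[OF n] by (intro mult_left_mono mult_right_mono) auto
    also have "\<dots> \<le> (1 + C) * R n"
      using R_ge[OF n] C0 by (intro mult_left_mono) auto
    finally show ?thesis .
  qed
  have \<sigma>_pos: "\<forall>\<^sub>F n in sequentially. 0 < \<sigma> n"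
    using sigma_lim by (simp add: filterlim_at_top_dense)
  have t_pos: "\<forall>\<^sub>F n in sequentially. 0 < t n"
    using t_lim by (simp add: filterlim_at_top_dense)
  have R_le: "\<forall>\<^sub>F n in sequentially. R n \<le> \<sigma> n powr (1/3)"
    using landau_o.smallD[OF R_small zero_less_one] by eventually_elim simp
  have ratio: "\<forall>\<^sub>F n in sequentially. t n * R n / \<sigma> n \<le> \<delta>" if \<delta>: "0 < \<delta>" for \<delta>
    using order_tendstoD(2)[OF t_small \<delta>] \<sigma>_pos t_pos R_le eventually_ge_at_top[of 2]
  proof eventually_elim
    case (elim n)
    then show ?case
      using moderate_scale_le[of \<gamma> "R n" "\<sigma> n" "t n"] R1[of n] eta by (simp add: gamma)
  qed
  have laplace: "\<forall>\<^sub>F n in sequentially.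
      exp ((t n)\<^sup>2 * (l\<^sup>2 / 2 - e)) \<le> expectation (\<lambda>\<omega>. exp (l * (t n)\<^sup>2 * W n \<omega>)) \<and>
      expectation (\<lambda>\<omega>. exp (l * (t n)\<^sup>2 * W n \<omega>)) \<le> exp ((t n)\<^sup>2 * (l\<^sup>2 / 2 + e))"
    if e: "0 < e" for e l
  proof -
    \<comment> \<open>The relative error \<open>e'\<close> multiplies \<open>l\<^sup>2\<close>, so
      it is divided by \<open>l\<^sup>2 + 1\<close>, which is positive also for
      \<open>l = 0\<close>; the 1/4 is the range of the Laplace estimate.\<close>
    define e' where "e' = min (1/4) (e / (l\<^sup>2 + 1))"
    have l0: "0 < l\<^sup>2 + 1"
      by (rule add_nonneg_pos) auto
    have e': "0 < e'" "e' \<le> 1/4" and e'_le: "e' \<le> e / (l\<^sup>2 + 1)"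
      unfolding e'_def using e l0 by (simp_all only: min.cobounded1 min.cobounded2) simp
    have le_e: "e' * l\<^sup>2 \<le> e"
    proof -
      have "e' * l\<^sup>2 \<le> e / (l\<^sup>2 + 1) * (l\<^sup>2 + 1)"
        using e l0 e'_le by (intro mult_mono) auto
      then show ?thesis using l0 by simp
    qed
    define c where "c = 5 * ((1 + \<bar>l\<bar>) * (1 + C))"
    have c: "0 < c"
      unfolding c_def using C0 by (intro mult_pos_pos) auto
    \<comment> \<open>Calibrated so that \<open>c * \<delta>\<close> is the smallness threshold of
      \<open>row_laplace_bounds\<close>.\<close>
    define \<delta> where "\<delta> = e' / 100 / c"
    have \<delta>: "0 < \<delta>"
      unfolding \<delta>_def using e' c by (intro divide_pos_pos) auto
    show ?thesis
      using ratio[OF \<delta>] \<sigma>_pos t_pos eventually_ge_at_top[of 2]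
    proof eventually_elim
      case (elim n)
      \<comment> \<open>At this slope the scaled row sum is \<open>l * (t n)\<^sup>2 * W n\<close>
        and its variance is \<open>l\<^sup>2 * (t n)\<^sup>2\<close>.\<close>
      let ?\<theta> = "l * t n / \<sigma> n"
      have n: "1 \<le> n" using elim by simp
      have small: "5 * (\<bar>?\<theta>\<bar> * K n) * (1 + H n) \<le> e' / 100"
      proof -
        have "5 * (\<bar>?\<theta>\<bar> * K n) * (1 + H n) = 5 * \<bar>?\<theta>\<bar> * (K n * (1 + H n))"
          by simp
        also have "\<dots> \<le> 5 * \<bar>?\<theta>\<bar> * ((1 + C) * R n)"
          using elim by (intro mult_left_mono KH) auto
        also have "\<dots> = 5 * (\<bar>l\<bar> * (1 + C)) * (t n * R n / \<sigma> n)"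
          using elim by (simp add: abs_mult)
        also have "\<dots> \<le> c * \<delta>"
          unfolding c_def using elim C0 R1[of n] by (intro mult_mono) auto
        also have "\<dots> = e' / 100"
          using c by (simp add: \<delta>_def)
        finally show ?thesis .
      qed
      have W_eq: "l * (t n)\<^sup>2 * W n \<omega> = ?\<theta> * row_sum (\<xi> n) n \<omega>" for \<omega>
        using elim by (simp add: W power2_eq_square)
      have v: "?\<theta>\<^sup>2 * (row_sd M (\<xi> n) n)\<^sup>2 = l\<^sup>2 * (t n)\<^sup>2"
        using elim by (simp add: sigma power_mult_distrib power_divide)
      have bounds: "expectation (\<lambda>\<omega>. exp (?\<theta> * row_sum (\<xi> n) n \<omega>)) \<le> exp ((1/2 + e') * (l\<^sup>2 * (t n)\<^sup>2))"
        "exp ((1/2 - e') * (l\<^sup>2 * (t n)\<^sup>2)) \<le> expectation (\<lambda>\<omega>. exp (?\<theta> * row_sum (\<xi> n) n \<omega>))"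
        using row_laplace_bounds[where X = "\<xi> n" and Z = "\<zeta> n" and N = "N n" and g = "g n" and \<theta> = ?\<theta>,
            OF n zeta g xi_n centered bdd e' small[unfolded K_def H_def]]
        unfolding v by auto
      have "(t n)\<^sup>2 * (e' * l\<^sup>2) \<le> (t n)\<^sup>2 * e"
        by (intro mult_left_mono le_e) simp
      then have "(1/2 + e') * (l\<^sup>2 * (t n)\<^sup>2) \<le> (t n)\<^sup>2 * (l\<^sup>2 / 2 + e)"
        "(t n)\<^sup>2 * (l\<^sup>2 / 2 - e) \<le> (1/2 - e') * (l\<^sup>2 * (t n)\<^sup>2)"
        by (simp_all add: algebra_simps)
      with bounds show ?case
        unfolding W_eq by (meson exp_le_cancel_iff order_trans)
    qed
  qed
  interpret gaussian_laplace_limit M W t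
  proof
    show "W n \<in> borel_measurable M" for n
      unfolding W row_sum_def
      by (intro borel_measurable_divide borel_measurable_sum borel_measurable_const xi_meas) auto
    show "\<forall>\<^sub>F n in sequentially. expectation (\<lambda>\<omega>. exp (l * (t n)\<^sup>2 * W n \<omega>)) \<le> exp ((t n)\<^sup>2 * (l\<^sup>2 / 2 + e))"
      and "\<forall>\<^sub>F n in sequentially. exp ((t n)\<^sup>2 * (l\<^sup>2 / 2 - e)) \<le> expectation (\<lambda>\<omega>. exp (l * (t n)\<^sup>2 * W n \<omega>))"
      if "0 < e" for e l
      using laplace[OF that, of l] by (auto simp: eventually_conj_iff)
  qed (rule t_lim)
  show ?thesis
    unfolding I using large_deviation_lower[OF Gamma] large_deviation_upper[OF Gamma]
    by (intro conjI Liminf_le_Limsup) auto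
qed

end
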